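(* Let $n\ge 1$ and let $Q\subset\mathbb{R}^n$ be an aperiodic quasicrystal. Then $\mathsf{A}(Q)=\mathsf{A}(\mathfrak{Q})$ is a simple finitely generated group, where $\mathfrak{Q}$ is the étale groupoid associated with $Q$.
   Context: Write $B_R(x)=\{y\in\mathbb{R}^n:\|x-y\|<R\}$. A subset $Q\subset\mathbb{R}^n$ is a quasicrystal if: (1) it is a Delaunay set: there is $R>0$ such that for every $x\in\mathbb{R}^n$ there is $q\in Q$ with $\|x-q\|<R$, and there is $\delta>0$ with $\|q_1-q_2\|>\delta$ for all distinct $q_1,q_2\in Q$; (2) it has finite local complexity: for every $R>0$ the set of sets of the form $(B_R(q)\cap Q)-q$, $q\in Q$, is finite; (3) it is repetitive: for every $R>0$ and $q\in Q$ there is $D>0$ such that for every $x\in\mathbb{R}^n$ there is $p\in Q$ with $\|x-p\|<D$ and $(B_R(p)\cap Q)-p=(B_R(q)\cap Q)-q$. $Q$ is aperiodic if $Q+v=Q$, $v\in\mathbb{R}^n$, implies $v=0$. The hull $\mathcal{Q}$ of $Q$ is the set of all $Q'\subset\mathbb{R}^n$ such that for every $R>0$ there is $q\in Q$ with $B_R(0)\cap Q'=(B_R(q)\cap Q)-q$; it is topologized by the metric $d(Q_1,Q_2)=R^{-1}$, where $R$ is the supremum of $r$ such that $B_r(0)\cap Q_1=B_r(0)\cap Q_2$. For $Q$ aperiodic, $\mathcal{Q}$ is homeomorphic to the Cantor set. The groupoid $\mathfrak{Q}$ consists of pairs $(P,q)$ with $P\in\mathcal{Q}$, $q\in P$, with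 product $(P_1,q_1)(P_2,q_2)=(P_2,q_1+q_2)$, defined iff $P_2-q_2=P_1$. Units are the pairs $(P,0)$, identified with $P\in\mathcal{Q}$; $\mathsf{s}(P,q)=P$ and $\mathsf{r}(P,q)=P-q$. A basis of its topology consists of the sets $\{(P',q): P'\in\mathcal{Q},\ q\in P',\ B_r(0)\cap P'=B_r(0)\cap P\}$, for $(P,q)\in\mathfrak{Q}$, $r>0$. It is an étale groupoid. For an étale groupoid $\mathfrak{G}$ with unit space $\mathfrak{G}^{(0)}$ homeomorphic to the Cantor set: a bisection is a compact open $F\subset\mathfrak{G}$ such that $\mathsf{s}:F\to\mathsf{s}(F)$ and $\mathsf{r}:F\to\mathsf{r}(F)$ are homeomorphisms onto open subsets of $\mathfrak{G}^{(0)}$; subsets are multiplied by $AB=\{ab:a\in A,b\in B, ab\text{ defined}\}$. The topological full group $\mathsf{F}(\mathfrak{G})$ is the group, under multiplication of subsets, of bisections $F$ with $\mathsf{s}(F)=\mathsf{r}(F)=\mathfrak{G}^{(0)}$. A multisection of degree $d$ is a collection $\mathcal{F}=\{F_{i,j}\}_{i,j=1}^d$ of bisections such that $F_{i_2,i_3}F_{i_1,i_2}=F_{i_1,i_3}$ for all $i_1,i_2,i_3$ and the $F_{i,i}$ are pairwise disjoint subsets of $\mathfrak{G}^{(0)}$; with $U=\bigcup_iF_{i,i}$ and $\pi$ a permutation of $\{1,\dots,d\}$ put $\mathcal{F}_\pi=\bigcup_iF_{i,\pi(i)}\cup(\mathfrak{G}^{(0)}\setminus U)\in\mathsf{F}(\mathfrak{G})$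 and $\mathsf{A}(\mathcal{F})=\{\mathcal{F}_\pi:\pi\text{ even}\}$. $\mathsf{A}(\mathfrak{G})$ is the subgroup of $\mathsf{F}(\mathfrak{G})$ generated by all $\mathsf{A}(\mathcal{F})$ for multisections $\mathcal{F}$ of degree $3$. By definition $\mathsf{A}(Q)=\mathsf{A}(\mathfrak{Q})$. *)

theory Defs
  imports
    "HOL-Analysis.Analysis"
    "HOL-Algebra.Generated_Groups"
    "HOL-Combinatorics.Permutations"
begin

section \<open>Quasicrystals\<close>

definition translate :: "real ^ 'n \<Rightarrow> (real ^ 'n) set \<Rightarrow> (real ^ 'n) set" where
  "translate v X = (\<lambda>x. x + v) ` X"

definition patch :: "(real ^ 'n) set \<Rightarrow> real \<Rightarrow> real ^ 'n \<Rightarrow> (real ^ 'n) set" where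
  "patch Q R q = translate (- q) (ball q R \<inter> Q)"

definition delaunay :: "(real ^ 'n) set \<Rightarrow> bool" where
  "delaunay Q \<longleftrightarrow>
     (\<exists>R>0. \<forall>x. \<exists>q\<in>Q. norm (x - q) < R) \<and>
     (\<exists>\<delta>>0. \<forall>q1\<in>Q. \<forall>q2\<in>Q. q1 \<noteq> q2 \<longrightarrow> norm (q1 - q2) > \<delta>)"

definition finite_local_complexity :: "(real ^ 'n) set \<Rightarrow> bool" where
  "finite_local_complexity Q \<longleftrightarrow> (\<forall>R>0. finite (patch Q R ` Q))"

definition repetitive :: "(real ^ 'n) set \<Rightarrow> bool" where
  "repetitive Q \<longleftrightarrow>
     (\<forall>R>0. \<forall>q\<in>Q. \<exists>D>0. \<forall>x. \<exists>p\<in>Q. norm (x - p) < D \<and> patch Q R p = patch Q R q)"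

definition quasicrystal :: "(real ^ 'n) set \<Rightarrow> bool" where
  "quasicrystal Q \<longleftrightarrow> delaunay Q \<and> finite_local_complexity Q \<and> repetitive Q"

definition aperiodic :: "(real ^ 'n) set \<Rightarrow> bool" where
  "aperiodic Q \<longleftrightarrow> (\<forall>v. translate v Q = Q \<longrightarrow> v = 0)"

section \<open>The hull\<close>

definition hull_set :: "(real ^ 'n) set \<Rightarrow> (real ^ 'n) set set" where
  "hull_set Q = {P. \<forall>R>0. \<exists>q\<in>Q. ball 0 R \<inter> P = patch Q R q}"

text \<open>
  For distinct sets the supremum is taken over a nonempty set that is bounded above; for equal
  sets it is infinite, so that the distance is \<open>0\<close>.
\<close>

definition hull_dist :: "(real ^ 'n) set \<Rightarrow> (real ^ 'n) set \<Rightarrow> real" where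
  "hull_dist P1 P2 =
     (if P1 = P2 then 0 else inverse (Sup {r. ball 0 r \<inter> P1 = ball 0 r \<inter> P2}))"

definition hull_topology :: "(real ^ 'n) set \<Rightarrow> (real ^ 'n) set topology" where
  "hull_topology Q = Metric_space.mtopology (hull_set Q) hull_dist"

lemma agree_bdd_above:
  fixes P1 P2 :: "(real ^ 'n) set"
  assumes "P1 \<noteq> P2"
  shows "bdd_above {r. ball 0 r \<inter> P1 = ball 0 r \<inter> P2}"
proof -
  obtain x where x: "(x \<in> P1) \<noteq> (x \<in> P2)"
    using assms by blast
  have "r \<le> norm x" if "ball 0 r \<inter> P1 = ball 0 r \<inter> P2" for r
  proof (rule ccontr)
    assume "\<not> r \<le> norm x"
    then have "x \<in> ball 0 r" by simp
    with that x show False by blast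
  qed
  then show ?thesis by (auto simp: bdd_above_def)
qed

lemma agree_mono:
  fixes P1 P2 :: "(real ^ 'n) set"
  assumes "ball 0 r \<inter> P1 = ball 0 r \<inter> P2" "s \<le> r"
  shows "ball 0 s \<inter> P1 = ball 0 s \<inter> P2"
proof -
  have "ball (0 :: real ^ 'n) s \<subseteq> ball 0 r"
    using assms(2) by (rule subset_ball)
  with assms(1) show ?thesis by blast
qed

lemma agree_less_Sup:
  fixes P1 P2 :: "(real ^ 'n) set"
  assumes "r < Sup {r. ball 0 r \<inter> P1 = ball 0 r \<inter> P2}"
  shows "ball 0 r \<inter> P1 = ball 0 r \<inter> P2"
proof -
  have "{r. ball 0 r \<inter> P1 = ball 0 r \<inter> P2} \<noteq> {}"
    by (auto intro!: exI[of _ 0])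
  from less_cSupE[OF assms this] obtain s
    where "ball 0 s \<inter> P1 = ball 0 s \<inter> P2" "r < s" by blast
  then show ?thesis
    by (meson agree_mono less_imp_le)
qed

lemma hull_ball_delta:
  fixes Q :: "(real ^ 'n) set"
  assumes "delaunay Q"
  obtains \<delta> where "\<delta> > 0" "\<And>P. P \<in> hull_set Q \<Longrightarrow> ball 0 \<delta> \<inter> P = {0}"
proof -
  obtain \<delta> where \<delta>: "\<delta> > 0"
      "\<And>q1 q2. q1 \<in> Q \<Longrightarrow> q2 \<in> Q \<Longrightarrow> q1 \<noteq> q2 \<Longrightarrow> norm (q1 - q2) > \<delta>"
    using assms unfolding delaunay_def by blast
  have "ball 0 \<delta> \<inter> P = {0}" if P: "P \<in> hull_set Q" for P
  proof -
    obtain q where q: "q \<in> Q" "ball 0 \<delta> \<inter> P = patch Q \<delta> q"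
      using P \<delta>(1) unfolding hull_set_def by blast
    have "ball q \<delta> \<inter> Q = {q}"
    proof -
      have "x = q" if "x \<in> ball q \<delta>" "x \<in> Q" for x
        using \<delta>(2)[of q x] q(1) that by (force simp: dist_norm)
      then show ?thesis using q(1) \<delta>(1) by auto
    qed
    then show ?thesis
      using q(2) by (simp add: patch_def translate_def)
  qed
  with \<delta>(1) show thesis by (rule that)
qed

lemma hull_Metric_space:
  fixes Q :: "(real ^ 'n) set"
  assumes "delaunay Q"
  shows "Metric_space (hull_set Q) hull_dist"
proof -
  let ?S = "\<lambda>P1 P2 :: (real ^ 'n) set. {r. ball 0 r \<inter> P1 = ball 0 r \<inter> P2}"
  obtain \<delta> where \<delta>: "\<delta> > 0" "\<And>P. P \<in> hull_set Q \<Longrightarrow> ball 0 \<delta> \<inter> P = {0}"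
    using hull_ball_delta[OF assms] by blast
  have nonneg: "0 \<le> Sup (?S P1 P2)" if "P1 \<noteq> P2" for P1 P2
    by (rule cSup_upper[OF _ agree_bdd_above[OF that]]) simp
  have pos: "0 < Sup (?S P1 P2)" if "P1 \<in> hull_set Q" "P2 \<in> hull_set Q" "P1 \<noteq> P2" for P1 P2
  proof -
    have "\<delta> \<in> ?S P1 P2" using \<delta>(2) that by simp
    then have "\<delta> \<le> Sup (?S P1 P2)"
      by (rule cSup_upper[OF _ agree_bdd_above[OF that(3)]])
    with \<delta>(1) show ?thesis by simp
  qed
  show ?thesis
  proof
    show "0 \<le> hull_dist x y" for x y :: "(real ^ 'n) set"
      using nonneg by (simp add: hull_dist_def)
    show "hull_dist x y = hull_dist y x" for x y :: "(real ^ 'n) set"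
      by (simp add: hull_dist_def eq_commute)
    show "hull_dist x y = 0 \<longleftrightarrow> x = y" if "x \<in> hull_set Q" "y \<in> hull_set Q" for x y
      using pos[OF that] by (cases "x = y") (auto simp: hull_dist_def)
    show "hull_dist x z \<le> hull_dist x y + hull_dist y z"
      if "x \<in> hull_set Q" "y \<in> hull_set Q" "z \<in> hull_set Q" for x y z
    proof (cases "x = y \<or> y = z \<or> x = z")
      case True
      then show ?thesis
        using nonneg by (auto simp: hull_dist_def)
    next
      case False
      let ?a = "Sup (?S x y)" and ?b = "Sup (?S y z)" and ?c = "Sup (?S x z)"
      have p: "0 < ?a" "0 < ?b" "0 < ?c"
        using pos that False by auto
      have "min ?a ?b \<le> ?c"
      proof (rule dense_le)
        fix r assume "r < min ?a ?b"
        then have "r \<in> ?S x z"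
          using agree_less_Sup[of r x y] agree_less_Sup[of r y z] by simp
        then show "r \<le> ?c"
          using False by (intro cSup_upper agree_bdd_above) auto
      qed
      then have "inverse ?c \<le> inverse (min ?a ?b)"
        using p by (intro le_imp_inverse_le) auto
      also have "\<dots> \<le> inverse ?a + inverse ?b"
        using p by (auto simp: min_def)
      finally show ?thesis
        using False by (simp add: hull_dist_def)
    qed
  qed
qed

lemma openin_hull:
  fixes Q :: "(real ^ 'n) set"
  assumes "delaunay Q"
  shows "openin (hull_topology Q) U \<longleftrightarrow> U \<subseteq> hull_set Q \<and>
    (\<forall>P\<in>U. \<exists>r>0. \<forall>P'\<in>hull_set Q. ball 0 r \<inter> P' = ball 0 r \<inter> P \<longrightarrow> P' \<in> U)"
proof -
  interpret M: Metric_space "hull_set Q" hull_dist by (rule hull_Metric_space[OF assms])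
  have 1: "\<exists>r>0. \<forall>P'\<in>hull_set Q. ball 0 r \<inter> P' = ball 0 r \<inter> P \<longrightarrow> P' \<in> U"
    if "e > 0" "M.mball P e \<subseteq> U" "P \<in> hull_set Q" for P e
  proof (intro exI[of _ "2/e"] conjI ballI impI)
    show "2/e>0" using that by simp
    fix P' assume P': "P' \<in> hull_set Q" "ball 0 (2/e) \<inter> P' = ball 0 (2/e) \<inter> P"
    have "hull_dist P P' < e"
    proof (cases "P = P'")
      case False
      have "2/e \<le> Sup {r. ball 0 r \<inter> P = ball 0 r \<inter> P'}"
        by (rule cSup_upper[OF _ agree_bdd_above[OF False]]) (use P' in auto)
      then have "inverse (Sup {r. ball 0 r \<inter> P = ball 0 r \<inter> P'}) \<le> inverse (2/e)"
        using that by (intro le_imp_inverse_le) auto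
      also have "\<dots> < e" using that by simp
      finally show ?thesis using False by (simp add: hull_dist_def)
    qed (use that in \<open>simp add: hull_dist_def\<close>)
    then show "P' \<in> U" using that P' by auto
  qed
  have 2: "\<exists>e>0. M.mball P e \<subseteq> U"
    if "r > 0" "\<forall>P'\<in>hull_set Q. ball 0 r \<inter> P' = ball 0 r \<inter> P \<longrightarrow> P' \<in> U" "P \<in> U" for P r
  proof (intro exI[of _ "1/r"] conjI subsetI)
    show "1/r > 0" using that by simp
    fix P' assume P': "P' \<in> M.mball P (1/r)"
    show "P' \<in> U"
    proof (cases "P = P'")
      case False
      let ?S = "Sup {r. ball 0 r \<inter> P = ball 0 r \<inter> P'}"
      have "?S \<noteq> 0" using P' False M.zero[of P P'] by (auto simp: hull_dist_def)
      moreover have "?S \<ge> 0" using P' False M.nonneg[of P P'] by (auto simp: hull_dist_def)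
      ultimately have "0 < ?S" by linarith
      moreover have "inverse ?S < 1/r" using P' False by (simp add: hull_dist_def)
      ultimately have "r < ?S" using that(1) by (simp add: field_simps)
      then show ?thesis using agree_less_Sup[of r P P'] that P' by auto
    qed (use that in auto)
  qed
  show ?thesis
    unfolding hull_topology_def M.openin_mtopology using 1 2 by (meson subsetD)
qed

lemma topspace_hull: "delaunay Q \<Longrightarrow> topspace (hull_topology Q) = hull_set Q"
  by (simp add: Metric_space.topspace_mtopology hull_Metric_space hull_topology_def)

lemma zero_in_hull: "delaunay Q \<Longrightarrow> P \<in> hull_set Q \<Longrightarrow> 0 \<in> P"
  by (metis Int_iff hull_ball_delta insertI1)

section \<open>Groupoids and their full groups\<close>

text \<open>
  The unit space is kept as a space of its own, together with the map \<open>unit_arrow\<close> identifying it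
  with the set of unit arrows. The product \<open>gmult G a b\<close> is meaningful only if
  \<open>src G a = rng G b\<close>.
\<close>

record ('g, 'u) top_groupoid =
  arrow_space :: "'g topology"
  unit_space :: "'u topology"
  unit_arrow :: "'u \<Rightarrow> 'g"
  src :: "'g \<Rightarrow> 'u"
  rng :: "'g \<Rightarrow> 'u"
  gmult :: "'g \<Rightarrow> 'g \<Rightarrow> 'g"

definition unit_arrows :: "('g, 'u) top_groupoid \<Rightarrow> 'g set" where
  "unit_arrows G = unit_arrow G ` topspace (unit_space G)"

definition bisection :: "('g, 'u) top_groupoid \<Rightarrow> 'g set \<Rightarrow> bool" where
  "bisection G F \<longleftrightarrow>
     compactin (arrow_space G) F \<and> openin (arrow_space G) F \<and>
     openin (unit_space G) (src G ` F) \<and>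
     homeomorphic_map (subtopology (arrow_space G) F)
       (subtopology (unit_space G) (src G ` F)) (src G) \<and>
     openin (unit_space G) (rng G ` F) \<and>
     homeomorphic_map (subtopology (arrow_space G) F)
       (subtopology (unit_space G) (rng G ` F)) (rng G)"

definition gset_mult :: "('g, 'u) top_groupoid \<Rightarrow> 'g set \<Rightarrow> 'g set \<Rightarrow> 'g set" where
  "gset_mult G A B = {gmult G a b | a b. a \<in> A \<and> b \<in> B \<and> src G a = rng G b}"

definition full_group :: "('g, 'u) top_groupoid \<Rightarrow> 'g set monoid" where
  "full_group G =
     \<lparr>carrier = {F. bisection G F \<and> src G ` F = topspace (unit_space G)
                      \<and> rng G ` F = topspace (unit_space G)},
      mult = gset_mult G,
      one = unit_arrows G\<rparr>"

definition multisection ::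
    "('g, 'u) top_groupoid \<Rightarrow> nat \<Rightarrow> (nat \<Rightarrow> nat \<Rightarrow> 'g set) \<Rightarrow> bool" where
  "multisection G d F \<longleftrightarrow>
     (\<forall>i\<in>{1..d}. \<forall>j\<in>{1..d}. bisection G (F i j)) \<and>
     (\<forall>i1\<in>{1..d}. \<forall>i2\<in>{1..d}. \<forall>i3\<in>{1..d}.
        gset_mult G (F i2 i3) (F i1 i2) = F i1 i3) \<and>
     (\<forall>i\<in>{1..d}. F i i \<subseteq> unit_arrows G) \<and>
     (\<forall>i\<in>{1..d}. \<forall>j\<in>{1..d}. i \<noteq> j \<longrightarrow> F i i \<inter> F j j = {})"

definition multisection_perm ::
    "('g, 'u) top_groupoid \<Rightarrow> nat \<Rightarrow> (nat \<Rightarrow> nat \<Rightarrow> 'g set) \<Rightarrow> (nat \<Rightarrow> nat) \<Rightarrow> 'g set" where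
  "multisection_perm G d F \<pi> =
     (\<Union>i\<in>{1..d}. F i (\<pi> i)) \<union> (unit_arrows G - (\<Union>i\<in>{1..d}. F i i))"

definition multisection_alt ::
    "('g, 'u) top_groupoid \<Rightarrow> nat \<Rightarrow> (nat \<Rightarrow> nat \<Rightarrow> 'g set) \<Rightarrow> 'g set set" where
  "multisection_alt G d F = {multisection_perm G d F \<pi> | \<pi>. \<pi> permutes {1..d} \<and> evenperm \<pi>}"

definition alternating_full_group :: "('g, 'u) top_groupoid \<Rightarrow> 'g set monoid" where
  "alternating_full_group G =
     (full_group G)\<lparr>carrier :=
        generate (full_group G) (\<Union>F\<in>{F. multisection G 3 F}. multisection_alt G 3 F)\<rparr>"

section \<open>The groupoid of a quasicrystal\<close>

definition qc_arrows :: "(real ^ 'n) set \<Rightarrow> ((real ^ 'n) set \<times> (real ^ 'n)) set" where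
  "qc_arrows Q = {(P, q). P \<in> hull_set Q \<and> q \<in> P}"

definition qc_basic_open ::
    "(real ^ 'n) set \<Rightarrow> (real ^ 'n) set \<Rightarrow> real ^ 'n \<Rightarrow> real
     \<Rightarrow> ((real ^ 'n) set \<times> (real ^ 'n)) set" where
  "qc_basic_open Q P q r =
     {(P', q) | P'. P' \<in> hull_set Q \<and> q \<in> P' \<and> ball 0 r \<inter> P' = ball 0 r \<inter> P}"

definition qc_arrow_topology :: "(real ^ 'n) set \<Rightarrow> ((real ^ 'n) set \<times> (real ^ 'n)) topology" where
  "qc_arrow_topology Q =
     topology_generated_by {qc_basic_open Q P q r | P q r. (P, q) \<in> qc_arrows Q \<and> r > 0}"

definition qc_groupoid ::
    "(real ^ 'n) set \<Rightarrow> ((real ^ 'n) set \<times> (real ^ 'n), (real ^ 'n) set) top_groupoid" where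
  "qc_groupoid Q =
     \<lparr>arrow_space = qc_arrow_topology Q,
      unit_space = hull_topology Q,
      unit_arrow = (\<lambda>P. (P, 0)),
      src = (\<lambda>(P, q). P),
      rng = (\<lambda>(P, q). translate (- q) P),
      gmult = (\<lambda>(P1, q1) (P2, q2). (P2, q1 + q2))\<rparr>"

lemma qc_basic_open_mono: "s \<le> r \<Longrightarrow> qc_basic_open Q P q r \<subseteq> qc_basic_open Q P q s"
  unfolding qc_basic_open_def using agree_mono by blast

lemma openin_arrows:
  fixes Q :: "(real ^ 'n) set"
  shows "openin (qc_arrow_topology Q) W \<longleftrightarrow> W \<subseteq> qc_arrows Q \<and>
    (\<forall>(P,q)\<in>W. \<exists>r>0. qc_basic_open Q P q r \<subseteq> W)" (is "_ \<longleftrightarrow> ?R W")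
proof
  assume "openin (qc_arrow_topology Q) W"
  then have "generate_topology_on {qc_basic_open Q P q r | P q r. (P, q) \<in> qc_arrows Q \<and> r > 0} W"
    unfolding qc_arrow_topology_def by (rule openin_topology_generated_by)
  then show "?R W"
  proof (induction rule: generate_topology_on.induct)
    case (Int a b)
    have "\<exists>r>0. qc_basic_open Q P q r \<subseteq> a \<inter> b" if "(P,q) \<in> a \<inter> b" for P q
    proof -
      have "\<exists>r>0. qc_basic_open Q P q r \<subseteq> a" "\<exists>r>0. qc_basic_open Q P q r \<subseteq> b"
        using Int.IH that by auto
      then obtain r s where "r>0" "s>0" "qc_basic_open Q P q r \<subseteq> a" "qc_basic_open Q P q s \<subseteq> b"
        by metis
      then have "max r s > 0" "qc_basic_open Q P q (max r s) \<subseteq> a \<inter> b"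
        using qc_basic_open_mono[of r "max r s" Q P q] qc_basic_open_mono[of s "max r s" Q P q] by auto
      then show ?thesis by blast
    qed
    then show ?case using Int.IH(1) by auto
  next
    case (UN K)
    have "\<exists>r>0. qc_basic_open Q P q r \<subseteq> \<Union>K" if "(P,q) \<in> k" "k \<in> K" for P q k
    proof -
      have "\<exists>r>0. qc_basic_open Q P q r \<subseteq> k" using UN.IH[OF that(2)] that(1) by auto
      then show ?thesis using that(2) by (meson Union_upper subset_trans)
    qed
    moreover have "\<Union>K \<subseteq> qc_arrows Q" using UN.IH by (intro Union_least) blast
    ultimately show ?case by auto
  next
    case (Basis s)
    then obtain P q r where "s = qc_basic_open Q P q r" "r > 0" by blast
    moreover have "qc_basic_open Q P' q' r \<subseteq> s" if "(P',q') \<in> s" for P' q'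
      using that calculation by (auto simp: qc_basic_open_def)
    moreover have "s \<subseteq> qc_arrows Q" using calculation(1) by (auto simp: qc_basic_open_def qc_arrows_def)
    ultimately show ?case by blast
  qed auto
next
  assume R: "?R W"
  have "openin (qc_arrow_topology Q) (qc_basic_open Q P q r)" if "(P,q) \<in> W" "r > 0" for P q r
    unfolding qc_arrow_topology_def using that R by (intro topology_generated_by_Basis) auto
  moreover have "(P,q) \<in> qc_basic_open Q P q r" if "(P,q) \<in> W" for P q r
    using that R by (auto simp: qc_basic_open_def qc_arrows_def)
  ultimately show "openin (qc_arrow_topology Q) W"
    using R by (subst openin_subopen) fast
qed

lemma topspace_arrows: "topspace (qc_arrow_topology Q) = qc_arrows Q"
proof (rule antisym)
  show "topspace (qc_arrow_topology Q) \<subseteq> qc_arrows Q" using openin_arrows openin_topspace by blast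
  have "openin (qc_arrow_topology Q) (qc_arrows Q)"
    unfolding openin_arrows by (auto intro!: exI[of _ 1] simp: qc_basic_open_def qc_arrows_def)
  then show "qc_arrows Q \<subseteq> topspace (qc_arrow_topology Q)" by (rule openin_subset)
qed

text \<open>The identification of a unit \<open>(P, 0)\<close> with \<open>P\<close> is compatible with the two topologies.\<close>

lemma unit_arrow_embedding:
  fixes Q :: "(real ^ 'n) set"
  assumes D: "delaunay Q"
  shows "embedding_map (hull_topology Q) (qc_arrow_topology Q) (\<lambda>P. (P,0))"
proof (rule injective_open_imp_embedding_map)
  note z = zero_in_hull[OF D]
  show "continuous_map (hull_topology Q) (qc_arrow_topology Q) (\<lambda>P. (P, 0))"
    unfolding continuous_map topspace_arrows topspace_hull[OF D]
  proof (intro conjI allI impI)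
    show "(\<lambda>P. (P, 0)) ` hull_set Q \<subseteq> qc_arrows Q" using z by (auto simp: qc_arrows_def)
    fix W :: "((real ^ 'n) set \<times> (real ^ 'n)) set" assume W: "openin (qc_arrow_topology Q) W"
    show "openin (hull_topology Q) {x \<in> hull_set Q. (x, 0) \<in> W}"
      unfolding openin_hull[OF D]
    proof (intro conjI ballI)
      fix P assume "P \<in> {x \<in> hull_set Q. (x, 0) \<in> W}"
      then obtain r where "r>0" "qc_basic_open Q P 0 r \<subseteq> W" using W unfolding openin_arrows by blast
      then show "\<exists>r>0. \<forall>P'\<in>hull_set Q. ball 0 r \<inter> P' = ball 0 r \<inter> P \<longrightarrow> P' \<in> {x \<in> hull_set Q. (x, 0) \<in> W}"
        using z unfolding qc_basic_open_def by blast
    qed auto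
  qed
  show "open_map (hull_topology Q) (qc_arrow_topology Q) (\<lambda>P. (P, 0))"
    unfolding open_map_def
  proof (intro allI impI)
    fix U assume U: "openin (hull_topology Q) U"
    show "openin (qc_arrow_topology Q) ((\<lambda>P. (P, 0)) ` U)"
      unfolding openin_arrows
    proof (intro conjI ballI)
      show "(\<lambda>P. (P, 0)) ` U \<subseteq> qc_arrows Q" using U z unfolding openin_hull[OF D] by (auto simp: qc_arrows_def)
      fix x :: "(real ^ 'n) set \<times> (real ^ 'n)" assume "x \<in> (\<lambda>P. (P, 0)) ` U"
      then obtain P where P: "x = (P,0)" "P \<in> U" by blast
      then obtain r where "r>0" "\<forall>P'\<in>hull_set Q. ball 0 r \<inter> P' = ball 0 r \<inter> P \<longrightarrow> P' \<in> U"
        using U unfolding openin_hull[OF D] by blast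
      then show "case x of (P, q) \<Rightarrow> \<exists>r>0. qc_basic_open Q P q r \<subseteq> (\<lambda>P. (P, 0)) ` U"
        unfolding P(1) by (auto simp: qc_basic_open_def intro!: exI[of _ r])
    qed
  qed
  show "inj_on (\<lambda>P. (P, 0)) (topspace (hull_topology Q))" by (auto simp: inj_on_def)
qed

definition qc_alternating_group ::
    "(real ^ 'n) set \<Rightarrow> ((real ^ 'n) set \<times> (real ^ 'n)) set monoid" where
  "qc_alternating_group Q = alternating_full_group (qc_groupoid Q)"

section \<open>Simple and finitely generated groups\<close>

text \<open>
  The locale \<open>simple_group\<close> of HOL-Algebra requires \<open>order G > 1\<close>, which excludes all infinite
  groups because \<open>order\<close> is \<open>0\<close> for them.
\<close>

definition is_simple_group :: "('a, 'b) monoid_scheme \<Rightarrow> bool" where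
  "is_simple_group G \<longleftrightarrow>
     group G \<and> carrier G \<noteq> {\<one>\<^bsub>G\<^esub>} \<and> (\<forall>N. N \<lhd> G \<longrightarrow> N = carrier G \<or> N = {\<one>\<^bsub>G\<^esub>})"

definition finitely_generated_group :: "('a, 'b) monoid_scheme \<Rightarrow> bool" where
  "finitely_generated_group G \<longleftrightarrow>
     group G \<and> (\<exists>S. finite S \<and> S \<subseteq> carrier G \<and> generate G S = carrier G)"

end

theory Submission imports Defs begin

text \<open>
  Aperiodicity and repetitivity make every element of the hull aperiodic, so the groupoid is
  principal and an element of the full group is a permutation of the hull that locally is a
  translation. The alternating full group is then generated by three-cycles
  \<open>P - a \<mapsto> P - b \<mapsto> P - c \<mapsto> P - a\<close>, with \<open>P\<close> ranging over a clopen set \<open>D\<close> whose translates by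
  \<open>- a\<close>, \<open>- b\<close>, \<open>- c\<close> are disjoint. Everything rests on one identity: the commutator of a
  three-cycle over \<open>U\<close> along \<open>a, b, c\<close> and one over \<open>V\<close> along \<open>a, d, e\<close> is a three-cycle over
  \<open>U \<inter> V\<close> along \<open>a, b, d\<close>.

  Finite generation: start with the three-cycles over cylinders of a fixed large radius and
  with bounded \<open>a, b, c\<close>. Since every patch of larger radius is a union of translates of
  patches of the given radius, commutators produce three-cycles over arbitrarily small clopen
  sets, and chains of overlapping balls give arbitrary \<open>a, b, c\<close>.

  Simplicity: an element \<open>g \<noteq> 1\<close> of a normal subgroup \<open>N\<close> moves some clopen \<open>U\<close> off itself, hence
  \<open>N\<close> contains the commutators of all pairs of elements supported in \<open>U\<close>, so it contains
  three-cycles supported in \<open>U\<close>. By minimality each orbit meets \<open>U\<close> infinitely often, and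
  further commutators yield all three-cycles over sufficiently small sets.
\<close>

section \<open>Translations and three-cycles\<close>

text \<open>A three-cycle is recorded by an index set and three displacements, none of which has to
  be zero. Shifting the index set and the displacements together changes nothing, so cycles anchored
  at different points of one orbit can be compared and multiplied. The commutator identity is what
  shapes the generation argument: besides the three displacements of the result it consumes two
  auxiliary ones, all five distinct. Every overlap of point sets must therefore contain five points,
  and this dictates the radii: if \<open>R\<close> is such that every ball of radius
  \<open>R\<close> meets each element of the hull, then balls of radius \<open>13 * R\<close> around
  points less than \<open>3 * R\<close> apart share five points of it, and \<open>16 * R\<close>
  contains both balls when one of them is centred at the origin. Compactness of the hull enters only
  through \<open>uniform_radius\<close>: a property that passes to subsets and holds on a small
  cylinder around each point holds on all cylinders of one radius. It gives separation of
  translates, the description of clopen sets, and the passage from local to global membership in a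
  normal subgroup. Permutations act on all subsets of the space, so composition needs no carrier;
  the groupoid returns only through \<open>perm_graph\<close>.\<close>

lemma mem_translate [simp]: "x \<in> translate v X \<longleftrightarrow> x - v \<in> X"
proof -
  have "x = y + v \<longleftrightarrow> y = x - v" for y by (auto simp: algebra_simps)
  then show ?thesis by (simp add: translate_def image_iff)
qed

lemma translate_translate [simp]: "translate u (translate v X) = translate (u + v) X"
  by (auto simp: algebra_simps)

lemma translate_0 [simp]: "translate 0 X = X"
  by auto

lemma translate_eq_iff [simp]: "translate u X = translate u Y \<longleftrightarrow> X = Y"
  by (metis translate_translate translate_0 left_minus)

text \<open>\<open>A\<close> is an index set, not the support: \<open>translate a x \<in> A\<close>
  says that \<open>x\<close> is \<open>P - a\<close> with \<open>P\<close> in \<open>A\<close>, and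
  \<open>x\<close> then goes to \<open>P - b\<close>. The order of the tests is immaterial once the
  displacements are distinct and \<open>A\<close> is separated along them.\<close>

definition three_cycle ::
    "(real ^ 'n) set set \<Rightarrow> real ^ 'n \<Rightarrow> real ^ 'n \<Rightarrow> real ^ 'n \<Rightarrow> (real ^ 'n) set \<Rightarrow> (real ^ 'n) set" where
  "three_cycle A a b c x =
     (if translate a x \<in> A then translate (a - b) x
      else if translate b x \<in> A then translate (b - c) x
      else if translate c x \<in> A then translate (c - a) x else x)"

text \<open>Pairwise disjointness of the translates \<open>A - a\<close> with \<open>a\<close> in
  \<open>E\<close>, stated pointwise.\<close>

definition separated :: "(real ^ 'n) set set \<Rightarrow> (real ^ 'n) set \<Rightarrow> bool" where
  "separated A E \<longleftrightarrow>
     (\<forall>x. \<forall>a\<in>E. \<forall>b\<in>E. translate a x \<in> A \<longrightarrow> translate b x \<in> A \<longrightarrow> a = b)"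

lemma separated_mono: "separated A E \<Longrightarrow> B \<subseteq> A \<Longrightarrow> F \<subseteq> E \<Longrightarrow> separated B F"
  unfolding separated_def by blast

lemma separatedD:
  "separated A E \<Longrightarrow> a \<in> E \<Longrightarrow> b \<in> E \<Longrightarrow> translate a x \<in> A \<Longrightarrow> translate b x \<in> A \<Longrightarrow> a = b"
  unfolding separated_def by blast

text \<open>The pair \<open>W\<close>, \<open>E\<close> is ambient: inside it, products of cycles
  over different subsets \<open>U\<close> of \<open>W\<close> can be evaluated at the points
  \<open>P - q\<close> as permutations of the letters \<open>q\<close> in \<open>E\<close>, with
  \<open>P\<close> held fixed.\<close>

lemma three_cycle_eval:
  assumes "separated W E" "{a, b, c} \<subseteq> E" "distinct [a, b, c]" "U \<subseteq> W" "P \<in> W" "q \<in> E"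
  shows "three_cycle U a b c (translate (- q) P) =
    (if P \<in> U then if q = a then translate (- b) P else if q = b then translate (- c) P
       else if q = c then translate (- a) P else translate (- q) P
     else translate (- q) P)"
proof -
  have *: "translate (p - q) P \<in> U \<longleftrightarrow> p = q \<and> P \<in> U" if "p \<in> E" for p
    using separatedD[OF assms(1) that assms(6), of "translate (- q) P"] assms(4,5) by auto
  show ?thesis
    using assms(2,3) by (auto simp: three_cycle_def *)
qed

lemma translate_cases:
  obtains P q where "P \<in> W" "q \<in> E" "x = translate (- q) P"
  | "\<And>q. q \<in> E \<Longrightarrow> translate q x \<notin> W"
proof (cases "\<exists>q\<in>E. translate q x \<in> W")
  case True
  then obtain q where "q \<in> E" "translate q x \<in> W" by blast
  then show ?thesis using that(1)[of "translate q x" q] by simp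
next
  case False
  then show ?thesis using that(2) by blast
qed

lemma three_cycle_eqI:
  assumes "\<And>P q. P \<in> W \<Longrightarrow> q \<in> E \<Longrightarrow> f (translate (- q) P) = g (translate (- q) P)"
    and "\<And>x. \<forall>q\<in>E. translate q x \<notin> W \<Longrightarrow> f x = g x"
  shows "f = g"
proof
  fix x
  show "f x = g x" by (rule translate_cases[of W E x]) (use assms in auto)
qed

lemma three_cycle_evals:
  assumes "separated W E" "distinct [a, b, c]" "{a, b, c} \<subseteq> E" "U \<subseteq> W" "P \<in> W"
  shows "three_cycle U a b c (translate (- a) P) = translate (- (if P \<in> U then b else a)) P"
    "three_cycle U a b c (translate (- b) P) = translate (- (if P \<in> U then c else b)) P"
    "three_cycle U a b c (translate (- c) P) = translate (- (if P \<in> U then a else c)) P"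
    "q \<in> E \<Longrightarrow> q \<notin> {a, b, c} \<Longrightarrow> three_cycle U a b c (translate (- q) P) = translate (- q) P"
proof -
  have "a \<noteq> b" "b \<noteq> a" "a \<noteq> c" "c \<noteq> a" "b \<noteq> c" "c \<noteq> b" using assms(2) by auto
  then show "three_cycle U a b c (translate (- a) P) = translate (- (if P \<in> U then b else a)) P"
    "three_cycle U a b c (translate (- b) P) = translate (- (if P \<in> U then c else b)) P"
    "three_cycle U a b c (translate (- c) P) = translate (- (if P \<in> U then a else c)) P"
    "q \<in> E \<Longrightarrow> q \<notin> {a, b, c} \<Longrightarrow> three_cycle U a b c (translate (- q) P) = translate (- q) P"
    using assms(3) by (simp_all add: three_cycle_eval[OF assms(1,3,2,4,5)])
qed

text \<open>For fixed \<open>P\<close> this is a computation with five letters. If \<open>P\<close>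
  lies in both sets, the left side is the commutator of the cycles (a b c) and (a d e), which is (a
  b d). If \<open>P\<close> lies in only one of them, the two factors over the other set act
  trivially and the remaining two cancel.\<close>

lemma three_cycle_commutator:
  assumes sep: "separated (U \<union> V) {a, b, c, d, e}" and dist: "distinct [a, b, c, d, e]"
  shows "three_cycle U a b c \<circ> (three_cycle V a d e \<circ> (three_cycle U a c b \<circ> three_cycle V a e d)) =
    three_cycle (U \<inter> V) a b d"
proof (rule three_cycle_eqI[of "U \<union> V" "{a, b, c, d, e}"])
  fix P q assume P: "P \<in> U \<union> V" and q: "q \<in> {a, b, c, d, e}"
  note ev = three_cycle_evals[OF sep _ _ _ P]
  have UV: "U \<subseteq> U \<union> V" "V \<subseteq> U \<union> V" "U \<inter> V \<subseteq> U \<union> V" by auto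
  have dis: "distinct [a, b, c]" "distinct [a, c, b]" "distinct [a, d, e]" "distinct [a, e, d]"
      "distinct [a, b, d]" using dist by auto
  have sub: "{a, b, c} \<subseteq> {a, b, c, d, e}" "{a, c, b} \<subseteq> {a, b, c, d, e}"
    "{a, d, e} \<subseteq> {a, b, c, d, e}" "{a, e, d} \<subseteq> {a, b, c, d, e}" "{a, b, d} \<subseteq> {a, b, c, d, e}" by auto
  note evs = ev(1-3)[OF dis(1) sub(1) UV(1)] ev(1-3)[OF dis(2) sub(2) UV(1)]
    ev(1-3)[OF dis(3) sub(3) UV(2)] ev(1-3)[OF dis(4) sub(4) UV(2)] ev(1-3)[OF dis(5) sub(5) UV(3)]
  have fixed: "three_cycle U a b c (translate (- d) P) = translate (- d) P"
    "three_cycle U a b c (translate (- e) P) = translate (- e) P"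
    "three_cycle U a c b (translate (- d) P) = translate (- d) P"
    "three_cycle U a c b (translate (- e) P) = translate (- e) P"
    "three_cycle V a d e (translate (- b) P) = translate (- b) P"
    "three_cycle V a d e (translate (- c) P) = translate (- c) P"
    "three_cycle V a e d (translate (- b) P) = translate (- b) P"
    "three_cycle V a e d (translate (- c) P) = translate (- c) P"
    "three_cycle (U \<inter> V) a b d (translate (- c) P) = translate (- c) P"
    "three_cycle (U \<inter> V) a b d (translate (- e) P) = translate (- e) P"
    using dist by (auto intro!: ev(4)[OF dis(1) sub(1) UV(1)] ev(4)[OF dis(2) sub(2) UV(1)]
        ev(4)[OF dis(3) sub(3) UV(2)] ev(4)[OF dis(4) sub(4) UV(2)] ev(4)[OF dis(5) sub(5) UV(3)])
  show "(three_cycle U a b c \<circ> (three_cycle V a d e \<circ> (three_cycle U a c b \<circ> three_cycle V a e d)))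
      (translate (- q) P) = three_cycle (U \<inter> V) a b d (translate (- q) P)"
    using q by (elim insertE emptyE; cases "P \<in> U"; cases "P \<in> V";
        simp only: o_apply evs fixed if_True if_False Int_iff simp_thms)
next
  fix x assume "\<forall>q\<in>{a, b, c, d, e}. translate q x \<notin> U \<union> V"
  then show "(three_cycle U a b c \<circ> (three_cycle V a d e \<circ> (three_cycle U a c b \<circ> three_cycle V a e d))) x
      = three_cycle (U \<inter> V) a b d x"
    by (simp add: three_cycle_def)
qed

lemma three_cycle_rotate:
  assumes "separated U {a, b, c}" "distinct [a, b, c]"
  shows "three_cycle U b c a = three_cycle U a b c"
proof (rule three_cycle_eqI[of U "{a, b, c}"])
  fix P q assume P: "P \<in> U" and q: "q \<in> {a, b, c}"
  have neq: "a \<noteq> b" "b \<noteq> a" "a \<noteq> c" "c \<noteq> a" "b \<noteq> c" "c \<noteq> b" using assms(2) by auto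
  note ev = three_cycle_eval[OF assms(1) _ _ _ P]
  show "three_cycle U b c a (translate (- q) P) = three_cycle U a b c (translate (- q) P)"
    using q P by (elim insertE) (simp_all add: ev neq)
qed (simp add: three_cycle_def)

lemma three_cycle_square:
  assumes "separated U {a, b, c}" "distinct [a, b, c]"
  shows "three_cycle U a b c \<circ> three_cycle U a b c = three_cycle U a c b"
proof (rule three_cycle_eqI[of U "{a, b, c}"])
  fix P q assume P: "P \<in> U" and q: "q \<in> {a, b, c}"
  have neq: "a \<noteq> b" "b \<noteq> a" "a \<noteq> c" "c \<noteq> a" "b \<noteq> c" "c \<noteq> b" using assms(2) by auto
  note ev = three_cycle_eval[OF assms(1) _ _ _ P]
  show "(three_cycle U a b c \<circ> three_cycle U a b c) (translate (- q) P) = three_cycle U a c b (translate (- q) P)"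
    using q P by (elim insertE) (simp_all add: ev neq)
qed (simp add: three_cycle_def)

lemma three_cycle_inverse:
  assumes "separated U {a, b, c}" "distinct [a, b, c]"
  shows "three_cycle U a b c \<circ> three_cycle U a c b = id"
proof (rule three_cycle_eqI[of U "{a, b, c}"])
  fix P q assume P: "P \<in> U" and q: "q \<in> {a, b, c}"
  have neq: "a \<noteq> b" "b \<noteq> a" "a \<noteq> c" "c \<noteq> a" "b \<noteq> c" "c \<noteq> b" using assms(2) by auto
  note ev = three_cycle_eval[OF assms(1) _ _ _ P]
  show "(three_cycle U a b c \<circ> three_cycle U a c b) (translate (- q) P) = id (translate (- q) P)"
    using q P by (elim insertE) (simp_all add: ev neq)
qed (simp add: three_cycle_def)

lemma three_cycle_Un:
  assumes sep: "separated (U \<union> V) {a, b, c}" and "distinct [a, b, c]" "U \<inter> V = {}"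
  shows "three_cycle (U \<union> V) a b c = three_cycle U a b c \<circ> three_cycle V a b c"
proof (rule three_cycle_eqI[of "U \<union> V" "{a, b, c}"])
  fix P q assume P: "P \<in> U \<union> V" and q: "q \<in> {a, b, c}"
  have neq: "a \<noteq> b" "b \<noteq> a" "a \<noteq> c" "c \<noteq> a" "b \<noteq> c" "c \<noteq> b" using assms(2) by auto
  note ev = three_cycle_eval[OF sep _ _ _ P]
  show "three_cycle (U \<union> V) a b c (translate (- q) P) = (three_cycle U a b c \<circ> three_cycle V a b c) (translate (- q) P)"
    using q P assms(3) by (cases "P \<in> U"; cases "P \<in> V"; elim insertE) (auto simp add: ev neq)
qed (simp add: three_cycle_def)

lemma three_cycle_empty: "three_cycle {} a b c = id"
  by (auto simp: three_cycle_def)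

text \<open>The points \<open>P - a\<close> do not change when \<open>P\<close> and \<open>a\<close>
  move by the same vector. This is the change of anchor along an orbit.\<close>

lemma three_cycle_translate:
  fixes v :: "real ^ 'n"
  shows "three_cycle (translate v ` A) (a + v) (b + v) (c + v) = three_cycle A a b c"
proof -
  have "translate (q + v) x \<in> translate v ` A \<longleftrightarrow> translate q x \<in> A" for q and x :: "(real ^ 'n) set"
    using translate_translate[of v q x] by (auto simp: add.commute simp del: translate_translate)
  then show ?thesis
    by (intro ext) (simp add: three_cycle_def)
qed

text \<open>Composition alone suffices when generating by three-cycles, since the inverse of a
  three-cycle is its square.\<close>

definition comp_closed :: "('a \<Rightarrow> 'a) set \<Rightarrow> bool" where
  "comp_closed H \<longleftrightarrow> id \<in> H \<and> (\<forall>f\<in>H. \<forall>g\<in>H. f \<circ> g \<in> H)"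

lemma comp_closedD: "comp_closed H \<Longrightarrow> f \<in> H \<Longrightarrow> g \<in> H \<Longrightarrow> f \<circ> g \<in> H"
  unfolding comp_closed_def by blast

text \<open>For finite \<open>E\<close>, separated translates and composition-closed
  \<open>H\<close>, this says that \<open>H\<close> contains the alternating group on the letters
  \<open>E\<close>, acting simultaneously over all points of \<open>W\<close>.\<close>

definition alternating_in ::
    "((real ^ 'n) set \<Rightarrow> (real ^ 'n) set) set \<Rightarrow> (real ^ 'n) set set \<Rightarrow> (real ^ 'n) set \<Rightarrow> bool" where
  "alternating_in H W E \<longleftrightarrow>
     (\<forall>a\<in>E. \<forall>b\<in>E. \<forall>c\<in>E. distinct [a, b, c] \<longrightarrow> three_cycle W a b c \<in> H)"

lemma alternating_inD:
  "alternating_in H W E \<Longrightarrow> {a, b, c} \<subseteq> E \<Longrightarrow> distinct [a, b, c] \<Longrightarrow> three_cycle W a b c \<in> H"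
  unfolding alternating_in_def by blast

lemma alternating_in_mono: "alternating_in H W E \<Longrightarrow> F \<subseteq> E \<Longrightarrow> alternating_in H W F"
  unfolding alternating_in_def by blast

lemma alternating_in_translate:
  assumes "alternating_in H W E"
  shows "alternating_in H (translate v ` W) (translate v E)"
  unfolding alternating_in_def
proof (intro ballI impI)
  fix a b c assume "a \<in> translate v E" "b \<in> translate v E" "c \<in> translate v E" "distinct [a, b, c]"
  then have "three_cycle W (a - v) (b - v) (c - v) \<in> H"
    using assms by (intro alternating_inD) auto
  then show "three_cycle (translate v ` W) a b c \<in> H"
    using three_cycle_translate[of v W "a - v" "b - v" "c - v"] by simp
qed

lemma three_cycle_Union:
  assumes "finite \<C>" "comp_closed H" "pairwise disjnt \<C>" "separated (\<Union>\<C>) {a, b, c}" "distinct [a, b, c]"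
    and "\<And>C. C \<in> \<C> \<Longrightarrow> three_cycle C a b c \<in> H"
  shows "three_cycle (\<Union>\<C>) a b c \<in> H"
  using assms
proof (induction \<C>)
  case empty
  then show ?case unfolding Union_empty three_cycle_empty comp_closed_def by blast
next
  case (insert C \<C>)
  have "C \<inter> \<Union>\<C> = {}"
    using insert.prems(2) insert.hyps(2) by (fastforce simp: pairwise_insert disjnt_def)
  then have eq: "three_cycle (\<Union>(insert C \<C>)) a b c = three_cycle C a b c \<circ> three_cycle (\<Union>\<C>) a b c"
    using insert.prems by (simp add: three_cycle_Un)
  have "three_cycle (\<Union>\<C>) a b c \<in> H"
    using insert.prems separated_mono[OF insert.prems(3), of "\<Union>\<C>"]
    by (intro insert.IH) (auto simp: pairwise_insert)
  then show ?case
    unfolding eq using insert.prems(5) by (intro comp_closedD[OF insert.prems(1)]) auto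
qed

lemma three_cycle_swap_in:
  assumes "comp_closed H" "separated U {a, b, c}" "distinct [a, b, c]" "three_cycle U a b c \<in> H"
  shows "three_cycle U a c b \<in> H"
  using comp_closedD[OF assms(1,4,4)] three_cycle_square[OF assms(2,3)] by simp

lemma commutator_in:
  assumes "comp_closed H" "separated (U \<union> V) {a, b, c, d, e}" "distinct [a, b, c, d, e]"
    and "three_cycle U a b c \<in> H" "three_cycle V a d e \<in> H"
  shows "three_cycle (U \<inter> V) a b d \<in> H"
proof -
  have "three_cycle U a c b \<in> H" "three_cycle V a e d \<in> H"
    using assms(3)
    by (auto intro!: three_cycle_swap_in[OF assms(1) _ _ assms(4)] three_cycle_swap_in[OF assms(1) _ _ assms(5)]
        separated_mono[OF assms(2)])
  then show ?thesis
    unfolding three_cycle_commutator[OF assms(2,3), symmetric] using assms by (intro comp_closedD)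
qed

text \<open>The origin of the number five: three letters occur in the cycle sought, and the
  commutator identity needs two more.\<close>

lemma fresh_two:
  assumes "card I \<ge> 5"
  obtains p q where "p \<in> I" "q \<in> I" "p \<noteq> q" "p \<notin> {x, y, z}" "q \<notin> {x, y, z}"
proof -
  have "finite I" using assms card.infinite by fastforce
  then have "card (I - {x, y, z}) \<ge> 2"
    using assms diff_card_le_card_Diff[of "{x, y, z}" I] card_insert_le_m1[of 3 "{y, z}" x]
      card_insert_le_m1[of 2 "{z}" y] by simp
  then obtain S where S: "S \<subseteq> I - {x, y, z}" "card S = 2"
    by (metis obtain_subset_with_card_n)
  then obtain p q where "S = {p, q}" "p \<noteq> q"
    by (meson card_2_iff)
  with S show thesis using that[of p q] by blast
qed

text \<open>The generation step: alternating groups on letters \<open>E1\<close> over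
  \<open>U\<close> and \<open>E2\<close> over \<open>V\<close> with five common letters produce the
  one on all letters over \<open>U \<inter> V\<close>. The commutator identity is used three times,
  for cycles with a common first letter and one further letter from each set, then for a common
  first letter and arbitrary others, and finally for arbitrary letters.\<close>

lemma alternating_in_Int:
  assumes H: "comp_closed H" and sep: "separated (U \<union> V) (E1 \<union> E2)" and card: "card (E1 \<inter> E2) \<ge> 5"
    and 1: "alternating_in H U E1" and 2: "alternating_in H V E2"
  shows "alternating_in H (U \<inter> V) (E1 \<union> E2)"
proof -
  let ?W = "U \<inter> V"
  have comm: "three_cycle (U' \<inter> V') a b d \<in> H"
    if "three_cycle U' a b c \<in> H" "three_cycle V' a d e \<in> H" "U' \<subseteq> U \<union> V" "V' \<subseteq> U \<union> V"
      "{a, b, c, d, e} \<subseteq> E1 \<union> E2" "distinct [a, b, c, d, e]" for U' V' a b c d e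
    using that by (intro commutator_in[of H U' V' a b c d e] H separated_mono[OF sep]) auto
  have rot: "three_cycle ?W b c a = three_cycle ?W a b c"
    if "{a, b, c} \<subseteq> E1 \<union> E2" "distinct [a, b, c]" for a b c
    using that separated_mono[OF sep, of ?W "{a, b, c}"] by (intro three_cycle_rotate) auto
  have one: "three_cycle ?W a b d \<in> H"
    if "a \<in> E1 \<inter> E2" "b \<in> E1" "d \<in> E2" "distinct [a, b, d]" for a b d
  proof -
    obtain c e where "c \<in> E1 \<inter> E2" "e \<in> E1 \<inter> E2" "c \<noteq> e" "c \<notin> {a, b, d}" "e \<notin> {a, b, d}"
      using fresh_two[OF card] by metis
    then show ?thesis
      using that by (intro comm[of U a b c V d e] alternating_inD[OF 1] alternating_inD[OF 2]) auto
  qed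
  have one': "three_cycle ?W a d b \<in> H"
    if "a \<in> E1 \<inter> E2" "b \<in> E1" "d \<in> E2" "distinct [a, b, d]" for a b d
    using that by (intro three_cycle_swap_in[OF H _ _ one] separated_mono[OF sep]) auto
  \<comment> \<open>From here on both factors already live over the intersection, so only the
    letters remain to be enlarged.\<close>
  have two: "three_cycle ?W a b d \<in> H"
    if "a \<in> E1 \<inter> E2" "b \<in> E1 \<union> E2" "d \<in> E1 \<union> E2" "distinct [a, b, d]" for a b d
  proof -
    obtain c e where "c \<in> E1 \<inter> E2" "e \<in> E1 \<inter> E2" "c \<noteq> e" "c \<notin> {a, b, d}" "e \<notin> {a, b, d}"
      using fresh_two[OF card] by metis
    moreover from this have "three_cycle ?W a b c \<in> H" "three_cycle ?W a d e \<in> H"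
      using that one[of a b c] one'[of a c b] one[of a d e] one'[of a e d] by auto
    ultimately show ?thesis
      using that comm[of ?W a b c ?W d e] by auto
  qed
  show ?thesis
    unfolding alternating_in_def
  proof (intro ballI impI)
    fix a b d assume abd: "a \<in> E1 \<union> E2" "b \<in> E1 \<union> E2" "d \<in> E1 \<union> E2" "distinct [a, b, d]"
    obtain c e where ce: "c \<in> E1 \<inter> E2" "e \<in> E1 \<inter> E2" "c \<noteq> e" "c \<notin> {a, b, d}" "e \<notin> {a, b, d}"
      using fresh_two[OF card] by metis
    \<comment> \<open>Rotation puts the common letter \<open>c\<close> or \<open>e\<close> in front,
      where \<open>two\<close> applies.\<close>
    then have "three_cycle ?W a b c \<in> H" "three_cycle ?W a d e \<in> H"
      using abd two[of c a b] rot[of c a b] two[of e a d] rot[of e a d] by auto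
    then show "three_cycle ?W a b d \<in> H"
      using ce abd comm[of ?W a b c ?W d e] by auto
  qed
qed

section \<open>The hull as a compact space\<close>

definition agree :: "real \<Rightarrow> (real ^ 'n) set \<Rightarrow> (real ^ 'n) set \<Rightarrow> bool" where
  "agree s P P' \<longleftrightarrow> ball 0 s \<inter> P = ball 0 s \<inter> P'"

lemma agree_iff: "agree s P P' \<longleftrightarrow> (\<forall>x. norm x < s \<longrightarrow> (x \<in> P \<longleftrightarrow> x \<in> P'))"
  unfolding agree_def set_eq_iff by auto

lemma agree_refl [simp]: "agree s P P"
  by (simp add: agree_def)

lemma agree_sym: "agree s P P' \<Longrightarrow> agree s P' P"
  by (simp add: agree_def)

lemma agree_trans: "agree s P P' \<Longrightarrow> agree s P' P'' \<Longrightarrow> agree s P P''"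
  by (simp add: agree_def)

lemma agree_le: "agree s P P' \<Longrightarrow> t \<le> s \<Longrightarrow> agree t P P'"
  by (auto simp: agree_iff)

lemma agree_translate:
  fixes v :: "real ^ 'n"
  assumes "agree s P P'" "t + norm v \<le> s"
  shows "agree t (translate v P) (translate v P')"
  unfolding agree_iff
proof (intro allI impI)
  fix x :: "real ^ 'n" assume "norm x < t"
  then have "norm (x - v) < s"
    using norm_triangle_ineq4[of x v] assms(2) by linarith
  then show "x \<in> translate v P \<longleftrightarrow> x \<in> translate v P'"
    using assms(1) by (simp add: agree_iff)
qed

lemma patch_eq: "patch Q s q = ball 0 s \<inter> translate (- q) Q"
  unfolding patch_def by (auto simp: dist_norm norm_minus_commute)

lemma hull_set_iff: "P \<in> hull_set Q \<longleftrightarrow> (\<forall>s>0. \<exists>q\<in>Q. agree s P (translate (- q) Q))"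
  by (simp add: hull_set_def patch_eq agree_def)

lemma translate_in_hull:
  assumes "P \<in> hull_set Q" "v \<in> P"
  shows "translate (- v) P \<in> hull_set Q"
  unfolding hull_set_iff
proof (intro allI impI)
  fix s :: real assume "s > 0"
  then have "s + norm v > 0"
    by (simp add: add_pos_nonneg)
  then obtain q where q: "q \<in> Q" "agree (s + norm v) P (translate (- q) Q)"
    using assms(1) unfolding hull_set_iff by blast
  with assms(2) \<open>s > 0\<close> have "v + q \<in> Q"
    by (auto simp: agree_iff)
  moreover have "agree s (translate (- v) P) (translate (- (v + q)) Q)"
    using agree_translate[OF q(2), of s "- v"] by simp
  ultimately show "\<exists>q\<in>Q. agree s (translate (- v) P) (translate (- q) Q)" by blast
qed

section \<open>Cylinders and sets determined by a finite radius\<close>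

definition cyl :: "(real ^ 'n) set \<Rightarrow> real \<Rightarrow> (real ^ 'n) set \<Rightarrow> (real ^ 'n) set set" where
  "cyl Q s P = {P' \<in> hull_set Q. agree s P P'}"

lemma cyl_iff: "P' \<in> cyl Q s P \<longleftrightarrow> P' \<in> hull_set Q \<and> agree s P P'"
  by (simp add: cyl_def)

lemma cyl_self: "P \<in> hull_set Q \<Longrightarrow> P \<in> cyl Q s P"
  by (simp add: cyl_iff)

lemma cyl_eq: "P' \<in> cyl Q s P \<Longrightarrow> cyl Q s P' = cyl Q s P"
  by (auto simp: cyl_def agree_def)

lemma cyl_mono: "s \<le> t \<Longrightarrow> cyl Q t P \<subseteq> cyl Q s P"
  by (auto simp: cyl_iff agree_le)

text \<open>Moving the origin to \<open>v\<close> costs \<open>norm v\<close> of the radius on which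
  agreement is known; every later radius estimate is of this kind.\<close>

lemma cyl_translate:
  assumes "P' \<in> cyl Q s P" "v \<in> P" "norm v < s" "t + norm v \<le> s"
  shows "v \<in> P'" "translate (- v) P' \<in> cyl Q t (translate (- v) P)"
proof -
  show v: "v \<in> P'" using assms by (auto simp: cyl_iff agree_iff)
  show "translate (- v) P' \<in> cyl Q t (translate (- v) P)"
    using assms v by (auto simp: cyl_iff translate_in_hull intro!: agree_translate[of s])
qed

text \<open>A union of cylinders of radius \<open>s\<close>. For an aperiodic quasicrystal, having
  this for some \<open>s > 0\<close> is the combinatorial form of being clopen; see
  \<open>clopen_determined\<close>.\<close>

definition determined :: "(real ^ 'n) set \<Rightarrow> real \<Rightarrow> (real ^ 'n) set set \<Rightarrow> bool" where
  "determined Q s A \<longleftrightarrow> A \<subseteq> hull_set Q \<and> (\<forall>P\<in>A. cyl Q s P \<subseteq> A)"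

lemma determined_cyl: "determined Q s (cyl Q s P)"
  unfolding determined_def using cyl_eq[of _ Q s P] by (simp add: subset_iff cyl_iff)

lemma determined_le: "determined Q s A \<Longrightarrow> s \<le> t \<Longrightarrow> determined Q t A"
  unfolding determined_def using cyl_mono by (meson subset_trans)

text \<open>\<open>cl\<close> sends a point to its block. It is used with cylinders and with
  translated cells.\<close>

lemma three_cycle_partition:
  assumes H: "comp_closed H" and "finite (cl ` D)" "separated D {a, b, c}" "distinct [a, b, c]"
    and self: "\<And>P. P \<in> D \<Longrightarrow> P \<in> cl P" and sub: "\<And>P. P \<in> D \<Longrightarrow> cl P \<subseteq> D"
    and eq: "\<And>P P'. P \<in> D \<Longrightarrow> P' \<in> cl P \<Longrightarrow> cl P' = cl P"
    and "\<And>P. P \<in> D \<Longrightarrow> three_cycle (cl P) a b c \<in> H"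
  shows "three_cycle D a b c \<in> H"
proof -
  have D: "\<Union>(cl ` D) = D" using self sub by blast
  have "pairwise disjnt (cl ` D)"
    unfolding pairwise_def disjnt_def using eq by blast
  from three_cycle_Union[OF assms(2) H this _ assms(4)]
  show ?thesis using assms(3,8) by (auto simp: D)
qed

locale aperiodic_quasicrystal =
  fixes Q :: "(real ^ 'n) set"
  assumes quasicrystal: "quasicrystal Q" and aperiodic: "aperiodic Q"
begin

abbreviation "X \<equiv> hull_set Q"
abbreviation "cylinder \<equiv> cyl Q"

lemma delaunay: "delaunay Q"
  using quasicrystal by (simp add: quasicrystal_def)

lemma zero_in: "P \<in> X \<Longrightarrow> 0 \<in> P"
  using zero_in_hull[OF delaunay] .

lemma translate_in_X: "q \<in> Q \<Longrightarrow> translate (- q) Q \<in> X"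
  unfolding hull_set_iff using agree_refl by blast

lemma X_nonempty: "X \<noteq> {}"
  using delaunay translate_in_X unfolding delaunay_def by blast

lemma finite_ball:
  assumes "P \<in> X"
  shows "finite (ball 0 s \<inter> P)"
proof (cases "s > 0")
  case True
  obtain \<delta> where \<delta>: "\<delta> > 0" "\<And>q1 q2. q1 \<in> Q \<Longrightarrow> q2 \<in> Q \<Longrightarrow> q1 \<noteq> q2 \<Longrightarrow> norm (q1 - q2) > \<delta>"
    using delaunay unfolding delaunay_def by blast
  obtain q where q: "agree s P (translate (- q) Q)"
    using assms True unfolding hull_set_iff by blast
  let ?S = "ball 0 s \<inter> translate (- q) Q"
  have "uniform_discrete ?S"
    unfolding uniform_discrete_def using \<delta>
    by (intro exI[of _ \<delta>]) (fastforce simp: dist_norm)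
  moreover have "bounded ?S" by (simp add: bounded_Int)
  ultimately have "finite ?S" using uniform_discrete_finite_iff by blast
  then show ?thesis using q by (simp add: agree_def)
next
  case False
  then show ?thesis by (simp add: ball_empty)
qed

lemma finite_patches:
  assumes "s > 0"
  shows "finite ((\<lambda>P. ball 0 s \<inter> P) ` X)"
proof (rule finite_subset)
  show "(\<lambda>P. ball 0 s \<inter> P) ` X \<subseteq> patch Q s ` Q"
    using assms unfolding hull_set_def by blast
  show "finite (patch Q s ` Q)"
    using quasicrystal assms by (simp add: quasicrystal_def finite_local_complexity_def)
qed

lemma finite_cylinders:
  assumes "s > 0" "A \<subseteq> X"
  shows "finite (cylinder s ` A)"
proof -
  have "cylinder s P = {P' \<in> X. ball 0 s \<inter> P' = ball 0 s \<inter> P}" for P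
    by (auto simp: cyl_def agree_def)
  then have "cylinder s ` A = (\<lambda>p. {P' \<in> X. ball 0 s \<inter> P' = p}) ` (\<lambda>P. ball 0 s \<inter> P) ` A"
    by (simp add: image_image)
  moreover have "finite ((\<lambda>P. ball 0 s \<inter> P) ` A)"
    using finite_patches[OF assms(1)] assms(2) by (meson finite_subset image_mono)
  ultimately show ?thesis by simp
qed

lemma relatively_dense:
  obtains R where "R > 0" "\<And>P x. P \<in> X \<Longrightarrow> \<exists>q\<in>P. norm (x - q) < R"
proof -
  obtain R where R: "R > 0" "\<And>x. \<exists>q\<in>Q. norm (x - q) < R"
    using delaunay unfolding delaunay_def by blast
  have "\<exists>q\<in>P. norm (x - q) < R" if P: "P \<in> X" for P x
  proof -
    have "norm x + R > 0" using R(1) by (simp add: add_nonneg_pos)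
    then obtain p where p: "p \<in> Q" "agree (norm x + R) P (translate (- p) Q)"
      using P unfolding hull_set_iff by blast
    obtain q where q: "q \<in> Q" "norm (x + p - q) < R" using R(2) by blast
    have "norm (q - p) < norm x + R"
      using norm_triangle_ineq4[of x "x + p - q"] q(2) by (simp add: algebra_simps)
    then have "q - p \<in> P" using p q by (auto simp: agree_iff)
    moreover have "norm (x - (q - p)) < R" using q(2) by (simp add: algebra_simps)
    ultimately show ?thesis by blast
  qed
  with R(1) show thesis by (rule that)
qed

text \<open>Repetitivity passes from \<open>Q\<close> to each element of the hull with the same
  \<open>D\<close>: only the part of \<open>P\<close> within \<open>norm x + D + s\<close> of the
  origin matters, and there \<open>P\<close> coincides with a translate of \<open>Q\<close>.\<close>

lemma minimal:
  assumes "P' \<in> X" "s > 0"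
  obtains D where "D > 0"
    "\<And>P x. P \<in> X \<Longrightarrow> \<exists>p\<in>P. norm (x - p) < D \<and> translate (- p) P \<in> cylinder s P'"
proof -
  obtain q where q: "q \<in> Q" "agree s P' (translate (- q) Q)"
    using assms unfolding hull_set_iff by blast
  obtain D where D: "D > 0" "\<And>x. \<exists>p\<in>Q. norm (x - p) < D \<and> patch Q s p = patch Q s q"
    using quasicrystal assms q(1) unfolding quasicrystal_def repetitive_def by meson
  have "\<exists>p\<in>P. norm (x - p) < D \<and> translate (- p) P \<in> cylinder s P'" if P: "P \<in> X" for P x
  proof -
    let ?t = "norm x + D + s"
    have "?t > 0" using D(1) assms(2) by (simp add: add_nonneg_pos)
    then obtain q1 where q1: "q1 \<in> Q" "agree ?t P (translate (- q1) Q)"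
      using P unfolding hull_set_iff by blast
    obtain p where p: "p \<in> Q" "norm (x + q1 - p) < D" "patch Q s p = patch Q s q"
      using D(2) by blast
    have n: "norm (p - q1) < norm x + D"
      using norm_triangle_ineq4[of x "x + q1 - p"] p(2) by (simp add: algebra_simps)
    then have p': "p - q1 \<in> P"
      using p(1) q1(2) assms(2) by (auto simp: agree_iff)
    have "agree s (translate (- (p - q1)) P) (translate (- (p - q1)) (translate (- q1) Q))"
      using n by (intro agree_translate[OF q1(2)]) (simp add: norm_minus_commute)
    then have "agree s (translate (- (p - q1)) P) (translate (- p) Q)" by simp
    moreover have "agree s (translate (- p) Q) (translate (- q) Q)"
      using p(3) by (simp add: patch_eq agree_def)
    ultimately have "agree s P' (translate (- (p - q1)) P)"
      using q(2) by (simp add: agree_def)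
    then have "translate (- (p - q1)) P \<in> cylinder s P'"
      using translate_in_hull[OF P p'] by (simp add: cyl_iff)
    moreover have "norm (x - (p - q1)) < D" using p(2) by (simp add: algebra_simps)
    ultimately show ?thesis using p' by blast
  qed
  with D(1) show thesis by (rule that)
qed

text \<open>A period of \<open>P\<close> is a period of \<open>Q\<close>: every patch of
  \<open>Q\<close> of radius \<open>norm v + 1\<close> recurs in \<open>P\<close>, and on such a
  patch the shifts of its centre by \<open>v\<close> and \<open>- v\<close> are visible.\<close>

lemma aperiodic_hull:
  assumes P: "P \<in> X" and eq: "translate v P = P"
  shows "v = 0"
proof -
  have pm: "p + v \<in> P" "p - v \<in> P" if "p \<in> P" for p
    using that mem_translate[of "p + v" v P] mem_translate[of p v P] by (auto simp: eq)
  have Q: "q + v \<in> Q \<and> q - v \<in> Q" if "q \<in> Q" for q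
  proof -
    have "norm v + 1 > 0" by (simp add: add_nonneg_pos)
    from minimal[OF translate_in_X[OF that] this]
    obtain p where p: "p \<in> P" "translate (- p) P \<in> cylinder (norm v + 1) (translate (- q) Q)"
      using P by metis
    then have "agree (norm v + 1) (translate (- q) Q) (translate (- p) P)"
      by (simp add: cyl_iff)
    then have *: "x \<in> translate (- q) Q \<longleftrightarrow> x \<in> translate (- p) P" if "norm x < norm v + 1" for x
      using that unfolding agree_iff by blast
    have "v \<in> translate (- q) Q \<longleftrightarrow> v \<in> translate (- p) P"
      "- v \<in> translate (- q) Q \<longleftrightarrow> - v \<in> translate (- p) P"
      by (rule *, simp)+
    then show ?thesis using pm[OF p(1)] by (simp add: add.commute)
  qed
  have "translate v Q = Q"
    unfolding set_eq_iff
  proof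
    fix x show "x \<in> translate v Q \<longleftrightarrow> x \<in> Q"
      using Q[of x] Q[of "x - v"] by auto
  qed
  then show ?thesis using aperiodic by (simp add: aperiodic_def)
qed

text \<open>Compactness in the form of Koenig's lemma. If no radius worked everywhere, finite local
  complexity would give nested cylinders of growing radius on each of which none works; their limit
  is a point of the hull and contradicts \<open>loc\<close>.\<close>

lemma uniform_radius:
  fixes \<Phi> :: "(real ^ 'n) set set \<Rightarrow> bool"
  assumes loc: "\<And>P. P \<in> X \<Longrightarrow> \<exists>r>0. \<Phi> (cylinder r P)"
    and anti: "\<And>A B. \<Phi> A \<Longrightarrow> B \<subseteq> A \<Longrightarrow> \<Phi> B"
  obtains s where "s > 0" "\<And>P. P \<in> X \<Longrightarrow> \<Phi> (cylinder s P)"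
proof -
  define good where "good A \<longleftrightarrow> (\<exists>s>0. \<forall>P\<in>A. \<Phi> (cylinder s P))" for A
  have union: "good A" if A: "A \<subseteq> X" and n: "n > 0" and g: "\<And>P. P \<in> A \<Longrightarrow> good (cylinder n P)" for A n
  proof -
    have "\<forall>C\<in>cylinder n ` A. \<exists>s>0. \<forall>P\<in>C. \<Phi> (cylinder s P)"
      using g unfolding good_def by blast
    then obtain s where s: "\<And>C. C \<in> cylinder n ` A \<Longrightarrow> s C > 0 \<and> (\<forall>P\<in>C. \<Phi> (cylinder (s C) P))"
      by metis
    \<comment> \<open>Finite local complexity leaves finitely many cylinders of radius
      \<open>n\<close>, so the maximum exists; the entry \<open>1\<close> covers empty
      \<open>A\<close>.\<close>
    let ?s = "Max (insert 1 (s ` cylinder n ` A))"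
    have fin: "finite (insert 1 (s ` cylinder n ` A))" using finite_cylinders[OF n A] by simp
    have "\<Phi> (cylinder ?s P)" if "P \<in> A" for P
    proof -
      have "\<Phi> (cylinder (s (cylinder n P)) P)"
        using s[of "cylinder n P"] that A cyl_self[of P] by blast
      moreover have "s (cylinder n P) \<le> ?s" using fin that by (intro Max_ge) auto
      ultimately show ?thesis using anti cyl_mono by blast
    qed
    moreover have "?s > 0" using fin by (subst Max_gr_iff) auto
    ultimately show ?thesis unfolding good_def by blast
  qed
  have "good X"
  proof (rule ccontr)
    assume "\<not> good X"
    then obtain P0 where P0: "P0 \<in> X" "\<not> good (cylinder 1 P0)"
      using union[of X 1] by auto
    have "\<exists>f. \<forall>n. (f n \<in> X \<and> \<not> good (cylinder (Suc n) (f n))) \<and> f (Suc n) \<in> cylinder (Suc n) (f n)"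
    proof (rule dependent_nat_choice)
      show "\<exists>P. P \<in> X \<and> \<not> good (cylinder (Suc 0) P)" using P0 by auto
      fix P n assume P: "P \<in> X \<and> \<not> good (cylinder (Suc n) P)"
      have "\<exists>P'\<in>cylinder (Suc n) P. \<not> good (cylinder (Suc (Suc n)) P')"
      proof (rule ccontr)
        assume "\<not> ?thesis"
        then have "good (cylinder (Suc n) P)"
          by (intro union[of "cylinder (Suc n) P" "Suc (Suc n)"]) (auto simp: cyl_iff)
        with P show False by blast
      qed
      then show "\<exists>P'. (P' \<in> X \<and> \<not> good (cylinder (Suc (Suc n)) P')) \<and> P' \<in> cylinder (Suc n) P"
        by (auto simp: cyl_iff)
    qed
    then obtain f where f: "\<And>n. f n \<in> X" "\<And>n. \<not> good (cylinder (Suc n) (f n))"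
      "\<And>n. f (Suc n) \<in> cylinder (Suc n) (f n)" by metis
    have stable: "agree (Suc n) (f n) (f m)" if "n \<le> m" for n m
      using that
    proof (induction m rule: dec_induct)
      case (step m)
      have "agree (Suc m) (f m) (f (Suc m))" using f(3)[of m] by (simp add: cyl_iff)
      then show ?case using step by (meson agree_le agree_trans of_nat_le_iff Suc_le_mono)
    qed simp
    \<comment> \<open>A point \<open>x\<close> is decided at stage
      \<open>nat \<lceil>norm x\<rceil>\<close>, whose cylinder has radius one larger and so
      strictly more than \<open>norm x\<close>, as open balls require.\<close>
    define P where "P = {x. x \<in> f (nat \<lceil>norm x\<rceil>)}"
    have lim: "agree (Suc n) (f n) P" for n
      unfolding agree_iff
    proof (intro allI impI)
      fix x :: "real ^ 'n" assume x: "norm x < real (Suc n)"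
      let ?k = "nat \<lceil>norm x\<rceil>"
      have "norm x < Suc ?k" by linarith
      then have "x \<in> f ?k \<longleftrightarrow> x \<in> f (max n ?k)" "x \<in> f n \<longleftrightarrow> x \<in> f (max n ?k)"
        using stable[of ?k "max n ?k"] stable[of n "max n ?k"] x unfolding agree_iff by auto
      then show "x \<in> f n \<longleftrightarrow> x \<in> P" by (simp add: P_def)
    qed
    have "P \<in> X"
      unfolding hull_set_iff
    proof (intro allI impI)
      fix s :: real assume "s > 0"
      have *: "s \<le> Suc (nat \<lceil>s\<rceil>)" by linarith
      obtain q where "q \<in> Q" "agree s (f (nat \<lceil>s\<rceil>)) (translate (- q) Q)"
        using f(1) \<open>s > 0\<close> unfolding hull_set_iff by blast
      then show "\<exists>q\<in>Q. agree s P (translate (- q) Q)"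
        using agree_le[OF lim *] by (auto simp: agree_def)
    qed
    then obtain r where r: "r > 0" "\<Phi> (cylinder r P)" using loc by blast
    let ?n = "nat \<lceil>r\<rceil>"
    have n: "r \<le> Suc ?n" by linarith
    \<comment> \<open>All members of this supposedly bad cylinder share the
      \<open>r\<close>-cylinder of \<open>P\<close>, so the single radius \<open>r\<close> makes it
      good.\<close>
    have "cylinder r P' = cylinder r P" if "P' \<in> cylinder (Suc ?n) (f ?n)" for P'
    proof (rule cyl_eq)
      have "agree r P P'"
        using that agree_le[OF lim n] agree_le[OF _ n] by (meson agree_sym agree_trans cyl_iff)
      then show "P' \<in> cylinder r P" using that by (simp add: cyl_iff)
    qed
    then have "good (cylinder (Suc ?n) (f ?n))"
      unfolding good_def using r by auto
    then show False using f(2) by blast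
  qed
  then show thesis using that unfolding good_def by blast
qed

text \<open>Aperiodicity made uniform: \<open>P - a\<close> and \<open>P - b\<close> already differ
  within a finite radius, and only finitely many pairs from the ball have to be told apart.\<close>

lemma separated_cylinders:
  obtains s where "s > 0" "\<And>P. P \<in> X \<Longrightarrow> separated (cylinder s P) (ball 0 K \<inter> P)"
proof -
  \<comment> \<open>The point set depends on \<open>P\<close>. Quantifying over \<open>P\<close> in
    \<open>A\<close> yields a property of \<open>A\<close> alone that passes to subsets.\<close>
  define \<Phi> :: "(real ^ 'n) set set \<Rightarrow> bool" where "\<Phi> A \<longleftrightarrow> (\<forall>P\<in>A. separated A (ball 0 K \<inter> P))" for A
  have "\<exists>r>0. \<Phi> (cylinder r P)" if P: "P \<in> X" for P
  proof -
    let ?E = "ball 0 K \<inter> P"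
    have "\<exists>t. \<not> agree t (translate (- a) P) (translate (- b) P)" if "a \<noteq> b" for a b
    proof (rule ccontr)
      assume *: "\<nexists>t. \<not> agree t (translate (- a) P) (translate (- b) P)"
      have "x \<in> translate (- a) P \<longleftrightarrow> x \<in> translate (- b) P" for x
        using * unfolding agree_iff by (metis less_add_one)
      then have "translate (- a) P = translate (- b) P" by blast
      then have "translate (b - a) P = P"
        by (metis add.commute translate_translate translate_0 right_minus uminus_add_conv_diff)
      then show False using aperiodic_hull[OF P] that by force
    qed
    then obtain t where t: "\<And>a b. a \<noteq> b \<Longrightarrow> \<not> agree (t a b) (translate (- a) P) (translate (- b) P)"
      by metis
    define m where "m = Max (insert 1 (case_prod t ` (?E \<times> ?E)))"
    have fin: "finite (insert 1 (case_prod t ` (?E \<times> ?E)))" using finite_ball[OF P] by simp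
    have m: "t a b \<le> m" if "a \<in> ?E" "b \<in> ?E" for a b
      unfolding m_def using that by (intro Max_ge[OF fin]) force
    have m1: "m \<ge> 1" unfolding m_def by (intro Max_ge[OF fin]) simp
    \<comment> \<open>\<open>m\<close> tells all pairs apart. The summand
      \<open>\<bar>K\<bar>\<close> pays for a shift by \<open>a\<close> or \<open>b\<close> and
      makes the points within \<open>K\<close> the same throughout the cylinder.\<close>
    let ?r = "m + \<bar>K\<bar>"
    have "separated (cylinder ?r P) ?E"
      unfolding separated_def
    proof (intro allI ballI impI)
      fix x a b assume a: "a \<in> ?E" "translate a x \<in> cylinder ?r P" and b: "b \<in> ?E" "translate b x \<in> cylinder ?r P"
      have "agree m (translate (- a) P) x"
        using a agree_translate[of ?r P "translate a x" m "- a"] by (auto simp: cyl_iff)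
      moreover have "agree m (translate (- b) P) x"
        using b agree_translate[of ?r P "translate b x" m "- b"] by (auto simp: cyl_iff)
      ultimately have "agree (t a b) (translate (- a) P) (translate (- b) P)"
        using agree_le[OF _ m[OF a(1) b(1)]] by (meson agree_sym agree_trans)
      then show "a = b" using t by blast
    qed
    moreover have "ball 0 K \<inter> P' = ?E" if "P' \<in> cylinder ?r P" for P'
      using that m1 agree_le[of ?r P P' K] by (auto simp: cyl_iff agree_def)
    ultimately show ?thesis
      using m1 unfolding \<Phi>_def by (intro exI[of _ ?r]) auto
  qed
  moreover have "\<Phi> B" if "\<Phi> A" "B \<subseteq> A" for A B
    using that separated_mono unfolding \<Phi>_def by blast
  ultimately obtain s where "s > 0" "\<And>P. P \<in> X \<Longrightarrow> \<Phi> (cylinder s P)"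
    using uniform_radius[of \<Phi>] by blast
  then show thesis using that cyl_self unfolding \<Phi>_def by blast
qed

lemma three_cycle_by_cylinders:
  assumes "comp_closed H" "s > 0" "determined Q s D" "separated D {a, b, c}" "distinct [a, b, c]"
    and "\<And>P. P \<in> D \<Longrightarrow> three_cycle (cylinder s P) a b c \<in> H"
  shows "three_cycle D a b c \<in> H"
proof (rule three_cycle_partition[of H "cylinder s" D a b c])
  show "finite (cylinder s ` D)" using assms by (simp add: finite_cylinders determined_def)
  show "P \<in> cylinder s P" "cylinder s P \<subseteq> D" if "P \<in> D" for P
    using that assms(3) by (auto simp: determined_def intro!: cyl_self)
  show "cylinder s P' = cylinder s P" if "P' \<in> cylinder s P" for P P'
    using that by (rule cyl_eq)
qed (use assms in auto)

end

section \<open>Finite generation\<close>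

lemma mem_translate_image: "x \<in> translate q ` S \<longleftrightarrow> translate (- q) x \<in> S"
  by (metis (no_types, lifting) image_iff left_minus right_minus translate_0 translate_translate)

context aperiodic_quasicrystal
begin

text \<open>The displacements are required to lie in each \<open>P\<close> of \<open>D\<close>, so
  that the three translates of \<open>P\<close> stay in the hull.\<close>

definition cycles :: "((real ^ 'n) set \<Rightarrow> (real ^ 'n) set) set" where
  "cycles = {three_cycle D a b c | D a b c.
     (\<exists>s>0. determined Q s D) \<and> (\<forall>P\<in>D. {a, b, c} \<subseteq> P) \<and> separated D {a, b, c} \<and> distinct [a, b, c]}"

lemma cyclesI:
  assumes "s > 0" "determined Q s D" "\<And>P. P \<in> D \<Longrightarrow> {a, b, c} \<subseteq> P" "separated D {a, b, c}" "distinct [a, b, c]"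
  shows "three_cycle D a b c \<in> cycles"
  unfolding cycles_def using assms by blast

context

  \<comment> \<open>Cells: index sets reproduced by commutators\<close>
  fixes R s0 :: real
  assumes R: "R > 0" "\<And>P x. P \<in> X \<Longrightarrow> \<exists>q\<in>P. norm (x - q) < R"
    and s0: "s0 > 3 * R"
begin

text \<open>Five positions spaced \<open>2 * R\<close> along a ray from \<open>q\<close> have
  distinct points of \<open>P\<close> within \<open>R\<close>. The last of these is less than
  \<open>9 * R\<close> from \<open>q\<close> and hence less than \<open>12 * R\<close> from
  \<open>q'\<close>.\<close>

lemma five_points:
  assumes P: "P \<in> X" and q: "norm (q - q') < 3 * R"
  shows "5 \<le> card (ball q (13 * R) \<inter> P \<inter> (ball q' (13 * R) \<inter> P))"
proof -
  obtain e :: "real ^ 'n" where e: "norm e = 1"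
    by (metis norm_axis_1)
  have "\<forall>j::nat. \<exists>x. x \<in> P \<and> norm (q + (2 * R * real j) *\<^sub>R e - x) < R"
    using R(2)[OF P] by blast
  from choice[OF this] obtain f where f: "\<And>j::nat. f j \<in> P" "\<And>j. norm (q + (2 * R * real j) *\<^sub>R e - f j) < R"
    by blast
  have "inj_on f {..<5}"
  proof (rule inj_onI)
    fix i j assume "f i = f j"
    then have "norm ((q + (2 * R * real i) *\<^sub>R e - f i) - (q + (2 * R * real j) *\<^sub>R e - f j)) < R + R"
      using norm_triangle_ineq4 f(2)[of i] f(2)[of j] by (meson add_strict_mono le_less_trans)
    also have "(q + (2 * R * real i) *\<^sub>R e - f i) - (q + (2 * R * real j) *\<^sub>R e - f j)
        = (2 * R * (real i - real j)) *\<^sub>R e"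
      using \<open>f i = f j\<close> by (simp add: algebra_simps)
    finally have "2 * R * \<bar>real i - real j\<bar> < 2 * R * 1"
      using e R(1) by (simp add: abs_mult)
    then have "\<bar>real i - real j\<bar> < 1"
      using R(1) by (simp only: mult_less_cancel_left_pos)
    then show "i = j" by linarith
  qed
  moreover have "f ` {..<5} \<subseteq> ball q (13 * R) \<inter> P \<inter> (ball q' (13 * R) \<inter> P)"
  proof (rule image_subsetI)
    fix j :: nat assume j: "j \<in> {..<5}"
    have "norm ((2 * R * real j) *\<^sub>R e) \<le> 2 * R * 4"
      using e R(1) j by (simp add: abs_mult)
    moreover have "norm (f j - q) \<le> norm ((2 * R * real j) *\<^sub>R e) + norm (q + (2 * R * real j) *\<^sub>R e - f j)"
      using norm_triangle_ineq4[of "(2 * R * real j) *\<^sub>R e" "q + (2 * R * real j) *\<^sub>R e - f j"]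
      by (simp add: algebra_simps)
    ultimately have n: "norm (f j - q) < 9 * R" using f(2)[of j] by simp
    have "norm (f j - q') \<le> norm (f j - q) + norm (q - q')"
      using norm_triangle_ineq[of "f j - q" "q - q'"] by simp
    then show "f j \<in> ball q (13 * R) \<inter> P \<inter> (ball q' (13 * R) \<inter> P)"
      using n q R(1) f(1)[of j] by (simp add: dist_norm norm_minus_commute)
  qed
  moreover have "finite (ball q (13 * R) \<inter> P \<inter> (ball q' (13 * R) \<inter> P))"
  proof (rule finite_subset[OF _ finite_ball[OF P, of "norm q + 13 * R"]])
    show "ball q (13 * R) \<inter> P \<inter> (ball q' (13 * R) \<inter> P) \<subseteq> ball 0 (norm q + 13 * R) \<inter> P"
    proof
      fix x assume "x \<in> ball q (13 * R) \<inter> P \<inter> (ball q' (13 * R) \<inter> P)"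
      then show "x \<in> ball 0 (norm q + 13 * R) \<inter> P"
        using norm_triangle_ineq[of q "x - q"] by (simp add: dist_norm norm_minus_commute)
    qed
  qed
  ultimately show ?thesis
    using card_inj_on_le[of f "{..<5}"] by simp
qed

text \<open>
  Intersections of translates of cylinders, unlike cylinders themselves, are reproduced by the
  commutator construction; they are squeezed between cylinders of unboundedly growing radius.
\<close>

primrec cell :: "nat \<Rightarrow> (real ^ 'n) set \<Rightarrow> (real ^ 'n) set set" where
  "cell 0 P = cylinder s0 P"
| "cell (Suc k) P = (\<Inter>q\<in>ball 0 (3 * R) \<inter> P. translate q ` cell k (translate (- q) P))"

lemma cell_Suc_iff:
  "P' \<in> cell (Suc k) P \<longleftrightarrow> (\<forall>q\<in>ball 0 (3 * R) \<inter> P. translate (- q) P' \<in> cell k (translate (- q) P))"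
  by (simp only: cell.simps INT_iff mem_translate_image)

lemma cell_Suc_subset: "P \<in> X \<Longrightarrow> cell (Suc k) P \<subseteq> cell k P"
proof
  fix P' assume P: "P \<in> X" and P': "P' \<in> cell (Suc k) P"
  have "0 \<in> ball 0 (3 * R) \<inter> P" using zero_in[OF P] R(1) by auto
  then have "translate (- 0) P' \<in> cell k (translate (- 0) P)"
    using P' unfolding cell_Suc_iff by blast
  then show "P' \<in> cell k P" by simp
qed

text \<open>Every level gains \<open>R\<close>. For \<open>x\<close> outside the range already known
  there is a point \<open>q\<close> of \<open>P\<close> with \<open>norm q < 3 * R\<close> that is
  closer to \<open>x\<close> than the origin by more than \<open>R\<close>, and the previous level
  at \<open>q\<close> decides \<open>x\<close>.\<close>

lemma cell_subset_cylinder: "P \<in> X \<Longrightarrow> cell k P \<subseteq> cylinder (s0 + k * R) P"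
proof (induction k arbitrary: P)
  case (Suc k)
  show ?case
  proof
    fix P' assume P': "P' \<in> cell (Suc k) P"
    then have "P' \<in> cylinder (s0 + k * R) P"
      using cell_Suc_subset[OF Suc.prems] Suc.IH[OF Suc.prems] by blast
    then have X: "P' \<in> X" by (simp add: cyl_iff)
    have "x \<in> P \<longleftrightarrow> x \<in> P'" if x: "norm x < s0 + Suc k * R" for x
    proof -
      have "\<exists>q\<in>ball 0 (3 * R) \<inter> P. norm (x - q) < s0 + k * R"
      proof (cases "norm x < s0 + k * R")
        case True
        then show ?thesis using zero_in[OF Suc.prems] R(1) by (intro bexI[of _ 0]) auto
      next
        case False
        have "k * R \<ge> 0" using R(1) by simp
        with False s0 have nx: "norm x > 3 * R" by linarith
        \<comment> \<open>A step of length \<open>2 * R\<close> towards \<open>x\<close>: after an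
          error below \<open>R\<close> in choosing \<open>q\<close>, a gain above \<open>R\<close>
          remains and \<open>norm q\<close> stays below \<open>3 * R\<close>. There is room for the
          step because \<open>s0 > 3 * R\<close>.\<close>
        define y where "y = (2 * R / norm x) *\<^sub>R x"
        have y: "norm y = 2 * R" using nx R(1) by (auto simp: y_def)
        have "x - y = (1 - 2 * R / norm x) *\<^sub>R x" by (simp add: y_def algebra_simps)
        then have "norm (x - y) = \<bar>1 - 2 * R / norm x\<bar> * norm x" by simp
        also have "\<bar>1 - 2 * R / norm x\<bar> = 1 - 2 * R / norm x"
        proof -
          have "norm x > 0" using nx R(1) by linarith
          then have "2 * R / norm x \<le> 1" using nx R(1) by (subst divide_le_eq_1_pos) auto
          then show ?thesis by simp
        qed
        also have "(1 - 2 * R / norm x) * norm x = norm x - 2 * R"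
        proof -
          have "norm x > 0" using nx R(1) by linarith
          then show ?thesis by (simp add: left_diff_distrib)
        qed
        finally have xy: "norm (x - y) = norm x - 2 * R" .
        obtain q where q: "q \<in> P" "norm (y - q) < R" using R(2)[OF Suc.prems] by blast
        have "norm q < 3 * R"
          using norm_triangle_ineq4[of y "y - q"] y q(2) by simp
        moreover have "norm (x - q) < norm x - R"
          using norm_triangle_ineq[of "x - y" "y - q"] xy q(2) by simp
        moreover have "norm x - R < s0 + k * R" using x by (simp add: algebra_simps)
        ultimately show ?thesis using q(1) by (intro bexI[of _ q]) auto
      qed
      then obtain q where q: "q \<in> ball 0 (3 * R) \<inter> P" "norm (x - q) < s0 + k * R" by blast
      then have "translate (- q) P' \<in> cell k (translate (- q) P)" using P' unfolding cell_Suc_iff by blast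
      then have "agree (s0 + k * R) (translate (- q) P) (translate (- q) P')"
        using Suc.IH[of "translate (- q) P"] q(1) translate_in_hull[OF Suc.prems] by (auto simp: cyl_iff)
      then have "x - q \<in> translate (- q) P \<longleftrightarrow> x - q \<in> translate (- q) P'"
        using q(2) unfolding agree_iff by blast
      then show ?thesis by simp
    qed
    then show "P' \<in> cylinder (s0 + Suc k * R) P"
      using X by (auto simp: cyl_iff agree_iff)
  qed
qed simp

lemma cell_subset_s0:
  assumes "P \<in> X"
  shows "cell k P \<subseteq> cylinder s0 P"
proof -
  have "s0 \<le> s0 + k * R" using R(1) by simp
  then show ?thesis using cell_subset_cylinder[OF assms] cyl_mono by (meson subset_trans)
qed

lemma cylinder_subset_cell: "P \<in> X \<Longrightarrow> cylinder (s0 + 3 * R * k) P \<subseteq> cell k P"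
proof (induction k arbitrary: P)
  case (Suc k)
  show ?case
  proof
    fix P' assume P': "P' \<in> cylinder (s0 + 3 * R * Suc k) P"
    have k: "3 * R * k \<ge> 0" using R(1) by simp
    show "P' \<in> cell (Suc k) P"
      unfolding cell_Suc_iff
    proof
      fix q assume q: "q \<in> ball 0 (3 * R) \<inter> P"
      have "3 * R * Suc k = 3 * R * k + 3 * R" by (simp add: algebra_simps)
      moreover have "q \<in> P" "norm q < 3 * R" using q by auto
      moreover have "s0 > 0" using s0 R(1) by linarith
      ultimately have "translate (- q) P' \<in> cylinder (s0 + 3 * R * k) (translate (- q) P)"
        using k by (intro cyl_translate(2)[OF P']) linarith+
      then show "translate (- q) P' \<in> cell k (translate (- q) P)"
        using Suc.IH[of "translate (- q) P"] q translate_in_hull[OF Suc.prems] by blast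
    qed
  qed
qed simp

lemma cell_self: "P \<in> X \<Longrightarrow> P \<in> cell k P"
  using cylinder_subset_cell cyl_self by blast

text \<open>Members of a cell agree up to \<open>s0 > 3 * R\<close>, so the intersections that
  define their next cells run over the same points \<open>q\<close>.\<close>

lemma cell_eq: "P \<in> X \<Longrightarrow> P' \<in> cell k P \<Longrightarrow> cell k P' = cell k P"
proof (induction k arbitrary: P P')
  case 0
  then show ?case by (simp add: cyl_eq)
next
  case (Suc k)
  have "P' \<in> cylinder s0 P" using Suc.prems cell_subset_s0 by blast
  then have "agree s0 P P'" by (simp add: cyl_iff)
  then have "agree (3 * R) P P'" using s0 by (rule_tac agree_le[where s = s0]) auto
  then have b: "ball 0 (3 * R) \<inter> P' = ball 0 (3 * R) \<inter> P" by (simp add: agree_def)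
  have "cell k (translate (- q) P') = cell k (translate (- q) P)" if "q \<in> ball 0 (3 * R) \<inter> P" for q
    using that Suc.prems translate_in_hull[OF Suc.prems(1)] unfolding cell_Suc_iff by (intro Suc.IH) auto
  then show ?case unfolding cell.simps b by simp
qed

lemma finite_cells:
  assumes "D \<subseteq> X"
  shows "finite (cell k ` D)"
proof -
  let ?t = "s0 + 3 * R * k"
  have t: "?t > 0" using R(1) s0 by (simp add: add_pos_nonneg)
  have "cell k P = \<Union>(cell k ` cylinder ?t P)" if "P \<in> D" for P
  proof -
    have P: "P \<in> X" using that assms by blast
    then have "cell k ` cylinder ?t P = {cell k P}"
      using cell_eq[OF P] cylinder_subset_cell[OF P, of k] cyl_self[OF P, of ?t] by blast
    then show ?thesis by simp
  qed
  then have "cell k ` D = (\<lambda>C. \<Union>(cell k ` C)) ` (cylinder ?t ` D)"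
    by (auto simp: image_iff)
  then show ?thesis using finite_cylinders[OF t assms] by simp
qed

context
  fixes H :: "((real ^ 'n) set \<Rightarrow> (real ^ 'n) set) set"
  assumes H: "comp_closed H"
    and base: "\<And>P. P \<in> X \<Longrightarrow> alternating_in H (cylinder s0 P) (ball 0 (13 * R) \<inter> P)"
    and sep: "\<And>P. P \<in> X \<Longrightarrow> separated (cylinder (s0 - 3 * R) P) (ball 0 (16 * R) \<inter> P)"
begin

lemma translate_ball: "translate q (ball 0 r \<inter> translate (- q) P) = ball q r \<inter> P"
  by (auto simp: dist_norm norm_minus_commute)

text \<open>The translates in the definition of \<open>cell\<close> are intersected one at a time by
  \<open>alternating_in_Int\<close>. All index sets involved lie in the cylinder of radius
  \<open>s0 - 3 * R\<close> and all letters within \<open>16 * R\<close>, which is what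
  \<open>sep\<close> provides for. The letters gained around \<open>q\<close> are dropped again, so
  that the induction keeps one ball.\<close>

lemma alternating_in_cell: "P \<in> X \<Longrightarrow> alternating_in H (cell k P) (ball 0 (13 * R) \<inter> P)"
proof (induction k arbitrary: P)
  case 0
  then show ?case using base by simp
next
  case (Suc k)
  note P = Suc.prems
  let ?V = "\<lambda>q. translate q ` cell k (translate (- q) P)" and ?E = "ball 0 (13 * R) \<inter> P"
  have "finite S \<Longrightarrow> S \<subseteq> ball 0 (3 * R) \<inter> P \<Longrightarrow> alternating_in H (cell k P \<inter> (\<Inter>q\<in>S. ?V q)) ?E" for S
  proof (induction S rule: finite_induct)
    case empty
    then show ?case using Suc.IH[OF P] by simp
  next
    case (insert q S)
    let ?U = "cell k P \<inter> (\<Inter>q\<in>S. ?V q)" and ?C = "cylinder (s0 - 3 * R) P"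
    have q: "q \<in> P" "norm q < 3 * R" using insert.prems by auto
    note Pq = translate_in_hull[OF P q(1)]
    have U: "alternating_in H ?U ?E" using insert by blast
    have V: "alternating_in H (?V q) (ball q (13 * R) \<inter> P)"
      using alternating_in_translate[OF Suc.IH[OF Pq], of q] by (simp only: translate_ball)
    have "?U \<subseteq> ?C"
      using cell_subset_s0[OF P, of k] cyl_mono[of "s0 - 3 * R" s0 Q P] R(1) by auto
    moreover have "?V q \<subseteq> ?C"
    proof
      fix x assume "x \<in> ?V q"
      then have x: "translate (- q) x \<in> cylinder s0 (translate (- q) P)"
        using cell_subset_s0[OF Pq] by (auto simp: mem_translate_image)
      have "translate (- (- q)) (translate (- q) x) \<in> cylinder (s0 - 3 * R) (translate (- (- q)) (translate (- q) P))"
        using q s0 zero_in[OF P] by (intro cyl_translate(2)[OF x]) auto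
      then show "x \<in> ?C" by simp
    qed
    moreover have "ball q (13 * R) \<inter> P \<subseteq> ball 0 (16 * R) \<inter> P"
    proof
      fix x assume "x \<in> ball q (13 * R) \<inter> P"
      then show "x \<in> ball 0 (16 * R) \<inter> P"
        using norm_triangle_ineq[of q "x - q"] q(2) by (simp add: dist_norm norm_minus_commute)
    qed
    moreover have "?E \<subseteq> ball 0 (16 * R) \<inter> P" using R(1) by auto
    ultimately have "separated (?U \<union> ?V q) (?E \<union> (ball q (13 * R) \<inter> P))"
      by (intro separated_mono[OF sep[OF P]]) blast+
    moreover have "5 \<le> card (?E \<inter> (ball q (13 * R) \<inter> P))"
      using q(2) by (intro five_points[OF P]) simp
    ultimately have "alternating_in H (?U \<inter> ?V q) (?E \<union> (ball q (13 * R) \<inter> P))"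
      using alternating_in_Int[OF H _ _ U V] by blast
    then have "alternating_in H (?U \<inter> ?V q) ?E" by (rule alternating_in_mono) simp
    moreover have "?U \<inter> ?V q = cell k P \<inter> (\<Inter>q\<in>insert q S. ?V q)" by auto
    ultimately show ?case by simp
  qed
  from this[OF finite_ball[OF P] order_refl]
  have "alternating_in H (cell k P \<inter> cell (Suc k) P) ?E" by simp
  moreover have "cell k P \<inter> cell (Suc k) P = cell (Suc k) P"
    using cell_Suc_subset[OF P] by blast
  ultimately show ?case by simp
qed

text \<open>Cells of high level anchored at \<open>q\<close> rather than at the origin cut the
  cylinder into finitely many blocks. The bound on \<open>s\<close> makes the points of
  \<open>P\<close> near \<open>q\<close> belong to every member of the cylinder.\<close>

lemma alternating_in_ball:
  assumes P: "P \<in> X" and q: "q \<in> P" "norm q < K" and s: "s \<ge> K + 13 * R"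
    and sepP: "separated (cylinder s P) (ball q (13 * R) \<inter> P)"
  shows "alternating_in H (cylinder s P) (ball q (13 * R) \<inter> P)"
  unfolding alternating_in_def
proof (intro ballI impI)
  fix a b c assume abc: "a \<in> ball q (13 * R) \<inter> P" "b \<in> ball q (13 * R) \<inter> P" "c \<in> ball q (13 * R) \<inter> P"
    "distinct [a, b, c]"
  have K: "K > 0" using q(2) norm_ge_zero[of q] by linarith
  \<comment> \<open>A level whose cells lie in cylinders of radius \<open>s + K\<close>; translating
    back by \<open>q\<close>, with \<open>norm q < K\<close>, still leaves radius
    \<open>s\<close>.\<close>
  obtain k :: nat where "(s + K) / R < k" using reals_Archimedean2 by blast
  then have k: "s + K \<le> s0 + k * R" using R(1) s0 by (simp add: field_simps)
  let ?cl = "\<lambda>P'. translate q ` cell k (translate (- q) P')"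
  have qin: "q \<in> P'" "translate (- q) P' \<in> X" if "P' \<in> cylinder s P" for P'
  proof -
    show "q \<in> P'" using that q s R(1) by (auto simp: cyl_iff agree_iff)
    then show "translate (- q) P' \<in> X" using that translate_in_hull by (auto simp: cyl_iff)
  qed
  show "three_cycle (cylinder s P) a b c \<in> H"
  proof (rule three_cycle_partition[OF H, of ?cl])
    have "(\<lambda>P'. cell k (translate (- q) P')) ` cylinder s P = cell k ` (translate (- q) ` cylinder s P)"
      by (simp add: image_image)
    moreover have "finite \<dots>" using qin(2) by (intro finite_cells) blast
    ultimately have "finite ((\<lambda>C. translate q ` C) ` (\<lambda>P'. cell k (translate (- q) P')) ` cylinder s P)"
      by simp
    then show "finite (?cl ` cylinder s P)" by (simp add: image_image)
    show "separated (cylinder s P) {a, b, c}" using abc by (intro separated_mono[OF sepP]) auto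
    show "distinct [a, b, c]" by fact
    fix P' assume P': "P' \<in> cylinder s P"
    note X' = qin[OF P']
    show "P' \<in> ?cl P'" using cell_self[OF X'(2)] by (simp add: mem_translate_image)
    show "?cl P' \<subseteq> cylinder s P"
    proof
      fix x assume "x \<in> ?cl P'"
      then have "translate (- q) x \<in> cylinder (s0 + k * R) (translate (- q) P')"
        using cell_subset_cylinder[OF X'(2)] by (auto simp: mem_translate_image)
      then have x: "translate (- q) x \<in> cylinder (s + K) (translate (- q) P')"
        using cyl_mono[OF k] by blast
      have "translate (- (- q)) (translate (- q) x) \<in> cylinder s (translate (- (- q)) (translate (- q) P'))"
        using q s K R(1) P' by (intro cyl_translate(2)[OF x]) (auto simp: cyl_iff zero_in)
      then have "x \<in> cylinder s P'" by simp
      then show "x \<in> cylinder s P" using cyl_eq[OF P'] by simp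
    qed
    show "?cl P'' = ?cl P'" if "P'' \<in> ?cl P'" for P''
      using that cell_eq[OF X'(2)] by (simp add: mem_translate_image)
    have "x \<in> P'" if "x \<in> ball q (13 * R) \<inter> P" for x
    proof -
      have "norm x < s"
        using that norm_triangle_ineq[of q "x - q"] q(2) s by (simp add: dist_norm norm_minus_commute)
      then show ?thesis using that P' by (auto simp: cyl_iff agree_iff)
    qed
    then have "{a, b, c} \<subseteq> ball q (13 * R) \<inter> P'" using abc by auto
    moreover have "alternating_in H (?cl P') (ball q (13 * R) \<inter> P')"
      using alternating_in_translate[OF alternating_in_cell[OF X'(2)], of q] by (simp only: translate_ball)
    ultimately show "three_cycle (?cl P') a b c \<in> H" using abc(4) by (intro alternating_inD)
  qed
qed

text \<open>Moving \<open>R\<close> towards the origin and then less than \<open>R\<close> to a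
  point of \<open>P\<close> decreases the norm and covers a distance below \<open>2 * R\<close>. If
  \<open>q\<close> is within \<open>2 * R\<close> of the origin, the origin itself serves.\<close>

lemma nearer_neighbour:
  assumes P: "P \<in> X" and q: "q \<in> P" "q \<noteq> 0"
  obtains q' where "q' \<in> P" "norm q' < norm q" "norm (q' - q) < 3 * R"
proof (cases "norm q < 2 * R")
  case True
  then show ?thesis using that[of 0] zero_in[OF P] q R(1) by auto
next
  case False
  define y where "y = (1 - R / norm q) *\<^sub>R q"
  have "norm q > 0" using q(2) by simp
  then have "R / norm q \<le> 1" using False R(1) by (subst divide_le_eq_1_pos) auto
  then have "1 - R / norm q \<ge> 0" by simp
  then have "norm y = (1 - R / norm q) * norm q" by (simp add: y_def)
  also have "\<dots> = norm q - R" using q(2) by (simp add: field_simps)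
  finally have ny: "norm y = norm q - R" .
  have "q - y = (R / norm q) *\<^sub>R q" by (simp add: y_def algebra_simps)
  then have "norm (q - y) = R" using q(2) R(1) by simp
  moreover obtain q' where q': "q' \<in> P" "norm (y - q') < R" using R(2)[OF P] by blast
  moreover have "norm q' \<le> norm y + norm (y - q')" using norm_triangle_ineq4[of y "y - q'"] by simp
  moreover have "norm (q' - q) \<le> norm (y - q') + norm (q - y)"
    using norm_triangle_ineq[of "y - q'" "q - y"] by (simp add: norm_minus_commute)
  ultimately show ?thesis using that[of q'] ny R(1) by linarith
qed

text \<open>The small balls are joined in order of increasing norm of their centres. Each new one
  shares five points with the ball of a nearer centre, so \<open>alternating_in_Int\<close> with
  equal index sets enlarges the set of letters.\<close>

lemma alternating_in_large_ball:
  assumes P: "P \<in> X" and s: "s \<ge> K + 13 * R"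
    and sepP: "separated (cylinder s P) (ball 0 (K + 13 * R) \<inter> P)"
  shows "alternating_in H (cylinder s P) (ball 0 K \<inter> P)"
proof -
  let ?B = "\<lambda>q. ball q (13 * R) \<inter> P"
  have sub: "?B q \<subseteq> ball 0 (K + 13 * R) \<inter> P" if "norm q < K" for q
  proof
    fix x assume "x \<in> ?B q"
    then show "x \<in> ball 0 (K + 13 * R) \<inter> P"
      using that norm_triangle_ineq[of q "x - q"] by (simp add: dist_norm norm_minus_commute)
  qed
  \<comment> \<open>The descent condition survives removal of a centre of largest norm, because the
    neighbour it provides has strictly smaller norm.\<close>
  have *: "finite S \<Longrightarrow> S \<noteq> {} \<longrightarrow> S \<subseteq> ball 0 K \<inter> P \<longrightarrow>
      (\<forall>q\<in>S. q = 0 \<or> (\<exists>q'\<in>S. norm q' < norm q \<and> norm (q' - q) < 3 * R)) \<longrightarrow>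
      alternating_in H (cylinder s P) (\<Union>q\<in>S. ?B q)" for S
  proof (induction S rule: finite_ranking_induct[where f = norm])
    case (insert x S)
    show ?case
    proof (intro impI)
      assume S: "insert x S \<subseteq> ball 0 K \<inter> P"
        and chain: "\<forall>q\<in>insert x S. q = 0 \<or> (\<exists>q'\<in>insert x S. norm q' < norm q \<and> norm (q' - q) < 3 * R)"
      have x: "alternating_in H (cylinder s P) (?B x)"
        using S sub[of x] by (intro alternating_in_ball[OF P _ _ s] separated_mono[OF sepP]) auto
      show "alternating_in H (cylinder s P) (\<Union>q\<in>insert x S. ?B q)"
      proof (cases "S = {}")
        case True
        then show ?thesis using x by simp
      next
        case False
        have chain': "\<forall>q\<in>S. q = 0 \<or> (\<exists>q'\<in>S. norm q' < norm q \<and> norm (q' - q) < 3 * R)"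
          using chain insert.hyps(2) by (metis insert_iff not_less)
        then have IH: "alternating_in H (cylinder s P) (\<Union>q\<in>S. ?B q)"
          using insert.IH False S by blast
        have "\<exists>q'\<in>S. norm (q' - x) < 3 * R"
        proof (cases "x = 0")
          case True
          obtain y where "y \<in> S" using False by blast
          then have "norm y \<le> norm x" using insert.hyps(2) by blast
          then show ?thesis using True \<open>y \<in> S\<close> R(1) by (intro bexI[of _ y]) auto
        next
          case False
          then show ?thesis using chain by auto
        qed
        then obtain q' where q': "q' \<in> S" "norm (q' - x) < 3 * R" by blast
        let ?U = "\<Union>q\<in>S. ?B q"
        have subU: "?U \<union> ?B x \<subseteq> ball 0 (K + 13 * R) \<inter> P"
          using sub S by fastforce
        have "card (?B q' \<inter> ?B x) \<le> card (?U \<inter> ?B x)"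
          using q'(1) finite_subset[OF subU finite_ball[OF P]] by (intro card_mono) auto
        then have "5 \<le> card (?U \<inter> ?B x)" using five_points[OF P q'(2)] by linarith
        moreover have "separated (cylinder s P \<union> cylinder s P) (?U \<union> ?B x)"
          using subU by (intro separated_mono[OF sepP]) auto
        ultimately have "alternating_in H (cylinder s P \<inter> cylinder s P) (?U \<union> ?B x)"
          using alternating_in_Int[OF H _ _ IH x] by blast
        then show ?thesis by (simp add: Un_commute)
      qed
    qed
  qed simp
  show ?thesis
  proof (cases "K > 0")
    case True
    have "alternating_in H (cylinder s P) (\<Union>q\<in>ball 0 K \<inter> P. ?B q)"
    proof (intro *[OF finite_ball[OF P], rule_format])
      have "0 \<in> ball 0 K \<inter> P" using True zero_in[OF P] by auto
      then show "ball 0 K \<inter> P \<noteq> {}" by blast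
      fix q assume q: "q \<in> ball 0 K \<inter> P"
      show "q = 0 \<or> (\<exists>q'\<in>ball 0 K \<inter> P. norm q' < norm q \<and> norm (q' - q) < 3 * R)"
      proof (cases "q = 0")
        case False
        obtain q' where "q' \<in> P" "norm q' < norm q" "norm (q' - q) < 3 * R"
          using nearer_neighbour[OF P _ False] q by blast
        then show ?thesis using q by (intro disjI2 bexI[of _ q']) auto
      qed simp
    qed simp
    then show ?thesis using R(1) by (rule_tac alternating_in_mono) auto
  next
    case False
    then show ?thesis by (simp add: alternating_in_def ball_empty)
  qed
qed

lemma cycles_subset: "cycles \<subseteq> H"
proof
  fix f assume "f \<in> cycles"
  then obtain D a b c t where f: "f = three_cycle D a b c" and t: "t > 0" "determined Q t D"
    and abc: "\<And>P. P \<in> D \<Longrightarrow> {a, b, c} \<subseteq> P" "separated D {a, b, c}" "distinct [a, b, c]"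
    unfolding cycles_def by blast
  define K where "K = norm a + norm b + norm c + 1"
  have K: "norm a < K" "norm b < K" "norm c < K"
    unfolding K_def using norm_ge_zero[of a] norm_ge_zero[of b] norm_ge_zero[of c] by linarith+
  obtain s1 where s1: "\<And>P. P \<in> X \<Longrightarrow> separated (cylinder s1 P) (ball 0 (K + 13 * R) \<inter> P)"
    using separated_cylinders[of "K + 13 * R"] by blast
  \<comment> \<open>\<open>t\<close> resolves \<open>D\<close>, \<open>s1\<close> separates the
    letters, and \<open>K + 13 * R\<close> makes them visible in the cylinder.\<close>
  define s where "s = max (max t s1) (K + 13 * R)"
  have s: "t \<le> s" "s1 \<le> s" "K + 13 * R \<le> s" by (auto simp: s_def)
  show "f \<in> H"
    unfolding f
  proof (rule three_cycle_by_cylinders[OF H _ determined_le[OF t(2) s(1)] abc(2,3)])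
    show "s > 0" using t s by linarith
    fix P assume P: "P \<in> D"
    then have X: "P \<in> X" using t(2) by (auto simp: determined_def)
    have "alternating_in H (cylinder s P) (ball 0 K \<inter> P)"
      using cyl_mono[OF s(2)] by (intro alternating_in_large_ball[OF X s(3)] separated_mono[OF s1[OF X]]) auto
    then show "three_cycle (cylinder s P) a b c \<in> H"
      using abc K P by (intro alternating_inD) auto
  qed
qed

end

end

lemma cycles_finitely_generated:
  obtains S where "finite S" "S \<subseteq> cycles" "\<And>H. comp_closed H \<Longrightarrow> S \<subseteq> H \<Longrightarrow> cycles \<subseteq> H"
proof -
  obtain R where R: "R > 0" "\<And>P x. P \<in> X \<Longrightarrow> \<exists>q\<in>P. norm (x - q) < R"
    using relatively_dense by blast
  obtain s1 where s1: "s1 > 0" "\<And>P. P \<in> X \<Longrightarrow> separated (cylinder s1 P) (ball 0 (16 * R) \<inter> P)"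
    using separated_cylinders[of "16 * R"] by blast
  \<comment> \<open>Two demands are met at once: radius \<open>s0 - 3 * R\<close> must still
    separate the points within \<open>16 * R\<close>, and radius \<open>s0\<close> must show all
    displacements below \<open>13 * R\<close>.\<close>
  define s0 where "s0 = s1 + 16 * R"
  have s0: "s0 > 3 * R" "s0 > 0" "s1 \<le> s0" "13 * R \<le> s0" "s1 \<le> s0 - 3 * R"
    using s1(1) R(1) by (auto simp: s0_def)
  let ?F = "\<Union>P\<in>X. ball 0 (13 * R) \<inter> P"
  \<comment> \<open>There are finitely many cylinders of radius \<open>s0\<close>, and finite local
    complexity bounds the displacements occurring in a ball of radius \<open>13 * R\<close>.\<close>
  define S where "S = {three_cycle (cylinder s0 P) a b c | P a b c.
     P \<in> X \<and> {a, b, c} \<subseteq> ball 0 (13 * R) \<inter> P \<and> distinct [a, b, c]}"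
  have "finite ?F"
    using finite_patches[of "13 * R"] R(1) finite_ball by (intro finite_Union) auto
  then have "finite ((\<lambda>(C, a, b, c). three_cycle C a b c) ` (cylinder s0 ` X \<times> ?F \<times> ?F \<times> ?F))"
    using finite_cylinders[OF s0(2)] by simp
  moreover have "S \<subseteq> (\<lambda>(C, a, b, c). three_cycle C a b c) ` (cylinder s0 ` X \<times> ?F \<times> ?F \<times> ?F)"
  proof
    fix f assume "f \<in> S"
    then obtain P a b c where f: "f = three_cycle (cylinder s0 P) a b c" and P: "P \<in> X"
      "{a, b, c} \<subseteq> ball 0 (13 * R) \<inter> P" unfolding S_def by blast
    then have "(cylinder s0 P, a, b, c) \<in> cylinder s0 ` X \<times> ?F \<times> ?F \<times> ?F" by blast
    then show "f \<in> (\<lambda>(C, a, b, c). three_cycle C a b c) ` (cylinder s0 ` X \<times> ?F \<times> ?F \<times> ?F)"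
      unfolding f by (rule rev_image_eqI) simp
  qed
  ultimately have "finite S" using finite_subset by blast
  moreover have "S \<subseteq> cycles"
  proof
    fix f assume "f \<in> S"
    then obtain P a b c where f: "f = three_cycle (cylinder s0 P) a b c" and P: "P \<in> X"
      "{a, b, c} \<subseteq> ball 0 (13 * R) \<inter> P" "distinct [a, b, c]" unfolding S_def by blast
    have "separated (cylinder s0 P) {a, b, c}"
      using P(2) cyl_mono[OF s0(3)] R(1) by (intro separated_mono[OF s1(2)[OF P(1)]]) auto
    moreover have "{a, b, c} \<subseteq> P'" if "P' \<in> cylinder s0 P" for P'
      using that P(2) s0(4) by (auto simp: cyl_iff agree_iff)
    ultimately show "f \<in> cycles"
      unfolding f using s0(2) determined_cyl P(3) by (intro cyclesI)
  qed
  moreover have "cycles \<subseteq> H" if H: "comp_closed H" "S \<subseteq> H" for H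
  proof (rule cycles_subset[OF R s0(1) H(1)])
    show "alternating_in H (cylinder s0 P) (ball 0 (13 * R) \<inter> P)" if "P \<in> X" for P
      unfolding alternating_in_def using that H(2) S_def by blast
    show "separated (cylinder (s0 - 3 * R) P) (ball 0 (16 * R) \<inter> P)" if "P \<in> X" for P
      using cyl_mono[OF s0(5)] by (intro separated_mono[OF s1(2)[OF that]]) auto
  qed
  ultimately show thesis by (rule that)
qed

end

section \<open>Simplicity\<close>

abbreviation finv :: "('a \<Rightarrow> 'b) \<Rightarrow> 'b \<Rightarrow> 'a" where
  "finv \<equiv> inv_into UNIV"

lemma commute_disjoint_support:
  assumes "inj k" "inj m" "\<And>x. k x \<noteq> x \<Longrightarrow> x \<in> U" "\<And>x. m x \<noteq> x \<Longrightarrow> x \<notin> U"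
  shows "m \<circ> k = k \<circ> m"
proof
  fix x
  show "(m \<circ> k) x = (k \<circ> m) x"
  proof (cases "k x = x")
    case True
    have "k (m x) = m x"
    proof (rule ccontr)
      assume *: "k (m x) \<noteq> m x"
      then have "m (m x) = m x" using assms(3,4) by blast
      then have "m x = x" using assms(2) by (simp add: inj_eq)
      with * True show False by simp
    qed
    then show ?thesis using True by simp
  next
    case False
    then have "k (k x) \<noteq> k x" using assms(1) by (simp add: inj_eq)
    then have "m (k x) = k x" "m x = x" using False assms(3,4) by blast+
    then show ?thesis by simp
  qed
qed

lemma inv_three_cycle:
  assumes "separated U {a, b, c}" "distinct [a, b, c]"
  shows "finv (three_cycle U a b c) = three_cycle U a c b" "bij (three_cycle U a b c)"
proof -
  have 1: "three_cycle U a b c \<circ> three_cycle U a c b = id" by (rule three_cycle_inverse[OF assms])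
  have 2: "three_cycle U a c b \<circ> three_cycle U a b c = id"
    using assms by (intro three_cycle_inverse) (auto simp: insert_commute)
  show "finv (three_cycle U a b c) = three_cycle U a c b" using inv_unique_comp[OF 1 2] .
  show "bij (three_cycle U a b c)" using o_bij[OF 2 1] .
qed

context aperiodic_quasicrystal
begin

text \<open>The condition \<open>v \<in> P'\<close> keeps images in the hull, and fixing every set
  outside it makes the later passage to bisections injective.\<close>

definition full_perms :: "((real ^ 'n) set \<Rightarrow> (real ^ 'n) set) set" where
  "full_perms = {g. bij g \<and> (\<forall>P. P \<notin> X \<longrightarrow> g P = P) \<and>
     (\<forall>P\<in>X. \<exists>s>0. \<exists>v. \<forall>P'\<in>cylinder s P. v \<in> P' \<and> g P' = translate (- v) P')}"

lemma full_permsD: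
  assumes "g \<in> full_perms"
  shows "bij g" "P \<notin> X \<Longrightarrow> g P = P"
    "P \<in> X \<Longrightarrow> \<exists>s>0. \<exists>v. \<forall>P'\<in>cylinder s P. v \<in> P' \<and> g P' = translate (- v) P'"
  using assms by (auto simp: full_perms_def)

lemma full_perms_in_X:
  assumes "g \<in> full_perms"
  shows "g P \<in> X \<longleftrightarrow> P \<in> X"
proof
  assume "P \<in> X"
  then show "g P \<in> X"
    using full_permsD(3)[OF assms, of P] cyl_self[of P] translate_in_hull by metis
next
  assume "g P \<in> X"
  then show "P \<in> X" using full_permsD(2)[OF assms, of P] by (cases "P \<in> X") auto
qed

lemma id_in_full_perms: "id \<in> full_perms"
  unfolding full_perms_def
proof (intro CollectI conjI allI ballI impI)
  fix P assume "P \<in> X"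
  have "\<forall>P'\<in>cylinder 1 P. 0 \<in> P' \<and> id P' = translate (- 0) P'"
    by (simp add: cyl_iff zero_in)
  then show "\<exists>s>0. \<exists>v. \<forall>P'\<in>cylinder s P. v \<in> P' \<and> id P' = translate (- v) P'"
    using zero_less_one by blast
qed auto

lemma comp_in_full_perms:
  assumes g: "g \<in> full_perms" and h: "h \<in> full_perms"
  shows "g \<circ> h \<in> full_perms"
  unfolding full_perms_def
proof (intro CollectI conjI allI ballI impI)
  show "bij (g \<circ> h)" using full_permsD(1)[OF g] full_permsD(1)[OF h] by (rule bij_comp[rotated])
  show "(g \<circ> h) P = P" if "P \<notin> X" for P using that full_permsD(2)[OF g] full_permsD(2)[OF h] by simp
  fix P assume P: "P \<in> X"
  obtain s v where s: "s > 0" "\<And>P'. P' \<in> cylinder s P \<Longrightarrow> v \<in> P' \<and> h P' = translate (- v) P'"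
    using full_permsD(3)[OF h P] by blast
  have v: "v \<in> P" "h P = translate (- v) P" using s(2)[OF cyl_self[OF P]] by auto
  have "h P \<in> X" using full_perms_in_X[OF h] P by simp
  then obtain t w where t: "t > 0" "\<And>P'. P' \<in> cylinder t (h P) \<Longrightarrow> w \<in> P' \<and> g P' = translate (- w) P'"
    using full_permsD(3)[OF g, of "h P"] by blast
  let ?r = "s + t + norm v"
  have "v + w \<in> P' \<and> (g \<circ> h) P' = translate (- (v + w)) P'" if P': "P' \<in> cylinder ?r P" for P'
  proof -
    have "P' \<in> cylinder s P" using P' cyl_mono[of s ?r] t(1) by (meson add_increasing2 le_add_same_cancel1 less_imp_le norm_ge_zero subsetD)
    then have hP': "h P' = translate (- v) P'" using s(2) by blast
    have "translate (- v) P' \<in> cylinder t (h P)"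
      unfolding v(2) using v(1) s(1) t(1) by (intro cyl_translate(2)[OF P']) auto
    then have "w \<in> translate (- v) P' \<and> g (translate (- v) P') = translate (- w) (translate (- v) P')"
      by (rule t(2))
    then show ?thesis by (simp add: hP' add.commute)
  qed
  moreover have "?r > 0" using s(1) t(1) by (simp add: add_pos_nonneg)
  ultimately show "\<exists>s>0. \<exists>v. \<forall>P'\<in>cylinder s P. v \<in> P' \<and> (g \<circ> h) P' = translate (- v) P'" by blast
qed

lemma inv_in_full_perms:
  assumes g: "g \<in> full_perms"
  shows "finv g \<in> full_perms"
  unfolding full_perms_def
proof (intro CollectI conjI allI ballI impI)
  note b = full_permsD(1)[OF g]
  show "bij (finv g)" using b by (rule bij_imp_bij_inv)
  show "finv g P = P" if "P \<notin> X" for P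
    using that full_permsD(2)[OF g, of P] b by (metis bij_inv_eq_iff)
  fix P assume P: "P \<in> X"
  let ?P0 = "finv g P"
  have gP0: "g ?P0 = P" using b by (meson bij_inv_eq_iff)
  then have "?P0 \<in> X" using full_perms_in_X[OF g, of ?P0] P by simp
  then obtain s v where s: "s > 0" "\<And>P'. P' \<in> cylinder s ?P0 \<Longrightarrow> v \<in> P' \<and> g P' = translate (- v) P'"
    using full_permsD(3)[OF g, of ?P0] by blast
  have P_eq: "P = translate (- v) ?P0" using s(2)[OF cyl_self[OF \<open>?P0 \<in> X\<close>]] gP0 by simp
  have P0_eq: "translate v P = ?P0" by (subst P_eq) simp
  have mv: "- v \<in> P" using zero_in[OF \<open>?P0 \<in> X\<close>] by (subst P_eq) simp
  let ?r = "s + norm v"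
  have "- v \<in> P' \<and> finv g P' = translate (- (- v)) P'" if P': "P' \<in> cylinder ?r P" for P'
  proof -
    have "translate (- (- v)) P' \<in> cylinder s (translate (- (- v)) P)"
      using mv s(1) by (intro cyl_translate(2)[OF P']) auto
    have "- v \<in> P'" using cyl_translate(1)[OF P' mv, of s] s(1) by simp
    have "translate v P' \<in> cylinder s ?P0"
      using \<open>translate (- (- v)) P' \<in> _\<close> by (simp add: P0_eq)
    then have "g (translate v P') = P'" using s(2) by simp
    then have "finv g P' = translate v P'" using b by (metis bij_inv_eq_iff)
    then show ?thesis using \<open>- v \<in> P'\<close> by simp
  qed
  moreover have "?r > 0" using s(1) by (simp add: add_pos_nonneg)
  ultimately show "\<exists>s>0. \<exists>v. \<forall>P'\<in>cylinder s P. v \<in> P' \<and> finv g P' = translate (- v) P'" by blast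
qed

lemma cycles_subset_full_perms: "cycles \<subseteq> full_perms"
proof
  fix f assume "f \<in> cycles"
  then obtain D a b c s where f: "f = three_cycle D a b c" and s: "s > 0" "determined Q s D"
    and abc: "\<And>P. P \<in> D \<Longrightarrow> {a, b, c} \<subseteq> P" "separated D {a, b, c}" "distinct [a, b, c]"
    unfolding cycles_def by blast
  have DX: "P \<in> X" if "P \<in> D" for P using that s(2) by (auto simp: determined_def)
  have orbit: "- q \<in> x" "x \<in> X" if "translate q x \<in> D" "q \<in> {a, b, c}" for q x
  proof -
    show "- q \<in> x" using zero_in[OF DX[OF that(1)]] by simp
    have "translate (- q) (translate q x) \<in> X"
      using abc(1)[OF that(1)] that(2) by (intro translate_in_hull[OF DX[OF that(1)]]) auto
    then show "x \<in> X" by simp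
  qed
  have imp: "translate q P' \<in> D"
    if q: "translate q P \<in> D" "q \<in> {a, b, c}" and P': "P' \<in> cylinder r P" "r \<ge> s + norm q" for P P' q r
  proof -
    have "translate (- (- q)) P' \<in> cylinder s (translate (- (- q)) P)"
      using orbit(1)[OF q] P'(2) s(1) by (intro cyl_translate(2)[OF P'(1)]) auto
    then show ?thesis using q(1) s(2) by (auto simp: determined_def)
  qed
  show "f \<in> full_perms"
    unfolding full_perms_def
  proof (intro CollectI conjI allI ballI impI)
    show "bij f" unfolding f by (rule inv_three_cycle(2)[OF abc(2,3)])
    show "f P = P" if "P \<notin> X" for P
      unfolding f three_cycle_def using orbit(2)[of _ P] that by auto
    fix P assume P: "P \<in> X"
    \<comment> \<open>Within this radius the three membership tests of the cycle have the same
      outcome, so one displacement serves the whole cylinder.\<close>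
    let ?r = "s + norm a + norm b + norm c"
    define v where "v = (if translate a P \<in> D then b - a else if translate b P \<in> D then c - b
      else if translate c P \<in> D then a - c else 0)"
    have "v \<in> P' \<and> f P' = translate (- v) P'" if P': "P' \<in> cylinder ?r P" for P'
    proof -
      have iff: "translate q P' \<in> D \<longleftrightarrow> translate q P \<in> D" if "q \<in> {a, b, c}" for q
      proof -
        have "s + norm q \<le> ?r" using that norm_ge_zero[of a] norm_ge_zero[of b] norm_ge_zero[of c] by auto
        moreover have "P \<in> cylinder ?r P'" using P' P by (auto simp: cyl_iff agree_sym)
        ultimately show ?thesis using imp[OF _ that] P' by blast
      qed
      have "0 \<in> P'" using P' zero_in by (simp add: cyl_iff)
      then show ?thesis
        using iff[of a] iff[of b] iff[of c] abc(1)[of "translate a P'"] abc(1)[of "translate b P'"]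
          abc(1)[of "translate c P'"]
        by (auto simp: f three_cycle_def v_def)
    qed
    moreover have "?r > 0" using s(1) by (simp add: add_pos_nonneg)
    ultimately show "\<exists>s>0. \<exists>v. \<forall>P'\<in>cylinder s P. v \<in> P' \<and> f P' = translate (- v) P'" by blast
  qed
qed

text \<open>Returns occur within a fixed distance \<open>D\<close> of every position, in particular
  of one at distance \<open>\<bar>B\<bar> + D\<close>, which defeats any bound \<open>B\<close> on
  their norms.\<close>

lemma infinite_returns:
  assumes P: "P \<in> X" and "P0 \<in> X" "t > 0"
  shows "infinite {e \<in> P. translate (- e) P \<in> cylinder t P0}"
proof
  assume fin: "finite {e \<in> P. translate (- e) P \<in> cylinder t P0}"
  obtain D where D: "D > 0" "\<And>x. \<exists>p\<in>P. norm (x - p) < D \<and> translate (- p) P \<in> cylinder t P0"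
    using minimal[OF assms(2,3)] P by metis
  obtain B where B: "\<And>e. e \<in> P \<Longrightarrow> translate (- e) P \<in> cylinder t P0 \<Longrightarrow> norm e \<le> B"
    using finite_imp_bounded[OF fin] unfolding bounded_iff by blast
  obtain u :: "real ^ 'n" where u: "norm u = 1" by (metis norm_axis_1)
  obtain p where p: "p \<in> P" "norm ((\<bar>B\<bar> + D) *\<^sub>R u - p) < D" "translate (- p) P \<in> cylinder t P0"
    using D(2) by blast
  have "norm ((\<bar>B\<bar> + D) *\<^sub>R u) = \<bar>B\<bar> + D" using u D(1) by simp
  then have "norm p > \<bar>B\<bar>"
    using norm_triangle_ineq2[of "(\<bar>B\<bar> + D) *\<^sub>R u" p] p(2) by linarith
  then show False using B[OF p(1,3)] by simp
qed

section \<open>Normal subgroups\<close>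

context
  fixes N :: "((real ^ 'n) set \<Rightarrow> (real ^ 'n) set) set"
  assumes N: "comp_closed N" "N \<subseteq> full_perms"
    and N_inv: "\<And>g. g \<in> N \<Longrightarrow> finv g \<in> N"
    and N_conj: "\<And>f g. f \<in> cycles \<Longrightarrow> g \<in> N \<Longrightarrow> f \<circ> (g \<circ> finv f) \<in> N"
begin

text \<open>One factor in \<open>N\<close> is enough: the commutator is \<open>h\<close> times a
  conjugate of its inverse, and equally a conjugate of \<open>k\<close> times the inverse of
  \<open>k\<close>.\<close>

lemma commutator_in_normal:
  assumes sep: "separated W {a, b, c, d, e}" and dist: "distinct [a, b, c, d, e]"
    and h: "three_cycle W a b c \<in> cycles" and k: "three_cycle W a d e \<in> cycles"
    and N': "three_cycle W a b c \<in> N \<or> three_cycle W a d e \<in> N"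
  shows "three_cycle W a b d \<in> N"
proof -
  let ?h = "three_cycle W a b c" and ?k = "three_cycle W a d e"
  have inv: "finv ?h = three_cycle W a c b" "finv ?k = three_cycle W a e d"
    using dist by (auto intro!: inv_three_cycle separated_mono[OF sep])
  have eq: "?h \<circ> (?k \<circ> (finv ?h \<circ> finv ?k)) = three_cycle W a b d"
    using three_cycle_commutator[of W W a b c d e] sep dist by (simp only: inv Un_absorb Int_absorb)
  from N' show ?thesis
  proof
    assume "?h \<in> N"
    then have "?h \<circ> (?k \<circ> (finv ?h \<circ> finv ?k)) \<in> N"
      by (intro comp_closedD[OF N(1)] N_conj[OF k] N_inv)
    then show ?thesis unfolding eq .
  next
    assume "?k \<in> N"
    then have "(?h \<circ> (?k \<circ> finv ?h)) \<circ> finv ?k \<in> N"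
      by (intro comp_closedD[OF N(1)] N_conj[OF h] N_inv)
    moreover have "(?h \<circ> (?k \<circ> finv ?h)) \<circ> finv ?k = ?h \<circ> (?k \<circ> (finv ?h \<circ> finv ?k))"
      by (simp only: comp_assoc)
    ultimately show ?thesis using eq by simp
  qed
qed

text \<open>
  If \<open>g\<close> moves \<open>U\<close> off itself and \<open>h\<close>, \<open>k\<close> are supported in \<open>U\<close>, then \<open>[[h, g], k] = [h, k]\<close>.
\<close>

lemma commutator_supported:
  assumes g: "g \<in> N" "\<And>x. x \<in> U \<Longrightarrow> g x \<notin> U"
    and sep: "separated W {a, b, c, d, e}" and dist: "distinct [a, b, c, d, e]"
    and h: "three_cycle W a b c \<in> cycles" and k: "three_cycle W a d e \<in> cycles"
    and U: "\<And>x q. q \<in> {a, b, c, d, e} \<Longrightarrow> translate q x \<in> W \<Longrightarrow> x \<in> U"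
  shows "three_cycle W a b d \<in> N"
proof -
  let ?h = "three_cycle W a b c" and ?k = "three_cycle W a d e"
  have bij: "bij g" "bij ?h" "bij ?k"
    using g(1) h k N(2) cycles_subset_full_perms full_permsD(1) by auto
  have inv: "finv ?h = three_cycle W a c b" "finv ?k = three_cycle W a e d"
    using dist by (auto intro!: inv_three_cycle separated_mono[OF sep])
  \<comment> \<open>\<open>m\<close> is the conjugate of the inverse of \<open>h\<close> by
    \<open>g\<close>, supported in the image of \<open>U\<close> under \<open>g\<close> and hence
    off \<open>U\<close>; \<open>n\<close> is the commutator of \<open>h\<close> and
    \<open>g\<close>.\<close>
  define m where "m = g \<circ> (finv ?h \<circ> finv g)"
  define n where "n = ?h \<circ> m"
  have "n = (?h \<circ> (g \<circ> finv ?h)) \<circ> finv g" by (simp only: n_def m_def comp_assoc)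
  then have n: "n \<in> N" using g(1) by (auto intro!: comp_closedD[OF N(1)] N_conj[OF h] N_inv)
  have m: "bij m" unfolding m_def using bij by (intro bij_comp bij_imp_bij_inv)
  have "m \<circ> ?k = ?k \<circ> m"
  proof (rule commute_disjoint_support[of _ _ U])
    show "inj ?k" "inj m" using bij m by (auto simp: bij_is_inj)
    show "x \<in> U" if "?k x \<noteq> x" for x
      using that U[of _ x] unfolding three_cycle_def by (auto split: if_splits)
    show "x \<notin> U" if "m x \<noteq> x" for x
    proof -
      have "three_cycle W a c b (finv g x) \<noteq> finv g x"
      proof
        assume "three_cycle W a c b (finv g x) = finv g x"
        then have "m x = g (finv g x)" by (simp add: m_def inv)
        also have "\<dots> = x" using bij(1) by (simp add: bij_is_surj surj_f_inv_f)
        finally show False using that by simp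
      qed
      then have "finv g x \<in> U"
        using U[of _ "finv g x"] unfolding three_cycle_def by (auto split: if_splits)
      then show ?thesis using g(2)[of "finv g x"] bij(1) by (simp add: bij_is_surj surj_f_inv_f)
    qed
  qed
  have bn: "bij n" unfolding n_def using bij(2) m by (intro bij_comp)
  have "finv ?h \<circ> n = m"
    unfolding n_def using bij(2) by (simp add: comp_assoc[symmetric] bij_is_inj)
  then have m_n: "m \<circ> finv n = finv ?h"
    using bn by (metis bij_is_surj comp_assoc surj_iff comp_id)
  \<comment> \<open>Once \<open>k\<close> has moved past \<open>m\<close>, the product of
    \<open>m\<close> and the inverse of \<open>n\<close> collapses to the inverse of
    \<open>h\<close>.\<close>
  have "n \<circ> (?k \<circ> (finv n \<circ> finv ?k)) \<in> N"
    using n by (intro comp_closedD[OF N(1)] N_conj[OF k] N_inv)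
  also have "n \<circ> (?k \<circ> (finv n \<circ> finv ?k)) = ?h \<circ> ((m \<circ> ?k) \<circ> (finv n \<circ> finv ?k))"
    by (simp only: n_def comp_assoc)
  also have "\<dots> = ?h \<circ> (?k \<circ> ((m \<circ> finv n) \<circ> finv ?k))"
    by (simp only: \<open>m \<circ> ?k = ?k \<circ> m\<close> comp_assoc)
  also have "\<dots> = three_cycle W a b d"
    using three_cycle_commutator[of W W a b c d e] sep dist by (simp only: m_n inv Un_absorb Int_absorb)
  finally show ?thesis .
qed

lemma moved_cylinder:
  assumes g: "g \<in> N" "g \<noteq> id"
  obtains P t where "P \<in> X" "t > 0" "\<And>x. x \<in> cylinder t P \<Longrightarrow> g x \<notin> cylinder t P"
proof -
  have gf: "g \<in> full_perms" using g(1) N(2) by blast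
  obtain P where "g P \<noteq> P" using g(2) by (metis eq_id_iff)
  then have P: "P \<in> X" using full_permsD(2)[OF gf] by blast
  obtain s v where s: "s > 0" "\<And>P'. P' \<in> cylinder s P \<Longrightarrow> v \<in> P' \<and> g P' = translate (- v) P'"
    using full_permsD(3)[OF gf P] by blast
  have gP: "g P = translate (- v) P" using s(2)[OF cyl_self[OF P]] by simp
  obtain u where u: "\<not> agree u P (translate (- v) P)"
  proof -
    have "\<exists>x. (x \<in> P) \<noteq> (x \<in> translate (- v) P)" using \<open>g P \<noteq> P\<close> unfolding gP by blast
    then obtain x where "(x \<in> P) \<noteq> (x \<in> translate (- v) P)" by blast
    then have "\<not> agree (norm x + 1) P (translate (- v) P)"
      unfolding agree_iff by (metis less_add_one)
    then show thesis by (rule that)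
  qed
  \<comment> \<open>Radius \<open>s\<close> makes \<open>g\<close> a translation by
    \<open>- v\<close>; \<open>\<bar>u\<bar> + norm v\<close> leaves radius \<open>u\<close> after
    that translation, where \<open>P\<close> and its image differ.\<close>
  let ?t = "max s (\<bar>u\<bar> + norm v)"
  have "g x \<notin> cylinder ?t P" if x: "x \<in> cylinder ?t P" for x
  proof
    assume gx: "g x \<in> cylinder ?t P"
    have "g x = translate (- v) x" using s(2) x cyl_mono[of s ?t] by auto
    moreover have "u \<le> \<bar>u\<bar> + norm v" using norm_ge_zero[of v] by linarith
    then have "u \<le> ?t" by simp
    ultimately have "agree u P (translate (- v) x)" using gx agree_le[of ?t P "g x" u] by (simp add: cyl_iff)
    moreover have "agree u (translate (- v) P) (translate (- v) x)"
      using x by (auto simp: cyl_iff intro!: agree_translate[of ?t])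
    ultimately show False using u by (meson agree_sym agree_trans)
  qed
  then show thesis using that[of P ?t] P s(1) by auto
qed

text \<open>Around five returns of the orbit to a cylinder moved off itself by \<open>g\<close>,
  \<open>commutator_supported\<close> puts three-cycles into \<open>N\<close>. Commutators with
  arbitrary cycles then trade these letters for \<open>p\<close>, \<open>q\<close>,
  \<open>w\<close>: the stages \<open>0\<close>, \<open>1\<close>, \<open>2\<close> and the
  conclusion have three, two, one and no letters from \<open>E\<close>.\<close>

lemma local_cycle_in_normal:
  assumes g: "g \<in> N" "g \<noteq> id" and P: "P \<in> X" and abc: "{p, q, w} \<subseteq> P" "distinct [p, q, w]"
  obtains r where "r > 0"
    "\<And>W s. W \<subseteq> cylinder r P \<Longrightarrow> s > 0 \<Longrightarrow> determined Q s W \<Longrightarrow> three_cycle W p q w \<in> N"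
proof -
  obtain P0 t where P0: "P0 \<in> X" "t > 0" "\<And>x. x \<in> cylinder t P0 \<Longrightarrow> g x \<notin> cylinder t P0"
    using moved_cylinder[OF g] by blast
  have "infinite ({e \<in> P. translate (- e) P \<in> cylinder t P0} - {p, q, w})"
    using infinite_returns[OF P P0(1,2)] by simp
  then obtain E where E: "E \<subseteq> {e \<in> P. translate (- e) P \<in> cylinder t P0} - {p, q, w}" "card E = 5" "finite E"
    by (meson infinite_arbitrarily_large)
  let ?E = "E \<union> {p, q, w}"
  obtain B where B: "\<And>e. e \<in> ?E \<Longrightarrow> norm e \<le> B"
    using finite_imp_bounded[of ?E] E(3) unfolding bounded_iff by blast
  obtain s1 where s1: "\<And>P. P \<in> X \<Longrightarrow> separated (cylinder s1 P) (ball 0 (B + 1) \<inter> P)"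
    using separated_cylinders[of "B + 1"] by blast
  have B0: "B \<ge> 0" using order_trans[OF norm_ge_zero B[of p]] by simp
  \<comment> \<open>\<open>s1\<close> separates the letters; \<open>B + t\<close> leaves radius
    \<open>t\<close> after a shift by any of them, so translates of \<open>W\<close> by letters in
    \<open>E\<close> land in the moved cylinder.\<close>
  define r where "r = max s1 (B + t)"
  have r: "s1 \<le> r" "B + t \<le> r" "r > 0" using B0 P0(2) by (auto simp: r_def)
  have "norm e < B + 1" if "e \<in> ?E" for e using B[OF that] by simp
  then have EP: "?E \<subseteq> ball 0 (B + 1) \<inter> P" using E(1) abc(1) by auto
  have "three_cycle W p q w \<in> N" if W: "W \<subseteq> cylinder r P" "s > 0" "determined Q s W" for W s
  proof -
    have sep: "separated W ?E"
      using W(1) cyl_mono[OF r(1)] EP by (intro separated_mono[OF s1[OF P]]) auto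
    have EW: "?E \<subseteq> P'" if "P' \<in> W" for P'
    proof
      fix e assume e: "e \<in> ?E"
      then have "norm e < r" using B[OF e] r(2) P0(2) by linarith
      moreover have "agree r P P'" using that W(1) by (auto simp: cyl_iff)
      ultimately show "e \<in> P'" using e EP by (auto simp: agree_iff)
    qed
    have cyc: "three_cycle W a b c \<in> cycles" if "{a, b, c} \<subseteq> ?E" "distinct [a, b, c]" for a b c
      using that EW by (intro cyclesI[OF W(2,3)] separated_mono[OF sep]) auto
    have rot: "three_cycle W b c a = three_cycle W a b c" if "{a, b, c} \<subseteq> ?E" "distinct [a, b, c]" for a b c
      using that by (intro three_cycle_rotate separated_mono[OF sep]) auto
    have comm: "three_cycle W a b d \<in> N"
      if "{a, b, c, d, e} \<subseteq> ?E" "distinct [a, b, c, d, e]" "three_cycle W a b c \<in> N \<or> three_cycle W a d e \<in> N"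
      for a b c d e
      using that by (intro commutator_in_normal[of W a b c d e] separated_mono[OF sep] cyc) auto
    have fresh: "\<exists>x y. x \<in> E \<and> y \<in> E \<and> x \<noteq> y \<and> x \<notin> {a, b, c} \<and> y \<notin> {a, b, c}" for a b c
    proof -
      have "5 \<le> card E" using E(2) by simp
      then show ?thesis using fresh_two[of E a b c] by blast
    qed
    have 0: "three_cycle W a b d \<in> N" if "{a, b, d} \<subseteq> E" "distinct [a, b, d]" for a b d
    proof -
      obtain c e where ce: "c \<in> E" "e \<in> E" "c \<noteq> e" "c \<notin> {a, b, d}" "e \<notin> {a, b, d}"
        using fresh[of a b d] by blast
      show ?thesis
      proof (rule commutator_supported[OF g(1) P0(3)])
        show "separated W {a, b, c, d, e}" using that ce by (intro separated_mono[OF sep]) auto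
        show "distinct [a, b, c, d, e]" using that ce by auto
        show "three_cycle W a b c \<in> cycles" "three_cycle W a d e \<in> cycles" using that ce by (auto intro!: cyc)
        fix x q' assume q': "q' \<in> {a, b, c, d, e}" "translate q' x \<in> W"
        then have q'E: "q' \<in> E" using that ce by auto
        have q'P: "q' \<in> P" "translate (- q') P \<in> cylinder t P0" using q'E E(1) by auto
        have "norm q' \<le> B" using B q'E by auto
        have x: "translate q' x \<in> cylinder r P" using q'(2) W(1) by blast
        have "translate (- q') (translate q' x) \<in> cylinder t (translate (- q') P)"
          using q'P(1) \<open>norm q' \<le> B\<close> r(2) P0(2) by (intro cyl_translate(2)[OF x]) auto
        then show "x \<in> cylinder t P0" using cyl_eq[OF q'P(2)] by simp
      qed
    qed
    have 1: "three_cycle W a b x \<in> N" if "{a, b} \<subseteq> E" "x \<in> ?E" "distinct [a, b, x]" for a b x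
    proof -
      obtain c e where ce: "c \<in> E" "e \<in> E" "c \<noteq> e" "c \<notin> {a, b, x}" "e \<notin> {a, b, x}"
        using fresh[of a b x] by blast
      show ?thesis using that ce 0[of a b c] by (intro comm[of a b c x e]) auto
    qed
    have 2: "three_cycle W a x y \<in> N" if "a \<in> E" "{x, y} \<subseteq> ?E" "distinct [a, x, y]" for a x y
    proof -
      obtain c e where ce: "c \<in> E" "e \<in> E" "c \<noteq> e" "c \<notin> {a, x, y}" "e \<notin> {a, x, y}"
        using fresh[of a x y] by blast
      \<comment> \<open>Stage \<open>1\<close> puts a free letter only in last position; squaring
        exchanges the last two.\<close>
      have "three_cycle W a e y \<in> N" using that ce by (intro 1) auto
      moreover have "three_cycle W a e y \<circ> three_cycle W a e y = three_cycle W a y e"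
        using that ce by (intro three_cycle_square separated_mono[OF sep]) auto
      ultimately have "three_cycle W a y e \<in> N" using comp_closedD[OF N(1)] by metis
      then show ?thesis using that ce by (intro comm[of a x c y e]) auto
    qed
    obtain c e where ce: "c \<in> E" "e \<in> E" "c \<noteq> e" "c \<notin> {p, q, w}" "e \<notin> {p, q, w}"
      using fresh[of p q w] by blast
    have "three_cycle W c p q \<in> N" using ce abc(2) by (intro 2) auto
    then have "three_cycle W p q c \<in> N" using rot[of c p q] ce abc(2) by auto
    then show ?thesis using ce abc(2) by (intro comm[of p q c w e]) auto
  qed
  with r(3) show thesis by (rule that)
qed

lemma cycles_subset_normal:
  assumes g: "g \<in> N" "g \<noteq> id"
  shows "cycles \<subseteq> N"
proof
  fix f assume "f \<in> cycles"
  then obtain D a b c s where f: "f = three_cycle D a b c" and s: "s > 0" "determined Q s D"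
    and abc: "\<And>P. P \<in> D \<Longrightarrow> {a, b, c} \<subseteq> P" "separated D {a, b, c}" "distinct [a, b, c]"
    unfolding cycles_def by blast
  \<comment> \<open>Ranging over all clopen pieces \<open>W\<close> of \<open>A\<close> inside
    \<open>D\<close> makes the property pass to smaller \<open>A\<close>.\<close>
  define \<Phi> :: "(real ^ 'n) set set \<Rightarrow> bool" where "\<Phi> A \<longleftrightarrow>
    (\<forall>W t. W \<subseteq> A \<longrightarrow> W \<subseteq> D \<longrightarrow> t > 0 \<longrightarrow> determined Q t W \<longrightarrow> three_cycle W a b c \<in> N)" for A
  have "\<exists>r>0. \<Phi> (cylinder r P)" if P: "P \<in> X" for P
  proof (cases "P \<in> D")
    case True
    obtain r where "r > 0"
      "\<And>W t. W \<subseteq> cylinder r P \<Longrightarrow> t > 0 \<Longrightarrow> determined Q t W \<Longrightarrow> three_cycle W a b c \<in> N"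
      using local_cycle_in_normal[OF g P abc(1)[OF True] abc(3)] by blast
    then show ?thesis unfolding \<Phi>_def by blast
  next
    case False
    \<comment> \<open>Around a point off \<open>D\<close> the cylinder of radius \<open>s\<close>
      misses \<open>D\<close>, so only the empty index set is left, whose cycle is the
      identity.\<close>
    have "W = {}" if "W \<subseteq> cylinder s P" "W \<subseteq> D" for W
    proof (rule ccontr)
      assume "W \<noteq> {}"
      then obtain P' where P': "P' \<in> W" by blast
      then have "P' \<in> cylinder s P" "P' \<in> D" using that by auto
      moreover from this have "P \<in> cylinder s P'" using P by (auto simp: cyl_iff agree_sym)
      ultimately show False using s(2) False unfolding determined_def by blast
    qed
    moreover have "three_cycle {} a b c \<in> N" 
      unfolding three_cycle_empty using N(1) by (simp only: comp_closed_def)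
    ultimately show ?thesis using s(1) unfolding \<Phi>_def by blast
  qed
  moreover have "\<Phi> B" if "\<Phi> A" "B \<subseteq> A" for A B
    using that unfolding \<Phi>_def by (meson subset_trans)
  ultimately obtain t where t: "t > 0" "\<And>P. P \<in> X \<Longrightarrow> \<Phi> (cylinder t P)"
    using uniform_radius[of \<Phi>] by blast
  let ?t = "max s t"
  show "f \<in> N"
    unfolding f
  proof (rule three_cycle_by_cylinders[OF N(1) _ determined_le[OF s(2)] abc(2,3)])
    show "?t > 0" "s \<le> ?t" using s(1) by auto
    fix P assume P: "P \<in> D"
    then have X: "P \<in> X" using s(2) by (auto simp: determined_def)
    have "cylinder ?t P \<subseteq> D" using determined_le[OF s(2), of ?t] P by (auto simp: determined_def)
    moreover have "cylinder ?t P \<subseteq> cylinder t P" by (rule cyl_mono) simp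
    ultimately show "three_cycle (cylinder ?t P) a b c \<in> N"
      using t(2)[OF X] determined_cyl \<open>?t > 0\<close> unfolding \<Phi>_def by blast
  qed
qed

end

lemma nontrivial_cycle: "\<exists>f\<in>cycles. f \<noteq> id"
proof -
  obtain P where P: "P \<in> X" using X_nonempty by blast
  have "infinite P"
    using infinite_returns[OF P P, of 1] by (auto elim: contrapos_nn intro: finite_subset)
  then obtain E where E: "E \<subseteq> P" "card E = 3" "finite E" by (meson infinite_arbitrarily_large)
  then obtain a b c where abc: "{a, b, c} \<subseteq> P" "distinct [a, b, c]"
    unfolding card_3_iff by auto
  define K where "K = norm a + norm b + norm c + 1"
  have K: "norm a < K" "norm b < K" "norm c < K"
    unfolding K_def using norm_ge_zero[of a] norm_ge_zero[of b] norm_ge_zero[of c] by linarith+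
  obtain s where s: "s > 0" "\<And>P. P \<in> X \<Longrightarrow> separated (cylinder s P) (ball 0 K \<inter> P)"
    using separated_cylinders[of K] by blast
  let ?s = "max s K"
  let ?f = "three_cycle (cylinder ?s P) a b c"
  have sep: "separated (cylinder ?s P) {a, b, c}"
    using cyl_mono[of s ?s] abc(1) K by (intro separated_mono[OF s(2)[OF P]]) auto
  have "?f \<in> cycles"
  proof (rule cyclesI)
    show "{a, b, c} \<subseteq> P'" if "P' \<in> cylinder ?s P" for P'
      using that abc(1) K by (auto simp: cyl_iff agree_iff)
    show "determined Q ?s (cylinder ?s P)" by (rule determined_cyl)
    show "?s > 0" using s(1) by simp
  qed (fact sep abc(2))+
  moreover have "?f \<noteq> id"
  proof
    assume "?f = id"
    then have "?f (translate (- a) P) = translate (- a) P" by simp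
    moreover have "?f (translate (- a) P) = translate (- b) P"
      using cyl_self[OF P] by (simp add: three_cycle_def)
    ultimately have "translate (- a) P = translate (- b) P" by simp
    then have "translate b (translate (- a) P) = P" by simp
    then have "translate (b - a) P = P" by simp
    then show False using aperiodic_hull[OF P, of "b - a"] abc(2) by auto
  qed
  ultimately show ?thesis by blast
qed

end

section \<open>The full group as a group of permutations of the hull\<close>

lemma groupoid_simps [simp]:
  "arrow_space (qc_groupoid Q) = qc_arrow_topology Q"
  "unit_space (qc_groupoid Q) = hull_topology Q"
  "unit_arrow (qc_groupoid Q) P = (P, 0)"
  "src (qc_groupoid Q) = fst"
  "rng (qc_groupoid Q) a = translate (- snd a) (fst a)"
  "gmult (qc_groupoid Q) a b = (fst b, snd a + snd b)"
  by (auto simp: qc_groupoid_def split: prod.splits)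

lemma mem_basic_open: "(P', q') \<in> qc_basic_open Q P q r \<longleftrightarrow> q' = q \<and> q \<in> P' \<and> P' \<in> cyl Q r P"
  by (auto simp: qc_basic_open_def cyl_iff agree_def)

lemma gset_mult_iff:
  "(P, v) \<in> gset_mult (qc_groupoid Q) A B \<longleftrightarrow>
     (\<exists>u w. v = u + w \<and> (P, w) \<in> B \<and> (translate (- w) P, u) \<in> A)"
  by (force simp: gset_mult_def)

context aperiodic_quasicrystal
begin

abbreviation "G \<equiv> qc_groupoid Q"

lemma topspace_hull_X [simp]: "topspace (hull_topology Q) = X"
  using topspace_hull[OF delaunay] .

lemma unit_arrows_iff: "(P, v) \<in> unit_arrows G \<longleftrightarrow> P \<in> X \<and> v = 0"
  by (auto simp: unit_arrows_def)

section \<open>The topologies of the hull and of the arrow space in terms of cylinders\<close>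

lemma openin_hull_iff:
  "openin (hull_topology Q) U \<longleftrightarrow> U \<subseteq> X \<and> (\<forall>P\<in>U. \<exists>r>0. cylinder r P \<subseteq> U)"
proof -
  have cyl: "cylinder r P = {P' \<in> X. ball 0 r \<inter> P' = ball 0 r \<inter> P}" for r P
    unfolding cyl_def agree_def eq_commute[of "ball 0 r \<inter> P"] by (rule refl)
  have "cylinder r P \<subseteq> U \<longleftrightarrow> (\<forall>P'\<in>X. ball 0 r \<inter> P' = ball 0 r \<inter> P \<longrightarrow> P' \<in> U)" for r P
    unfolding cyl by (simp only: subset_iff mem_Collect_eq Ball_def imp_conjL)
  then show ?thesis by (simp only: openin_hull[OF delaunay])
qed

lemma openin_arrows_iff:
  "openin (qc_arrow_topology Q) W \<longleftrightarrow>
     W \<subseteq> qc_arrows Q \<and> (\<forall>P q. (P, q) \<in> W \<longrightarrow> (\<exists>r>0. \<forall>P'\<in>cylinder r P. (P', q) \<in> W))"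
proof -
  have "(\<exists>r>0. qc_basic_open Q P q r \<subseteq> W) \<longleftrightarrow> (\<exists>r>0. \<forall>P'\<in>cylinder r P. (P', q) \<in> W)"
    if "(P, q) \<in> qc_arrows Q" for P q
  proof
    assume "\<exists>r>0. qc_basic_open Q P q r \<subseteq> W"
    then obtain r where r: "r > 0" "qc_basic_open Q P q r \<subseteq> W" by blast
    \<comment> \<open>The extra \<open>norm q\<close> makes \<open>q \<in> P'\<close> automatic on
      the cylinder.\<close>
    let ?t = "r + norm q"
    have "(P', q) \<in> W" if P': "P' \<in> cylinder ?t P" for P'
    proof -
      have "q \<in> P'" using cyl_translate(1)[OF P', of q r] \<open>(P, q) \<in> qc_arrows Q\<close> r(1)
        by (simp add: qc_arrows_def)
      moreover have "P' \<in> cylinder r P" using P' cyl_mono[of r ?t Q P] by auto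
      ultimately show ?thesis using r(2) mem_basic_open by blast
    qed
    moreover have "?t > 0" using r(1) by (simp add: add_pos_nonneg)
    ultimately show "\<exists>r>0. \<forall>P'\<in>cylinder r P. (P', q) \<in> W" by blast
  next
    assume "\<exists>r>0. \<forall>P'\<in>cylinder r P. (P', q) \<in> W"
    then obtain r where r: "r > 0" "\<And>P'. P' \<in> cylinder r P \<Longrightarrow> (P', q) \<in> W" by blast
    have "qc_basic_open Q P q r \<subseteq> W"
    proof
      fix a assume "a \<in> qc_basic_open Q P q r"
      then show "a \<in> W" using r(2) by (cases a) (auto simp: mem_basic_open)
    qed
    then show "\<exists>r>0. qc_basic_open Q P q r \<subseteq> W" using r(1) by blast
  qed
  then show ?thesis
    unfolding openin_arrows by fast
qed

lemma determined_complement: "determined Q s A \<Longrightarrow> determined Q s (X - A)"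
proof -
  assume A: "determined Q s A"
  have "P' \<notin> A" if "P \<in> X - A" "P' \<in> cylinder s P" for P P'
  proof
    assume "P' \<in> A"
    moreover have "P \<in> cylinder s P'" using that by (auto simp: cyl_iff agree_sym)
    ultimately show False using A that(1) unfolding determined_def by blast
  qed
  then show ?thesis unfolding determined_def by (auto simp: cyl_iff)
qed

lemma openin_determined: "s > 0 \<Longrightarrow> determined Q s A \<Longrightarrow> openin (hull_topology Q) A"
  by (auto simp: openin_hull_iff determined_def)

text \<open>\<open>uniform_radius\<close> for the property of lying on one side of
  \<open>A\<close>.\<close>

lemma clopen_determined:
  assumes "openin (hull_topology Q) A" "closedin (hull_topology Q) A"
  obtains s where "s > 0" "determined Q s A"
proof -
  have A: "A \<subseteq> X" using assms(1) by (simp add: openin_hull_iff)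
  define \<Phi> where "\<Phi> C \<longleftrightarrow> C \<subseteq> A \<or> C \<subseteq> X - A" for C
  have "openin (hull_topology Q) (X - A)" using assms(2) by (simp add: closedin_def)
  then have "\<exists>r>0. \<Phi> (cylinder r P)" if "P \<in> X" for P
    using assms(1) that unfolding \<Phi>_def openin_hull_iff by (cases "P \<in> A") blast+
  moreover have "\<Phi> B" if "\<Phi> C" "B \<subseteq> C" for B C
    using that unfolding \<Phi>_def by blast
  ultimately obtain s where s: "s > 0" "\<And>P. P \<in> X \<Longrightarrow> \<Phi> (cylinder s P)"
    using uniform_radius[of \<Phi>] by blast
  have "cylinder s P \<subseteq> A" if "P \<in> A" for P
    using s(2)[of P] cyl_self[of P Q s] that A unfolding \<Phi>_def by blast
  then show thesis using that s(1) A by (simp add: determined_def)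
qed

text \<open>The uniform radius plays the part of a Lebesgue number of the cover, and there are
  finitely many cylinders of that radius.\<close>

lemma compact_hull: "compact_space (hull_topology Q)"
  unfolding compact_space_def compactin_def
proof (intro conjI allI impI)
  fix \<U> assume \<U>: "(\<forall>U\<in>\<U>. openin (hull_topology Q) U) \<and> topspace (hull_topology Q) \<subseteq> \<Union>\<U>"
  define \<Phi> where "\<Phi> C \<longleftrightarrow> (\<exists>U\<in>\<U>. C \<subseteq> U)" for C
  have "\<exists>r>0. \<Phi> (cylinder r P)" if "P \<in> X" for P
  proof -
    have "P \<in> \<Union>\<U>" using \<U> that by (simp only: topspace_hull_X subset_iff)
    then obtain U where U: "U \<in> \<U>" "P \<in> U" by blast
    then have "openin (hull_topology Q) U" using \<U> by blast
    then show ?thesis using U unfolding \<Phi>_def openin_hull_iff by blast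
  qed
  moreover have "\<Phi> B" if "\<Phi> C" "B \<subseteq> C" for B C
    using that unfolding \<Phi>_def by blast
  ultimately obtain s where s: "s > 0" "\<And>P. P \<in> X \<Longrightarrow> \<Phi> (cylinder s P)"
    using uniform_radius[of \<Phi>] by blast
  then have "\<forall>C\<in>cylinder s ` X. \<exists>U. U \<in> \<U> \<and> C \<subseteq> U" unfolding \<Phi>_def by blast
  from bchoice[OF this] obtain U where U: "\<And>C. C \<in> cylinder s ` X \<Longrightarrow> U C \<in> \<U> \<and> C \<subseteq> U C" by blast
  have "finite (U ` cylinder s ` X)" using finite_cylinders[OF s(1)] by simp
  moreover have "U ` cylinder s ` X \<subseteq> \<U>" using U by blast
  moreover have "topspace (hull_topology Q) \<subseteq> \<Union>(U ` cylinder s ` X)"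
  proof
    fix P assume "P \<in> topspace (hull_topology Q)"
    then have P: "P \<in> X" by simp
    then have "P \<in> U (cylinder s P)" using U[of "cylinder s P"] cyl_self[OF P, of s] by blast
    then show "P \<in> \<Union>(U ` cylinder s ` X)" using P by blast
  qed
  ultimately show "\<exists>\<F>. finite \<F> \<and> \<F> \<subseteq> \<U> \<and> topspace (hull_topology Q) \<subseteq> \<Union>\<F>" by blast
qed simp

lemma hausdorff_hull: "Hausdorff_space (hull_topology Q)"
  unfolding hull_topology_def
  by (rule Metric_space.Hausdorff_space_mtopology[OF hull_Metric_space[OF delaunay]])

lemma continuous_src: "continuous_map (qc_arrow_topology Q) (hull_topology Q) fst"
  unfolding continuous_map
proof (intro conjI allI impI)
  show "fst ` topspace (qc_arrow_topology Q) \<subseteq> topspace (hull_topology Q)"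
    by (auto simp: topspace_arrows qc_arrows_def)
  fix U assume U: "openin (hull_topology Q) U"
  then show "openin (qc_arrow_topology Q) {a \<in> topspace (qc_arrow_topology Q). fst a \<in> U}"
    unfolding openin_arrows_iff topspace_arrows
  proof (intro conjI allI impI)
    fix P q assume "(P, q) \<in> {a \<in> qc_arrows Q. fst a \<in> U}"
    then have P: "P \<in> X" "q \<in> P" "P \<in> U" by (auto simp: qc_arrows_def)
    then obtain r where r: "r > 0" "cylinder r P \<subseteq> U" using U unfolding openin_hull_iff by blast
    have "(P', q) \<in> {a \<in> qc_arrows Q. fst a \<in> U}" if P': "P' \<in> cylinder (r + norm q) P" for P'
    proof -
      have "q \<in> P'" using cyl_translate(1)[OF P' P(2), of r] r(1) by simp
      moreover have "P' \<in> cylinder r P" using P' cyl_mono[of r "r + norm q" Q P] by auto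
      ultimately show ?thesis using r(2) by (auto simp: qc_arrows_def cyl_iff)
    qed
    moreover have "r + norm q > 0" using r(1) by (simp add: add_pos_nonneg)
    ultimately show "\<exists>r>0. \<forall>P'\<in>cylinder r P. (P', q) \<in> {a \<in> qc_arrows Q. fst a \<in> U}" by blast
  qed auto
qed

lemma continuous_rng: "continuous_map (qc_arrow_topology Q) (hull_topology Q) (rng G)"
  unfolding continuous_map
proof (intro conjI allI impI)
  show "rng G ` topspace (qc_arrow_topology Q) \<subseteq> topspace (hull_topology Q)"
    by (auto simp: topspace_arrows qc_arrows_def translate_in_hull)
  fix U assume U: "openin (hull_topology Q) U"
  then show "openin (qc_arrow_topology Q) {a \<in> topspace (qc_arrow_topology Q). rng G a \<in> U}"
    unfolding openin_arrows_iff topspace_arrows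
  proof (intro conjI allI impI)
    fix P q assume "(P, q) \<in> {a \<in> qc_arrows Q. rng G a \<in> U}"
    then have P: "P \<in> X" "q \<in> P" "translate (- q) P \<in> U" by (auto simp: qc_arrows_def)
    then obtain r where r: "r > 0" "cylinder r (translate (- q) P) \<subseteq> U"
      using U unfolding openin_hull_iff by blast
    have "(P', q) \<in> {a \<in> qc_arrows Q. rng G a \<in> U}" if P': "P' \<in> cylinder (r + norm q) P" for P'
    proof -
      have "q \<in> P'" "translate (- q) P' \<in> cylinder r (translate (- q) P)"
        using cyl_translate[OF P' P(2), of r] r(1) by auto
      then show ?thesis using r(2) P' by (auto simp: qc_arrows_def cyl_iff)
    qed
    moreover have "r + norm q > 0" using r(1) by (simp add: add_pos_nonneg)
    ultimately show "\<exists>r>0. \<forall>P'\<in>cylinder r P. (P', q) \<in> {a \<in> qc_arrows Q. rng G a \<in> U}" by blast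
  qed auto
qed

text \<open>The graph is open because \<open>c\<close> is locally constant and compact as a
  continuous image of the clopen set \<open>A\<close>. Source and range are continuous and injective
  on it, and such maps from a compact to a Hausdorff space are homeomorphisms onto their images.
  Openness of the range is checked by translating back.\<close>

lemma bisection_graph:
  assumes s: "s > 0" "determined Q s A"
    and c: "\<And>P. P \<in> A \<Longrightarrow> c P \<in> P"
    and loc: "\<And>P. P \<in> A \<Longrightarrow> \<exists>r>0. \<forall>P'\<in>cylinder r P. c P' = c P"
    and inj: "inj_on (\<lambda>P. translate (- c P) P) A"
  shows "bisection G ((\<lambda>P. (P, c P)) ` A)"
proof -
  let ?F = "(\<lambda>P. (P, c P)) ` A"
  have A: "A \<subseteq> X" using s(2) by (simp add: determined_def)
  have openA: "openin (hull_topology Q) A" by (rule openin_determined[OF s])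
  have "openin (hull_topology Q) (X - A)"
    by (rule openin_determined[OF s(1) determined_complement[OF s(2)]])
  then have "closedin (hull_topology Q) A" using A by (simp add: closedin_def)
  then have compA: "compactin (hull_topology Q) A" by (rule closedin_compact_space[OF compact_hull])
  have FX: "?F \<subseteq> qc_arrows Q" using A c by (auto simp: qc_arrows_def)
  have loc': "\<exists>r>0. \<forall>P'\<in>cylinder r P. P' \<in> A \<and> c P' = c P" if P: "P \<in> A" for P
  proof -
    obtain r where r: "r > 0" "\<forall>P'\<in>cylinder r P. c P' = c P" using loc[OF P] by blast
    have "cylinder (max r s) P \<subseteq> cylinder r P" by (rule cyl_mono) simp
    moreover have "cylinder (max r s) P \<subseteq> cylinder s P" by (rule cyl_mono) simp
    moreover have "cylinder s P \<subseteq> A" using s(2) P by (simp add: determined_def)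
    ultimately have "\<forall>P'\<in>cylinder (max r s) P. P' \<in> A \<and> c P' = c P"
      using r(2) by blast
    then show ?thesis using r(1) by (intro exI[of _ "max r s"]) auto
  qed
  have openF: "openin (qc_arrow_topology Q) ?F"
    unfolding openin_arrows_iff
  proof (intro conjI allI impI FX)
    fix P q assume "(P, q) \<in> ?F"
    then have P: "P \<in> A" "q = c P" by auto
    then obtain r where "r > 0" "\<forall>P'\<in>cylinder r P. P' \<in> A \<and> c P' = c P" using loc' by blast
    then show "\<exists>r>0. \<forall>P'\<in>cylinder r P. (P', q) \<in> ?F" unfolding P(2) by force
  qed
  have cont: "continuous_map (subtopology (hull_topology Q) A) (qc_arrow_topology Q) (\<lambda>P. (P, c P))"
    unfolding continuous_map
  proof (intro conjI allI impI)
    show "(\<lambda>P. (P, c P)) ` topspace (subtopology (hull_topology Q) A) \<subseteq> topspace (qc_arrow_topology Q)"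
      using FX by (auto simp: topspace_arrows)
    fix W assume W: "openin (qc_arrow_topology Q) W"
    have "openin (hull_topology Q) {P \<in> A. (P, c P) \<in> W}"
      unfolding openin_hull_iff
    proof (intro conjI ballI)
      fix P assume P: "P \<in> {P \<in> A. (P, c P) \<in> W}"
      then obtain r where r: "r > 0" "\<forall>P'\<in>cylinder r P. P' \<in> A \<and> c P' = c P" using loc' by blast
      obtain t where t: "t > 0" "\<forall>P'\<in>cylinder t P. (P', c P) \<in> W"
        using P W unfolding openin_arrows_iff by blast
      have "cylinder (max r t) P \<subseteq> {P \<in> A. (P, c P) \<in> W}"
      proof
        fix P' assume "P' \<in> cylinder (max r t) P"
        then have P': "P' \<in> cylinder r P" "P' \<in> cylinder t P"
          using cyl_mono[of r "max r t" Q P] cyl_mono[of t "max r t" Q P] by auto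
        then have "P' \<in> A" "c P' = c P" "(P', c P) \<in> W" using r(2) t(2) by blast+
        then show "P' \<in> {P \<in> A. (P, c P) \<in> W}" by simp
      qed
      then show "\<exists>r>0. cylinder r P \<subseteq> {P \<in> A. (P, c P) \<in> W}"
        using r(1) by (intro exI[of _ "max r t"]) auto
    qed (use A in auto)
    moreover have "{P \<in> topspace (subtopology (hull_topology Q) A). (P, c P) \<in> W} = {P \<in> A. (P, c P) \<in> W}"
      using A by auto
    ultimately show "openin (subtopology (hull_topology Q) A)
        {P \<in> topspace (subtopology (hull_topology Q) A). (P, c P) \<in> W}"
      by (simp add: openin_open_subtopology[OF openA])
  qed
  have compF: "compactin (qc_arrow_topology Q) ?F"
    by (rule image_compactin[OF _ cont]) (simp add: compactin_subtopology compA)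
  have srcF: "fst ` ?F = A" by force
  have openR: "openin (hull_topology Q) (rng G ` ?F)"
    unfolding openin_hull_iff
  proof (intro conjI ballI)
    show "rng G ` ?F \<subseteq> X" using A c by (auto simp: translate_in_hull)
    fix P' assume "P' \<in> rng G ` ?F"
    then obtain P where P: "P \<in> A" "P' = translate (- c P) P" by auto
    obtain r where r: "r > 0" "\<forall>P'\<in>cylinder r P. P' \<in> A \<and> c P' = c P" using loc' P(1) by blast
    have m: "- c P \<in> P'" using zero_in P(1) A by (auto simp: P(2))
    have "P'' \<in> rng G ` ?F" if P'': "P'' \<in> cylinder (r + norm (c P)) P'" for P''
    proof -
      have "translate (- (- c P)) P'' \<in> cylinder r (translate (- (- c P)) P')"
        using m r(1) by (intro cyl_translate(2)[OF P'']) auto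
      then have *: "translate (c P) P'' \<in> cylinder r P" by (simp add: P(2))
      then have "(translate (c P) P'', c P) \<in> ?F" using r(2) by force
      moreover have "rng G (translate (c P) P'', c P) = P''" by simp
      ultimately show ?thesis by (metis imageI)
    qed
    moreover have "r + norm (c P) > 0" using r(1) by (simp add: add_pos_nonneg)
    ultimately show "\<exists>r>0. cylinder r P' \<subseteq> rng G ` ?F" by blast
  qed
  have compspF: "compact_space (subtopology (qc_arrow_topology Q) ?F)"
    using compF by (rule compact_space_subtopology)
  have topF: "topspace (subtopology (qc_arrow_topology Q) ?F) = ?F"
    using FX by (auto simp: topspace_arrows)
  have homeo: "homeomorphic_map (subtopology (qc_arrow_topology Q) ?F) (subtopology (hull_topology Q) (f ` ?F)) f"
    if "continuous_map (qc_arrow_topology Q) (hull_topology Q) f" "inj_on f ?F" for f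
  proof (rule continuous_imp_homeomorphic_map[OF _ compspF])
    show "continuous_map (subtopology (qc_arrow_topology Q) ?F) (subtopology (hull_topology Q) (f ` ?F)) f"
      using that(1) by (simp add: continuous_map_in_subtopology continuous_map_from_subtopology image_mono)
    show "Hausdorff_space (subtopology (hull_topology Q) (f ` ?F))"
      by (rule Hausdorff_space_subtopology[OF hausdorff_hull])
    have "f ` ?F \<subseteq> X" using that(1) FX continuous_map_image_subset_topspace[OF that(1)]
      by (auto simp: topspace_arrows)
    then show "f ` topspace (subtopology (qc_arrow_topology Q) ?F) = topspace (subtopology (hull_topology Q) (f ` ?F))"
      unfolding topF by auto
    show "inj_on f (topspace (subtopology (qc_arrow_topology Q) ?F))" unfolding topF by (rule that(2))
  qed
  have "inj_on fst ?F" by (auto simp: inj_on_def)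
  moreover have "inj_on (rng G) ?F" using inj by (auto simp: inj_on_def)
  ultimately show ?thesis
    unfolding bisection_def
    using compF openF openA openR homeo[OF continuous_src] homeo[OF continuous_rng]
    by (simp only: groupoid_simps srcF simp_thms)
qed

text \<open>The groupoid is principal: an arrow is determined by its source and its range.\<close>

lemma translate_hull_inj:
  assumes "P \<in> X" "translate u P = translate w P"
  shows "u = w"
proof -
  have "translate (u - w) P = P"
    using arg_cong[OF assms(2), of "translate (- w)"] by simp
  then show ?thesis using aperiodic_hull[OF assms(1)] by force
qed

definition perm_graph :: "((real ^ 'n) set \<Rightarrow> (real ^ 'n) set) \<Rightarrow> ((real ^ 'n) set \<times> (real ^ 'n)) set" where
  "perm_graph g = {(P, v). P \<in> X \<and> v \<in> P \<and> g P = translate (- v) P}"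

lemma perm_graph_iff: "(P, v) \<in> perm_graph g \<longleftrightarrow> P \<in> X \<and> v \<in> P \<and> g P = translate (- v) P"
  by (simp add: perm_graph_def)

lemma perm_graph_total:
  assumes "g \<in> full_perms" "P \<in> X"
  obtains v where "v \<in> P" "g P = translate (- v) P" "(P, v) \<in> perm_graph g"
  using full_permsD(3)[OF assms] cyl_self[OF assms(2)] assms(2) that unfolding perm_graph_iff by blast

lemma perm_graph_in_full_group:
  assumes g: "g \<in> full_perms"
  shows "perm_graph g \<in> carrier (full_group G)"
proof -
  have "\<forall>P\<in>X. \<exists>v. v \<in> P \<and> g P = translate (- v) P" using perm_graph_total[OF g] by metis
  from bchoice[OF this] obtain c where c: "\<And>P. P \<in> X \<Longrightarrow> c P \<in> P \<and> g P = translate (- c P) P" by blast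
  have eq: "perm_graph g = (\<lambda>P. (P, c P)) ` X"
  proof (intro equalityI subsetI)
    fix a assume "a \<in> perm_graph g"
    then obtain P v where a: "a = (P, v)" "P \<in> X" "g P = translate (- v) P"
      by (auto simp: perm_graph_def)
    then have "- v = - c P" using c by (intro translate_hull_inj[of P]) auto
    then show "a \<in> (\<lambda>P. (P, c P)) ` X" using a by auto
  qed (use c in \<open>auto simp: perm_graph_iff\<close>)
  have inj: "inj_on (\<lambda>P. translate (- c P) P) X"
  proof (rule inj_onI)
    fix P P' assume "P \<in> X" "P' \<in> X" "translate (- c P) P = translate (- c P') P'"
    then have "g P = g P'" using c by simp
    then show "P = P'" using full_permsD(1)[OF g] by (simp add: bij_is_inj inj_eq)
  qed
  have "bisection G ((\<lambda>P. (P, c P)) ` X)"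
  proof (rule bisection_graph[OF zero_less_one])
    show "determined Q 1 X" by (auto simp: determined_def cyl_iff)
    fix P assume P: "P \<in> X"
    obtain s v where s: "s > 0" "\<forall>P'\<in>cylinder s P. v \<in> P' \<and> g P' = translate (- v) P'"
      using full_permsD(3)[OF g P] by blast
    have "- c P' = - v" if "P' \<in> cylinder s P" for P'
      using that s(2) c[of P'] by (intro translate_hull_inj[of P']) (auto simp: cyl_iff)
    then have "c P' = v" if "P' \<in> cylinder s P" for P' using that by force
    then show "\<exists>r>0. \<forall>P'\<in>cylinder r P. c P' = c P" using s(1) cyl_self[OF P] by blast
  qed (use c inj in auto)
  moreover have "rng G ` (\<lambda>P. (P, c P)) ` X = X"
  proof (intro equalityI subsetI)
    fix P assume P: "P \<in> X"
    let ?P = "finv g P"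
    have gP: "g ?P = P" using full_permsD(1)[OF g] by (simp add: bij_is_surj surj_f_inv_f)
    then have "?P \<in> X" using full_perms_in_X[OF g, of ?P] P by simp
    then have "P = rng G (?P, c ?P)" "(?P, c ?P) \<in> (\<lambda>P. (P, c P)) ` X" using c[of ?P] gP by auto
    then show "P \<in> rng G ` (\<lambda>P. (P, c P)) ` X" by (rule image_eqI)
  qed (use c in \<open>auto simp: translate_in_hull\<close>)
  moreover have "fst ` (\<lambda>P. (P, c P)) ` X = X" by force
  ultimately show ?thesis by (simp add: full_group_def eq)
qed

lemma bisection_arrowD:
  assumes "bisection G F" "(P, v) \<in> F"
  shows "P \<in> X" "v \<in> P"
  using assms openin_subset[of "qc_arrow_topology Q" F]
  by (auto simp: bisection_def topspace_arrows qc_arrows_def)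

lemma bisection_topspace:
  assumes "bisection G F"
  shows "topspace (subtopology (qc_arrow_topology Q) F) = F"
  using assms bisection_arrowD[OF assms] by (auto simp: topspace_arrows qc_arrows_def)

lemma bisection_src_inj:
  assumes "bisection G F" "(P, v) \<in> F" "(P, w) \<in> F"
  shows "v = w"
proof -
  have "inj_on fst F"
    using assms(1) homeomorphic_imp_injective_map bisection_topspace[OF assms(1)]
    unfolding bisection_def by fastforce
  from inj_onD[OF this _ assms(2,3)] show ?thesis by simp
qed

lemma bisection_rng_inj:
  assumes "bisection G F" "(P, v) \<in> F" "(P', v') \<in> F" "translate (- v) P = translate (- v') P'"
  shows "P = P'"
proof -
  have "homeomorphic_map (subtopology (qc_arrow_topology Q) F) (subtopology (hull_topology Q) (rng G ` F)) (rng G)"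
    using assms(1) by (simp add: bisection_def)
  then have "inj_on (rng G) F"
    using homeomorphic_imp_injective_map bisection_topspace[OF assms(1)] by fastforce
  from inj_onD[OF this _ assms(2,3)] show ?thesis using assms(4) by simp
qed

lemma bisection_locally_constant:
  assumes "bisection G F" "(P, v) \<in> F"
  shows "\<exists>r>0. \<forall>P'\<in>cylinder r P. (P', v) \<in> F"
  using assms unfolding bisection_def groupoid_simps openin_arrows_iff by blast

text \<open>Injectivity of the source on \<open>F\<close> selects one arrow over each
  \<open>P\<close> and so defines \<open>g\<close>; injectivity and surjectivity of the range make
  \<open>g\<close> a bijection; openness of \<open>F\<close> makes it locally a translation.\<close>

lemma full_group_perm_graph:
  assumes "F \<in> carrier (full_group G)"
  obtains g where "g \<in> full_perms" "F = perm_graph g"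
proof -
  have F: "bisection G F" "fst ` F = X" "rng G ` F = X" using assms by (auto simp: full_group_def)
  have "\<forall>P\<in>X. \<exists>v. (P, v) \<in> F" using F(2) by force
  from bchoice[OF this] obtain c where c: "\<And>P. P \<in> X \<Longrightarrow> (P, c P) \<in> F" by blast
  define g where "g P = (if P \<in> X then translate (- c P) P else P)" for P
  have gX: "g P = translate (- c P) P" "c P \<in> P" "g P \<in> X" if "P \<in> X" for P
    using that bisection_arrowD(2)[OF F(1) c[OF that]] by (auto simp: g_def translate_in_hull)
  have "inj g"
  proof (rule injI)
    fix P P' assume eq: "g P = g P'"
    show "P = P'"
    proof (cases "P \<in> X")
      case True
      then have "P' \<in> X" using eq gX(3)[OF True] by (auto simp: g_def split: if_splits)
      then show ?thesis using eq True bisection_rng_inj[OF F(1) c[OF True] c[of P']] gX(1) by auto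
    next
      case False
      then have "P' \<notin> X" using eq gX(3)[of P'] by (auto simp: g_def split: if_splits)
      then show ?thesis using eq False by (simp add: g_def)
    qed
  qed
  moreover have "surj g"
    unfolding surj_def
  proof
    fix P
    show "\<exists>P'. P = g P'"
    proof (cases "P \<in> X")
      case True
      then have "P \<in> rng G ` F" using F(3) by blast
      then obtain P' v where v: "(P', v) \<in> F" "P = translate (- v) P'" by auto
      then have P': "P' \<in> X" using bisection_arrowD[OF F(1)] by blast
      then have "v = c P'" using bisection_src_inj[OF F(1) v(1) c] by blast
      then show ?thesis using v(2) gX(1)[OF P'] by blast
    next
      case False
      then show ?thesis by (intro exI[of _ P]) (simp add: g_def)
    qed
  qed
  ultimately have "bij g" by (simp add: bij_def)
  moreover have "\<exists>s>0. \<exists>v. \<forall>P'\<in>cylinder s P. v \<in> P' \<and> g P' = translate (- v) P'" if P: "P \<in> X" for P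
  proof -
    obtain r where r: "r > 0" "\<forall>P'\<in>cylinder r P. (P', c P) \<in> F"
      using bisection_locally_constant[OF F(1) c[OF P]] by blast
    have "c P \<in> P' \<and> g P' = translate (- c P) P'" if "P' \<in> cylinder r P" for P'
    proof -
      have P': "P' \<in> X" using that by (simp add: cyl_iff)
      then have "c P' = c P" using bisection_src_inj[OF F(1) c[OF P']] r(2) that by blast
      then show ?thesis using gX[OF P'] by simp
    qed
    then show ?thesis using r(1) by blast
  qed
  ultimately have "g \<in> full_perms" by (simp add: full_perms_def g_def)
  moreover have "F = perm_graph g"
  proof (intro equalityI subsetI)
    fix a assume a: "a \<in> F"
    obtain P v where Pv: "a = (P, v)" by (cases a)
    then have P: "P \<in> X" "v \<in> P" using bisection_arrowD[OF F(1)] a by auto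
    then have "c P = v" using bisection_src_inj[OF F(1) c] a Pv by blast
    then show "a \<in> perm_graph g" using P gX(1)[of P] Pv by (simp add: perm_graph_iff)
  next
    fix a assume "a \<in> perm_graph g"
    then obtain P v where a: "a = (P, v)" "P \<in> X" "g P = translate (- v) P"
      by (auto simp: perm_graph_def)
    then have "- v = - c P" using gX by (intro translate_hull_inj[of P]) auto
    then show "a \<in> F" using a c by auto
  qed
  ultimately show thesis by (rule that)
qed

text \<open>The right factor of a groupoid product acts first, as in composition of maps.\<close>

lemma perm_graph_comp:
  assumes g: "g \<in> full_perms" and h: "h \<in> full_perms"
  shows "perm_graph (g \<circ> h) = gset_mult G (perm_graph g) (perm_graph h)"
proof -
  have "(P, v) \<in> perm_graph (g \<circ> h) \<longleftrightarrow> (P, v) \<in> gset_mult G (perm_graph g) (perm_graph h)" for P v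
  proof
    assume "(P, v) \<in> perm_graph (g \<circ> h)"
    then have P: "P \<in> X" "g (h P) = translate (- v) P" by (auto simp: perm_graph_iff)
    obtain w where w: "h P = translate (- w) P" "(P, w) \<in> perm_graph h" using perm_graph_total[OF h P(1)] by blast
    have "h P \<in> X" using full_perms_in_X[OF h] P(1) by simp
    then obtain u where u: "g (h P) = translate (- u) (h P)" "(h P, u) \<in> perm_graph g"
      using perm_graph_total[OF g] by blast
    have "- v = - (u + w)" using P u w by (intro translate_hull_inj[OF P(1)]) simp
    then have "v = u + w" by (metis minus_minus)
    then show "(P, v) \<in> gset_mult G (perm_graph g) (perm_graph h)"
      unfolding gset_mult_iff using u(2) w by auto
  next
    assume "(P, v) \<in> gset_mult G (perm_graph g) (perm_graph h)"
    then obtain u w where "v = u + w" "(P, w) \<in> perm_graph h" "(translate (- w) P, u) \<in> perm_graph g"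
      unfolding gset_mult_iff by blast
    then show "(P, v) \<in> perm_graph (g \<circ> h)" by (simp add: perm_graph_iff add.commute)
  qed
  then show ?thesis by auto
qed

lemma perm_graph_id: "perm_graph id = unit_arrows G"
proof -
  have "(P, v) \<in> perm_graph id \<longleftrightarrow> (P, v) \<in> unit_arrows G" for P v
    using translate_hull_inj[of P 0 "- v"] zero_in[of P] by (auto simp: perm_graph_iff unit_arrows_iff)
  then show ?thesis by auto
qed

definition perm_group :: "((real ^ 'n) set \<Rightarrow> (real ^ 'n) set) monoid" where
  "perm_group = \<lparr>carrier = full_perms, mult = (\<circ>), one = id\<rparr>"

lemma perm_group_simps [simp]:
  "carrier perm_group = full_perms" "mult perm_group = (\<circ>)" "one perm_group = id"
  by (simp_all add: perm_group_def)

lemma group_perm_group: "group perm_group"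
proof (rule groupI)
  fix g assume "g \<in> carrier perm_group"
  then have g: "g \<in> full_perms" by simp
  then have "finv g \<circ> g = id" using full_permsD(1) by (simp add: bij_is_inj)
  then show "\<exists>h\<in>carrier perm_group. h \<otimes>\<^bsub>perm_group\<^esub> g = \<one>\<^bsub>perm_group\<^esub>"
    using inv_in_full_perms[OF g] by auto
qed (auto simp: comp_in_full_perms id_in_full_perms comp_assoc)

lemma perm_group_inv: "g \<in> full_perms \<Longrightarrow> m_inv perm_group g = finv g"
  using group.inv_equality[OF group_perm_group, of "finv g" g] full_permsD(1)[of g] inv_in_full_perms
  by (simp add: bij_is_inj)

lemma perm_graph_iso: "perm_graph \<in> iso perm_group (full_group G)"
  unfolding iso_def hom_def
proof (intro CollectI conjI ballI)
  show "perm_graph \<in> carrier perm_group \<rightarrow> carrier (full_group G)"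
    using perm_graph_in_full_group by auto
  show "perm_graph (g \<otimes>\<^bsub>perm_group\<^esub> h) = perm_graph g \<otimes>\<^bsub>full_group G\<^esub> perm_graph h"
    if "g \<in> carrier perm_group" "h \<in> carrier perm_group" for g h
    using that perm_graph_comp by (simp add: full_group_def)
  show "bij_betw perm_graph (carrier perm_group) (carrier (full_group G))"
    unfolding bij_betw_def
  proof
    show "inj_on perm_graph (carrier perm_group)"
    proof (rule inj_onI)
      fix g h assume "g \<in> carrier perm_group" "h \<in> carrier perm_group" and eq: "perm_graph g = perm_graph h"
      then have gh: "g \<in> full_perms" "h \<in> full_perms" by auto
      show "g = h"
      proof
        fix P
        show "g P = h P"
        proof (cases "P \<in> X")
          case True
          then obtain v where "g P = translate (- v) P" "(P, v) \<in> perm_graph g"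
            using perm_graph_total[OF gh(1)] by blast
          then show ?thesis using eq by (simp add: perm_graph_iff)
        next
          case False
          then show ?thesis using full_permsD(2)[OF gh(1)] full_permsD(2)[OF gh(2)] by simp
        qed
      qed
    qed
    show "perm_graph ` carrier perm_group = carrier (full_group G)"
      using perm_graph_in_full_group full_group_perm_graph by (auto simp: image_iff) metis
  qed
qed

text \<open>The group axioms are transported along the isomorphism instead of being verified for
  bisections.\<close>

lemma group_full_group: "group (full_group G)"
proof -
  have "(full_group G)\<lparr>one := perm_graph \<one>\<^bsub>perm_group\<^esub>\<rparr> = full_group G"
    by (simp add: perm_graph_id full_group_def)
  then show ?thesis
    using group.iso_imp_img_group[OF group_perm_group perm_graph_iso] by simp
qed

end

section \<open>Multisections of degree three\<close>

text \<open>Of the six permutations of three letters the three excluded ones are transpositions,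
  hence odd.\<close>

lemma evenperm_three_cases:
  assumes "\<pi> permutes {1..3::nat}" "evenperm \<pi>"
  shows "\<pi> = id \<or> (\<pi> 1 = 2 \<and> \<pi> 2 = 3 \<and> \<pi> 3 = 1) \<or> (\<pi> 1 = 3 \<and> \<pi> 3 = 2 \<and> \<pi> 2 = 1)"
proof -
  have S: "{1..3::nat} = {1, 2, 3}" by auto
  have inj: "\<pi> x = \<pi> y \<longleftrightarrow> x = y" for x y using permutes_inj[OF assms(1)] by (simp add: inj_eq)
  have out: "\<pi> x = x" if "x \<notin> {1, 2, 3}" for x using assms(1) that unfolding S permutes_def by blast
  have range: "\<pi> 1 \<in> {1, 2, 3}" "\<pi> 2 \<in> {1, 2, 3}" "\<pi> 3 \<in> {1, 2, 3}"
    using permutes_in_image[OF assms(1)] unfolding S by auto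
  have neq: "\<pi> 1 \<noteq> \<pi> 2" "\<pi> 1 \<noteq> \<pi> 3" "\<pi> 2 \<noteq> \<pi> 3" by (simp_all add: inj)
  have id_case: "\<pi> = id" if "\<pi> 1 = 1" "\<pi> 2 = 2" "\<pi> 3 = 3"
  proof
    fix x show "\<pi> x = id x" using that out by (cases "x \<in> {1, 2, 3}") auto
  qed
  have no_swap: "\<not> (\<pi> a = b \<and> \<pi> b = a \<and> \<pi> c = c)" if "{a, b, c} = {1, 2, 3}" "a \<noteq> b" "c \<noteq> a" "c \<noteq> b" for a b c
  proof
    assume *: "\<pi> a = b \<and> \<pi> b = a \<and> \<pi> c = c"
    have "\<pi> x = Transposition.transpose a b x" for x
    proof (cases "x \<in> {a, b, c}")
      case True
      then show ?thesis using * that(2-4) by (auto simp: transpose_def)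
    next
      case False
      then have "\<pi> x = x" using out[of x] that(1) by simp
      then show ?thesis using False by (simp add: transpose_def)
    qed
    then have "\<pi> = Transposition.transpose a b" by blast
    then show False using assms(2) that(2) by (simp add: evenperm_swap)
  qed
  have "{1, 3, 2} = {1, 2, 3::nat}" "{2, 3, 1} = {1, 2, 3::nat}" by auto
  note swaps = no_swap[OF refl] no_swap[OF this(1)] no_swap[OF this(2)]
  have "(x = 1 \<and> y = 2 \<and> z = 3) \<or> (x = 2 \<and> y = 1 \<and> z = 3) \<or> (x = 3 \<and> z = 1 \<and> y = 2) \<or>
      (y = 3 \<and> z = 2 \<and> x = 1) \<or> (x = 2 \<and> y = 3 \<and> z = 1) \<or> (x = 3 \<and> z = 2 \<and> y = 1)"
    if "x \<in> {1, 2, 3}" "y \<in> {1, 2, 3}" "z \<in> {1, 2, 3}" "x \<noteq> y" "x \<noteq> z" "y \<noteq> z" for x y z :: nat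
    using that by auto
  note cases = this[OF range neq]
  have "\<not> (\<pi> 1 = 2 \<and> \<pi> 2 = 1 \<and> \<pi> 3 = 3)" by (rule swaps(1)) simp_all
  moreover have "\<not> (\<pi> 1 = 3 \<and> \<pi> 3 = 1 \<and> \<pi> 2 = 2)" by (rule swaps(2)) simp_all
  moreover have "\<not> (\<pi> 2 = 3 \<and> \<pi> 3 = 2 \<and> \<pi> 1 = 1)" by (rule swaps(3)) simp_all
  ultimately show ?thesis using cases id_case by argo
qed

lemma evenperm_rotation:
  obtains \<pi> where "\<pi> permutes {1..3::nat}" "evenperm \<pi>" "\<pi> 1 = 2" "\<pi> 2 = 3" "\<pi> 3 = 1"
proof
  let ?p = "Transposition.transpose 1 2 \<circ> Transposition.transpose 2 (3 :: nat)"
  show "?p permutes {1..3}" by (intro permutes_compose permutes_swap_id) auto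
  show "evenperm ?p" by (simp add: evenperm_comp permutation_swap_id evenperm_swap)
qed (auto simp: transpose_def)

context aperiodic_quasicrystal
begin

lemma determined_translate:
  assumes "determined Q s D" "s > 0" "\<And>P. P \<in> D \<Longrightarrow> q \<in> P"
  shows "determined Q (s + norm q) (translate (- q) ` D)"
  unfolding determined_def
proof (intro conjI ballI subsetI)
  have D: "P \<in> X" if "P \<in> D" for P using that assms(1) by (auto simp: determined_def)
  show "x \<in> X" if "x \<in> translate (- q) ` D" for x using that D assms(3) by (auto simp: translate_in_hull)
  fix P P' assume "P \<in> translate (- q) ` D" and P': "P' \<in> cylinder (s + norm q) P"
  then obtain W where W: "W \<in> D" "P = translate (- q) W" by blast
  have "translate (- (- q)) P' \<in> cylinder s (translate (- (- q)) P)"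
    using zero_in[OF D[OF W(1)]] assms(2) by (intro cyl_translate(2)[OF P']) (auto simp: W(2))
  then have "translate q P' \<in> cylinder s W" by (simp add: W(2))
  then have "translate q P' \<in> D" using assms(1) W(1) by (auto simp: determined_def)
  then show "P' \<in> translate (- q) ` D" by (auto simp: mem_translate_image)
qed

lemma cycle_in_multisection_alt:
  assumes "f \<in> cycles"
  obtains F where "multisection G 3 F" "perm_graph f \<in> multisection_alt G 3 F"
proof -
  obtain D a b c s where f: "f = three_cycle D a b c" and s: "s > 0" "determined Q s D"
    and abc: "\<And>P. P \<in> D \<Longrightarrow> {a, b, c} \<subseteq> P" "separated D {a, b, c}" "distinct [a, b, c]"
    using assms unfolding cycles_def by blast
  have D: "P \<in> X" if "P \<in> D" for P using that s(2) by (auto simp: determined_def)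
  define q where "q i = (if i = 1 then a else if i = 2 then b else c)" for i :: nat
  have q: "q 1 = a" "q 2 = b" "q 3 = c" by (auto simp: q_def)
  have qP: "q i \<in> P" "q i \<in> {a, b, c}" if "P \<in> D" for i P using that abc(1) by (auto simp: q_def)
  have q_in: "q i \<in> {a, b, c}" for i by (simp add: q_def)
  \<comment> \<open>The arrows from \<open>P - q i\<close> to \<open>P - q j\<close> for
    \<open>P\<close> in \<open>D\<close>; the displacement is the difference of the two
    positions.\<close>
  define F where "F i j = (\<lambda>P. (translate (- q i) P, q j - q i)) ` D" for i j
  have F_iff: "(x, v) \<in> F i j \<longleftrightarrow> translate (q i) x \<in> D \<and> v = q j - q i" for x v i j
    unfolding F_def by (auto simp: image_iff) (metis left_minus right_minus translate_0 translate_translate)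
  have q_inj: "q i = q j \<Longrightarrow> i = j" if "i \<in> {1..3}" "j \<in> {1..3}" for i j
  proof -
    assume "q i = q j"
    moreover have "i \<in> {1, 2, 3}" "j \<in> {1, 2, 3}" using that by auto
    ultimately show "i = j" using abc(3) q by auto
  qed
  have ms: "multisection G 3 F"
    unfolding multisection_def
  proof (intro conjI ballI impI)
    fix i j :: nat
    show "bisection G (F i j)"
    proof -
      have "F i j = (\<lambda>x. (x, q j - q i)) ` (translate (- q i) ` D)" by (simp add: F_def image_image)
      also have "bisection G \<dots>"
      proof (rule bisection_graph[OF _ determined_translate[OF s(2,1)]])
        show "s + norm (q i) > 0" using s(1) by (simp add: add_pos_nonneg)
        show "\<exists>r>0. \<forall>P'\<in>cylinder r P. q j - q i = q j - q i" for P using zero_less_one by blast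
      qed (use qP in \<open>auto simp: inj_on_def\<close>)
      finally show ?thesis .
    qed
    show "F i i \<subseteq> unit_arrows G"
    proof
      fix x assume "x \<in> F i i"
      then show "x \<in> unit_arrows G"
        using qP(1) translate_in_hull[OF D] unfolding F_def by (auto simp: unit_arrows_iff)
    qed
    show "F i i \<inter> F j j = {}" if "i \<in> {1..3}" "j \<in> {1..3}" "i \<noteq> j"
    proof (rule ccontr)
      assume "F i i \<inter> F j j \<noteq> {}"
      then obtain x v where "(x, v) \<in> F i i" "(x, v) \<in> F j j" by auto
      then have "translate (q i) x \<in> D" "translate (q j) x \<in> D" by (simp_all add: F_iff)
      then have "q i = q j" using separatedD[OF abc(2) q_in q_in] by blast
      then show False using q_inj that by blast
    qed
  next
    fix i1 i2 i3 :: nat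
    have "(x, v) \<in> gset_mult G (F i2 i3) (F i1 i2) \<longleftrightarrow> (x, v) \<in> F i1 i3" for x v
    proof
      assume "(x, v) \<in> F i1 i3"
      then have "v = (q i3 - q i2) + (q i2 - q i1) \<and> (translate (q i1) x \<in> D \<and> q i2 - q i1 = q i2 - q i1) \<and>
          translate (q i2) (translate (- (q i2 - q i1)) x) \<in> D \<and> q i3 - q i2 = q i3 - q i2"
        by (simp add: F_iff)
      then show "(x, v) \<in> gset_mult G (F i2 i3) (F i1 i2)" unfolding gset_mult_iff F_iff by blast
    qed (auto simp: gset_mult_iff F_iff)
    then show "gset_mult G (F i2 i3) (F i1 i2) = F i1 i3" by auto
  qed
  obtain \<pi> where \<pi>: "\<pi> permutes {1..3::nat}" "evenperm \<pi>" "\<pi> 1 = 2" "\<pi> 2 = 3" "\<pi> 3 = 1"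
    using evenperm_rotation by blast
  have S: "{1..3::nat} = {1, 2, 3}" by auto
  have perm_iff: "(x, v) \<in> multisection_perm G 3 F \<pi> \<longleftrightarrow>
      translate a x \<in> D \<and> v = b - a \<or> translate b x \<in> D \<and> v = c - b \<or> translate c x \<in> D \<and> v = a - c \<or>
      x \<in> X \<and> v = 0 \<and> translate a x \<notin> D \<and> translate b x \<notin> D \<and> translate c x \<notin> D" for x v
    unfolding multisection_perm_def S by (auto simp: F_iff \<pi> q unit_arrows_iff simp del: One_nat_def)
  have mem: "(x, v) \<in> perm_graph f \<longleftrightarrow> (x, v) \<in> multisection_perm G 3 F \<pi>" for x v
  proof (cases "x \<in> X")
    case False
    have "translate p x \<notin> D" if "p \<in> {a, b, c}" for p
    proof
      assume *: "translate p x \<in> D"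
      have "p \<in> translate p x" using abc(1)[OF *] that by blast
      from translate_in_hull[OF D[OF *] this] have "translate (- p) (translate p x) \<in> X" .
      then show False using False by simp
    qed
    then show ?thesis using False by (auto simp: perm_iff perm_graph_iff)
  next
    case True
    have eq: "translate u x = translate (- v) x \<longleftrightarrow> v = - u" for u v
      using translate_hull_inj[OF True, of u "- v"] by auto
    have sep: "translate p x \<in> D \<Longrightarrow> translate p' x \<in> D \<Longrightarrow> p = p'" if "p \<in> {a, b, c}" "p' \<in> {a, b, c}" for p p'
      using separatedD[OF abc(2) that] by blast
    have pts: "p' - p \<in> x" if "translate p x \<in> D" "p' \<in> {a, b, c}" for p p'
      using abc(1)[OF that(1)] that(2) by auto
    consider "translate a x \<in> D" | "translate b x \<in> D" | "translate c x \<in> D"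
      | "translate a x \<notin> D" "translate b x \<notin> D" "translate c x \<notin> D" by blast
    then show ?thesis
    proof cases
      case 1
      then have "translate b x \<notin> D" "translate c x \<notin> D" using sep[of a b] sep[of a c] abc(3) by auto
      then show ?thesis using 1 True pts[OF 1, of b] by (auto simp: perm_iff perm_graph_iff f three_cycle_def eq)
    next
      case 2
      then have "translate a x \<notin> D" "translate c x \<notin> D" using sep[of b a] sep[of b c] abc(3) by auto
      then show ?thesis using 2 True pts[OF 2, of c] by (auto simp: perm_iff perm_graph_iff f three_cycle_def eq)
    next
      case 3
      then have "translate a x \<notin> D" "translate b x \<notin> D" using sep[of c a] sep[of c b] abc(3) by auto
      then show ?thesis using 3 True pts[OF 3, of a] by (auto simp: perm_iff perm_graph_iff f three_cycle_def eq)
    next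
      case 4
      then show ?thesis
        using True zero_in[OF True] eq[of 0 v] by (auto simp: perm_iff perm_graph_iff f three_cycle_def)
    qed
  qed
  have "perm_graph f = multisection_perm G 3 F \<pi>" using mem by auto
  then have "perm_graph f \<in> multisection_alt G 3 F"
    unfolding multisection_alt_def using \<pi> by blast
  with ms show thesis by (rule that)
qed

text \<open>
  A permutation that acts as a three-cycle whose steps vary over \<open>A\<close> is a product of three-cycles
  with constant steps, one for each piece of \<open>A\<close>.
\<close>

definition rotates ::
    "((real ^ 'n) set \<Rightarrow> (real ^ 'n) set) \<Rightarrow> (real ^ 'n) set set \<Rightarrow>
     ((real ^ 'n) set \<Rightarrow> (real ^ 'n) set) \<Rightarrow> ((real ^ 'n) set \<Rightarrow> (real ^ 'n) set) \<Rightarrow> bool" where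
  "rotates h S \<beta> \<gamma> \<longleftrightarrow> (\<forall>x\<in>S. h x = \<beta> x \<and> h (\<beta> x) = \<gamma> x \<and> h (\<gamma> x) = x) \<and>
     (\<forall>y. y \<notin> S \<union> \<beta> ` S \<union> \<gamma> ` S \<longrightarrow> h y = y)"

lemma rotates_comp:
  assumes h: "rotates h S \<beta> \<gamma>" and k: "rotates k T \<beta> \<gamma>"
    and disj: "(S \<union> \<beta> ` S \<union> \<gamma> ` S) \<inter> (T \<union> \<beta> ` T \<union> \<gamma> ` T) = {}"
  shows "rotates (h \<circ> k) (S \<union> T) \<beta> \<gamma>"
proof -
  let ?O = "\<lambda>S. S \<union> \<beta> ` S \<union> \<gamma> ` S"
  have h1: "h x = \<beta> x" "h (\<beta> x) = \<gamma> x" "h (\<gamma> x) = x" if "x \<in> S" for x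
    using h that unfolding rotates_def by blast+
  have h2: "h y = y" if "y \<notin> ?O S" for y using h that unfolding rotates_def by blast
  have k1: "k x = \<beta> x" "k (\<beta> x) = \<gamma> x" "k (\<gamma> x) = x" if "x \<in> T" for x
    using k that unfolding rotates_def by blast+
  have k2: "k y = y" if "y \<notin> ?O T" for y using k that unfolding rotates_def by blast
  have S: "k x = x" if "x \<in> ?O S" for x using k2[of x] that disj by blast
  have T: "h x = x" if "x \<in> ?O T" for x using h2[of x] that disj by blast
  show ?thesis
    unfolding rotates_def
  proof (intro conjI ballI allI impI)
    fix x assume "x \<in> S \<union> T"
    then show "(h \<circ> k) x = \<beta> x" "(h \<circ> k) (\<beta> x) = \<gamma> x" "(h \<circ> k) (\<gamma> x) = x"
      using h1 k1 S T by auto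
  next
    fix y assume y: "y \<notin> S \<union> T \<union> \<beta> ` (S \<union> T) \<union> \<gamma> ` (S \<union> T)"
    then have "k y = y" "h y = y" using k2[of y] h2[of y] by blast+
    then show "(h \<circ> k) y = y" by simp
  qed
qed

abbreviation "alternating_perms \<equiv> generate perm_group cycles"

lemma alternating_perms_subset: "alternating_perms \<subseteq> full_perms"
  using group.generate_incl[OF group_perm_group, of cycles] cycles_subset_full_perms by simp

lemma alternating_perms_comp: "comp_closed alternating_perms"
  unfolding comp_closed_def
  using generate.one[of perm_group cycles] generate.eng[of _ perm_group cycles] by simp

text \<open>On a cylinder of radius \<open>s\<close> the displacements are constant, so the rotation
  over it is a three-cycle along \<open>0\<close>, \<open>b P\<close>, \<open>c P\<close>.
  Disjointness and injectivity make the supports for different cylinders disjoint, so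
  \<open>rotates_comp\<close> applies.\<close>

lemma rotation_exists:
  assumes s: "s > 0" "determined Q s A"
    and b: "\<And>x. x \<in> A \<Longrightarrow> b x \<in> x" and c: "\<And>x. x \<in> A \<Longrightarrow> c x \<in> x"
    and const: "\<And>x y. x \<in> A \<Longrightarrow> y \<in> cylinder s x \<Longrightarrow> b y = b x \<and> c y = c x"
    and disj: "\<And>x y. x \<in> A \<Longrightarrow> y \<in> A \<Longrightarrow> x \<noteq> translate (- b y) y \<and> x \<noteq> translate (- c y) y \<and>
      translate (- b x) x \<noteq> translate (- c y) y"
    and inj: "inj_on (\<lambda>x. translate (- b x) x) A" "inj_on (\<lambda>x. translate (- c x) x) A"
  obtains h where "h \<in> alternating_perms"
    "rotates h A (\<lambda>x. translate (- b x) x) (\<lambda>x. translate (- c x) x)"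
proof -
  let ?\<beta> = "\<lambda>x. translate (- b x) x" and ?\<gamma> = "\<lambda>x. translate (- c x) x"
  have A: "A \<subseteq> X" using s(2) by (simp add: determined_def)
  have fin: "finite (cylinder s ` A)" by (rule finite_cylinders[OF s(1) A])
  have step: "\<exists>h\<in>alternating_perms. rotates h (cylinder s P) ?\<beta> ?\<gamma>" if P: "P \<in> A" for P
  proof -
    let ?C = "cylinder s P"
    have C: "x \<in> A" "b x = b P" "c x = c P" if "x \<in> ?C" for x
      using that const[OF P that] s(2) P by (auto simp: determined_def)
    \<comment> \<open>Disjointness with both points equal to \<open>P\<close> shows that the
      displacements are distinct.\<close>
    have ne: "0 \<noteq> b P" "0 \<noteq> c P" "b P \<noteq> c P" using disj[OF P P] by auto
    have sep: "separated ?C {0, b P, c P}"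
      unfolding separated_def
    proof (intro allI ballI impI)
      fix x p q assume pq: "p \<in> {0, b P, c P}" "q \<in> {0, b P, c P}" "translate p x \<in> ?C" "translate q x \<in> ?C"
      define y z where yz: "y = translate p x" "z = translate q x"
      have y: "y \<in> A" "b y = b P" "c y = c P" "translate (- p) y = x"
        using C[OF pq(3)] by (auto simp: yz)
      have z: "z \<in> A" "b z = b P" "c z = c P" "translate (- q) z = x"
        using C[OF pq(4)] by (auto simp: yz)
      show "p = q"
      proof (rule ccontr)
        assume "p \<noteq> q"
        then consider "p = 0" "q = b P" | "p = 0" "q = c P" | "p = b P" "q = 0"
          | "p = b P" "q = c P" | "p = c P" "q = 0" | "p = c P" "q = b P"
          using pq(1,2) by blast
        then show False
          by cases (use disj[OF y(1) z(1)] disj[OF z(1) y(1)] y(2-4) z(2-4) in simp_all)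
      qed
    qed
    let ?f = "three_cycle ?C 0 (b P) (c P)"
    have "?f \<in> cycles"
    proof (rule cyclesI[OF s(1) determined_cyl _ sep])
      fix P' assume "P' \<in> ?C"
      then show "{0, b P, c P} \<subseteq> P'"
        using C[of P'] b[of P'] c[of P'] zero_in[of P'] A by auto
    qed (use ne in simp)
    then have "?f \<in> alternating_perms" by (rule generate.incl)
    moreover have "rotates ?f ?C ?\<beta> ?\<gamma>"
      unfolding rotates_def
    proof (intro conjI ballI allI impI)
      fix x assume x: "x \<in> ?C"
      have dist: "distinct [0, b P, c P]" using ne by simp
      note ev = three_cycle_eval[OF sep order_refl dist order_refl x]
      show "?f x = ?\<beta> x" "?f (?\<beta> x) = ?\<gamma> x" "?f (?\<gamma> x) = x"
        using ev[of 0] ev[of "b P"] ev[of "c P"] x ne C[OF x] by auto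
    next
      fix y assume y: "y \<notin> ?C \<union> ?\<beta> ` ?C \<union> ?\<gamma> ` ?C"
      have n: "translate p y \<notin> ?C" if p: "p \<in> {0, b P, c P}" for p
      proof
        assume *: "translate p y \<in> ?C"
        consider "p = 0" | "p = b P" | "p = c P" using p by blast
        then show False
        proof cases
          case 1
          then show False using * y by simp
        next
          case 2
          have "y = ?\<beta> (translate p y)" using C[OF *] 2 by simp
          then show False using y * by blast
        next
          case 3
          have "y = ?\<gamma> (translate p y)" using C[OF *] 3 by simp
          then show False using y * by blast
        qed
      qed
      show "?f y = y" using n[of 0] n[of "b P"] n[of "c P"] by (simp add: three_cycle_def)
    qed
    ultimately show ?thesis by blast
  qed
  have "finite \<S> \<Longrightarrow> \<S> \<subseteq> cylinder s ` A \<Longrightarrow> \<exists>h\<in>alternating_perms. rotates h (\<Union>\<S>) ?\<beta> ?\<gamma>" for \<S>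
  proof (induction \<S> rule: finite_induct)
    case empty
    have "id \<in> alternating_perms" using alternating_perms_comp by (simp only: comp_closed_def)
    then show ?case by (intro bexI[of _ id]) (auto simp: rotates_def)
  next
    case (insert C \<S>)
    obtain P where P: "P \<in> A" "C = cylinder s P" using insert.prems by blast
    obtain h where h: "h \<in> alternating_perms" "rotates h (\<Union>\<S>) ?\<beta> ?\<gamma>" using insert by blast
    obtain f where f: "f \<in> alternating_perms" "rotates f C ?\<beta> ?\<gamma>" using step[OF P(1)] P(2) by blast
    have CA: "C \<subseteq> A" using s(2) P by (auto simp: determined_def)
    have SA: "\<Union>\<S> \<subseteq> A" using s(2) insert.prems unfolding determined_def by blast
    have "C \<inter> \<Union>\<S> = {}"
    proof (rule ccontr)
      assume "C \<inter> \<Union>\<S> \<noteq> {}"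
      then obtain x C' where x: "x \<in> C" "x \<in> C'" "C' \<in> \<S>" by blast
      then obtain P' where "C' = cylinder s P'" using insert.prems by blast
      then have "C = C'" using x P(2) cyl_eq[of x Q s P] cyl_eq[of x Q s P'] by simp
      then show False using x(3) insert.hyps by blast
    qed
    then have ne: "x \<noteq> y" "?\<beta> x \<noteq> ?\<beta> y" "?\<gamma> x \<noteq> ?\<gamma> y" "x \<noteq> ?\<beta> y" "x \<noteq> ?\<gamma> y" "?\<beta> x \<noteq> ?\<gamma> y" "?\<beta> x \<noteq> y"
      "?\<gamma> x \<noteq> y" "?\<gamma> x \<noteq> ?\<beta> y" if "x \<in> C" "y \<in> \<Union>\<S>" for x y
      using that CA SA disj[of x y] disj[of y x] inj_onD[OF inj(1), of x y] inj_onD[OF inj(2), of x y]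
      by (blast, blast, blast, blast, blast, blast, metis subsetD, metis subsetD, metis subsetD)
    have "(C \<union> ?\<beta> ` C \<union> ?\<gamma> ` C) \<inter> (\<Union>\<S> \<union> ?\<beta> ` \<Union>\<S> \<union> ?\<gamma> ` \<Union>\<S>) = {}"
      using ne by blast
    from rotates_comp[OF f(2) h(2) this]
    have "rotates (f \<circ> h) (\<Union>(insert C \<S>)) ?\<beta> ?\<gamma>" by simp
    moreover have "f \<circ> h \<in> alternating_perms" using comp_closedD[OF alternating_perms_comp f(1) h(1)] .
    ultimately show ?case by blast
  qed
  from this[OF fin order_refl] obtain h where h: "h \<in> alternating_perms"
    "rotates h (\<Union>(cylinder s ` A)) ?\<beta> ?\<gamma>" by blast
  have "\<Union>(cylinder s ` A) = A" using s(2) A cyl_self unfolding determined_def by blast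
  with h show thesis using that by simp
qed

section \<open>Arrows of a multisection of degree three\<close>

context
  fixes F :: "nat \<Rightarrow> nat \<Rightarrow> ((real ^ 'n) set \<times> (real ^ 'n)) set"
  assumes F: "multisection G 3 F"
begin

lemma F_bisection: "i \<in> {1..3} \<Longrightarrow> j \<in> {1..3} \<Longrightarrow> bisection G (F i j)"
  using F by (simp add: multisection_def)

lemma F_mult: "i \<in> {1..3} \<Longrightarrow> j \<in> {1..3} \<Longrightarrow> k \<in> {1..3} \<Longrightarrow> gset_mult G (F j k) (F i j) = F i k"
  using F by (simp add: multisection_def)

lemma F_unit: "i \<in> {1..3} \<Longrightarrow> (x, v) \<in> F i i \<Longrightarrow> x \<in> X \<and> v = 0"
  using F unit_arrows_iff[of x v] unfolding multisection_def by blast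

lemma F_disjoint: "i \<in> {1..3} \<Longrightarrow> j \<in> {1..3} \<Longrightarrow> i \<noteq> j \<Longrightarrow> (x, 0) \<in> F i i \<Longrightarrow> (x, 0) \<notin> F j j"
  using F unfolding multisection_def by blast

lemma F_mult_mem:
  assumes "i \<in> {1..3}" "j \<in> {1..3}" "k \<in> {1..3}" "(x, w) \<in> F i j" "(translate (- w) x, u) \<in> F j k"
  shows "(x, u + w) \<in> F i k"
  unfolding F_mult[OF assms(1-3), symmetric] gset_mult_iff using assms(4,5) by blast

lemma F_src:
  assumes "i \<in> {1..3}" "j \<in> {1..3}" "(x, v) \<in> F i j"
  shows "(x, 0) \<in> F i i"
proof -
  have "(x, v) \<in> gset_mult G (F i j) (F i i)" using F_mult[OF assms(1,1,2)] assms(3) by simp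
  then obtain w where "(x, w) \<in> F i i" unfolding gset_mult_iff by blast
  then show ?thesis using F_unit[OF assms(1)] by blast
qed

lemma F_total:
  assumes "i \<in> {1..3}" "j \<in> {1..3}" "(x, 0) \<in> F i i"
  obtains w where "(x, w) \<in> F i j" "(translate (- w) x, - w) \<in> F j i"
proof -
  have "(x, 0) \<in> gset_mult G (F j i) (F i j)" using F_mult[OF assms(1,2,1)] assms(3) by simp
  then obtain u w where "0 = u + w" "(x, w) \<in> F i j" "(translate (- w) x, u) \<in> F j i"
    unfolding gset_mult_iff by blast
  moreover from this(1) have "u = - w" by (simp add: eq_neg_iff_add_eq_0)
  ultimately show ?thesis using that by blast
qed

lemma F_inverse:
  assumes "i \<in> {1..3}" "j \<in> {1..3}" "(x, v) \<in> F i j"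
  shows "(translate (- v) x, - v) \<in> F j i"
proof -
  obtain w where "(x, w) \<in> F i j" "(translate (- w) x, - w) \<in> F j i"
    using F_total[OF assms(1,2) F_src[OF assms]] by blast
  then show ?thesis using bisection_src_inj[OF F_bisection[OF assms(1,2)] assms(3)] by blast
qed

lemma F_rng: "i \<in> {1..3} \<Longrightarrow> j \<in> {1..3} \<Longrightarrow> (x, v) \<in> F i j \<Longrightarrow> (translate (- v) x, 0) \<in> F j j"
  using F_src F_inverse by blast

text \<open>The first diagonal bisection seen in the hull; the orbits of the multisection are
  anchored here at displacement zero.\<close>

definition base :: "(real ^ 'n) set set" where
  "base = fst ` F 1 1"

lemma base_iff: "x \<in> base \<longleftrightarrow> (x, 0) \<in> F 1 1"
proof
  assume "x \<in> base"
  then obtain v where "(x, v) \<in> F 1 1" unfolding base_def by auto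
  then show "(x, 0) \<in> F 1 1" using F_unit[of 1 x v] by auto
next
  assume "(x, 0) \<in> F 1 1"
  then show "x \<in> base" unfolding base_def by (metis fst_conv imageI)
qed

lemma base_clopen: "openin (hull_topology Q) base" "closedin (hull_topology Q) base"
proof -
  have "bisection G (F 1 1)" by (rule F_bisection) auto
  then have "openin (hull_topology Q) base" "compactin (qc_arrow_topology Q) (F 1 1)"
    by (simp_all add: bisection_def base_def)
  moreover from this(2) have "compactin (hull_topology Q) base"
    unfolding base_def by (rule image_compactin[OF _ continuous_src])
  ultimately show "openin (hull_topology Q) base" "closedin (hull_topology Q) base"
    using compactin_imp_closedin[OF hausdorff_hull] by blast+
qed

text \<open>The letters \<open>j\<close>, \<open>k\<close> treat both rotations at once. Arrows from
  \<open>base\<close> have locally constant displacements, so \<open>rotation_exists\<close>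
  supplies \<open>h\<close>. One inclusion of the graphs is checked arrow by arrow; the other
  follows because the multisection permutation has an arrow over every point of the hull and the
  graph of \<open>h\<close> only one.\<close>

lemma multisection_rotation:
  assumes \<pi>: "\<pi> permutes {1..3}" "j \<in> {1..3}" "k \<in> {1..3}" "distinct [1, j, k]"
    and \<pi>_eq: "\<pi> 1 = j" "\<pi> j = k" "\<pi> k = 1"
  obtains h where "h \<in> alternating_perms" "multisection_perm G 3 F \<pi> = perm_graph h"
proof -
  have one: "1 \<in> {1..3::nat}" by simp
  have jk: "{1..3} = {1, j, k}" using \<pi>(2-4) by auto
  have "\<forall>x\<in>base. \<exists>w. (x, w) \<in> F 1 i" if "i \<in> {1..3}" for i
  proof
    fix x assume "x \<in> base"
    then show "\<exists>w. (x, w) \<in> F 1 i" using F_total[OF one that, of x] unfolding base_iff by blast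
  qed
  note * = this[THEN bchoice]
  obtain b where b: "\<And>x. x \<in> base \<Longrightarrow> (x, b x) \<in> F 1 j" using *[OF \<pi>(2)] by blast
  obtain c where c: "\<And>x. x \<in> base \<Longrightarrow> (x, c x) \<in> F 1 k" using *[OF \<pi>(3)] by blast
  note bis = F_bisection[OF one \<pi>(2)] F_bisection[OF one \<pi>(3)]
  obtain s0 where s0: "s0 > 0" "determined Q s0 base" using clopen_determined[OF base_clopen] by blast
  have baseX: "base \<subseteq> X" using s0(2) by (simp add: determined_def)
  \<comment> \<open>Points off \<open>base\<close> impose nothing, so the property makes sense on
    cylinders of the whole hull.\<close>
  define \<Phi> where "\<Phi> C \<longleftrightarrow> (\<exists>p q. \<forall>x\<in>C. x \<in> base \<longrightarrow> b x = p \<and> c x = q)" for C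
  have "\<exists>r>0. \<Phi> (cylinder r P)" if P: "P \<in> X" for P
  proof (cases "P \<in> base")
    case True
    obtain r where r: "r > 0" "\<forall>P'\<in>cylinder r P. (P', b P) \<in> F 1 j"
      using bisection_locally_constant[OF bis(1) b[OF True]] by blast
    obtain t where t: "t > 0" "\<forall>P'\<in>cylinder t P. (P', c P) \<in> F 1 k"
      using bisection_locally_constant[OF bis(2) c[OF True]] by blast
    have "b x = b P \<and> c x = c P" if x: "x \<in> cylinder (max r t) P" "x \<in> base" for x
    proof -
      have "x \<in> cylinder r P" "x \<in> cylinder t P"
        using x(1) cyl_mono[of r "max r t" Q P] cyl_mono[of t "max r t" Q P] by auto
      then have "(x, b P) \<in> F 1 j" "(x, c P) \<in> F 1 k" using r(2) t(2) by blast+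
      then show ?thesis
        using bisection_src_inj[OF bis(1) b[OF x(2)]] bisection_src_inj[OF bis(2) c[OF x(2)]] by blast
    qed
    then have "\<Phi> (cylinder (max r t) P)" unfolding \<Phi>_def by blast
    then show ?thesis using r(1) by (intro exI[of _ "max r t"]) auto
  next
    case False
    have "x \<notin> base" if "x \<in> cylinder s0 P" for x
      using that P False determined_complement[OF s0(2)] unfolding determined_def by blast
    then show ?thesis using s0(1) unfolding \<Phi>_def by blast
  qed
  moreover have "\<Phi> B" if "\<Phi> C" "B \<subseteq> C" for B C
    using that unfolding \<Phi>_def by blast
  ultimately obtain s1 where s1: "s1 > 0" "\<And>P. P \<in> X \<Longrightarrow> \<Phi> (cylinder s1 P)"
    using uniform_radius[of \<Phi>] by blast
  let ?s = "max s0 s1"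
  have s: "?s > 0" "determined Q ?s base" using s0 by (auto intro: determined_le)
  let ?\<beta> = "\<lambda>x. translate (- b x) x" and ?\<gamma> = "\<lambda>x. translate (- c x) x"
  have loc: "x \<in> base \<Longrightarrow> (x, 0) \<in> F 1 1" "x \<in> base \<Longrightarrow> (?\<beta> x, 0) \<in> F j j" "x \<in> base \<Longrightarrow> (?\<gamma> x, 0) \<in> F k k" for x
    using F_rng[OF one \<pi>(2) b] F_rng[OF one \<pi>(3) c] by (auto simp: base_iff)
  obtain h where h: "h \<in> alternating_perms" "rotates h base ?\<beta> ?\<gamma>"
  proof (rule rotation_exists[OF s])
    show "b x \<in> x" "c x \<in> x" if "x \<in> base" for x
      using bisection_arrowD(2)[OF bis(1) b[OF that]] bisection_arrowD(2)[OF bis(2) c[OF that]] .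
    show "b y = b x \<and> c y = c x" if x: "x \<in> base" and y: "y \<in> cylinder ?s x" for x y
    proof -
      have X: "x \<in> X" using x baseX by blast
      have "y \<in> base" using s(2) x y by (auto simp: determined_def)
      moreover have "y \<in> cylinder s1 x" using y cyl_mono[of s1 ?s Q x] by auto
      ultimately show ?thesis using s1(2)[OF X] cyl_self[OF X, of s1] x unfolding \<Phi>_def by metis
    qed
    show "x \<noteq> ?\<beta> y \<and> x \<noteq> ?\<gamma> y \<and> ?\<beta> x \<noteq> ?\<gamma> y" if "x \<in> base" "y \<in> base" for x y
      using loc(1)[OF that(1)] loc(2)[OF that(1)] loc(2,3)[OF that(2)]
        F_disjoint[OF one \<pi>(2), of x] F_disjoint[OF one \<pi>(3), of x] F_disjoint[OF \<pi>(2,3), of "?\<beta> x"] \<pi>(4)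
      by auto
    show "inj_on ?\<beta> base" "inj_on ?\<gamma> base"
      using bisection_rng_inj[OF bis(1) b b] bisection_rng_inj[OF bis(2) c c] by (auto simp: inj_on_def)
  qed blast
  have hf: "h \<in> full_perms" using h(1) alternating_perms_subset by blast
  have rot: "h x = ?\<beta> x" "h (?\<beta> x) = ?\<gamma> x" "h (?\<gamma> x) = x" if "x \<in> base" for x
    using h(2) that unfolding rotates_def by blast+
  have fix_h: "h y = y" if "y \<notin> base \<union> ?\<beta> ` base \<union> ?\<gamma> ` base" for y
    using h(2) that unfolding rotates_def by blast
  have loc_iff: "y \<in> base \<longleftrightarrow> (y, 0) \<in> F 1 1" "y \<in> ?\<beta> ` base \<longleftrightarrow> (y, 0) \<in> F j j"
    "y \<in> ?\<gamma> ` base \<longleftrightarrow> (y, 0) \<in> F k k" for y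
  proof -
    \<comment> \<open>The inverse of the arrow from \<open>y\<close> back to \<open>base\<close>
      must be the chosen arrow \<open>d\<close>, since source is injective on
      \<open>F 1 i\<close>.\<close>
    have *: "y \<in> (\<lambda>x. translate (- d x) x) ` base"
      if i: "i \<in> {1..3}" and y: "(y, 0) \<in> F i i" and d: "\<And>x. x \<in> base \<Longrightarrow> (x, d x) \<in> F 1 i" for i d
    proof -
      obtain w where w: "(y, w) \<in> F i 1" using F_total[OF i one y] by blast
      let ?x = "translate (- w) y"
      have x: "?x \<in> base" using F_rng[OF i one w] by (simp add: base_iff)
      have "(?x, - w) \<in> F 1 i" by (rule F_inverse[OF i one w])
      then have "d ?x = - w" using bisection_src_inj[OF F_bisection[OF one i] d[OF x]] by blast
      then have "y = translate (- d ?x) ?x" by simp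
      then show ?thesis using x by blast
    qed
    show "y \<in> base \<longleftrightarrow> (y, 0) \<in> F 1 1" by (rule base_iff)
    show "y \<in> ?\<beta> ` base \<longleftrightarrow> (y, 0) \<in> F j j" using *[OF \<pi>(2) _ b] loc(2) by blast
    show "y \<in> ?\<gamma> ` base \<longleftrightarrow> (y, 0) \<in> F k k" using *[OF \<pi>(3) _ c] loc(3) by blast
  qed
  have perm_iff: "(y, v) \<in> multisection_perm G 3 F \<pi> \<longleftrightarrow> (y, v) \<in> F 1 j \<or> (y, v) \<in> F j k \<or> (y, v) \<in> F k 1 \<or>
      (y \<in> X \<and> v = 0 \<and> y \<notin> base \<union> ?\<beta> ` base \<union> ?\<gamma> ` base)" for y v
  proof -
    have "(y, v) \<in> multisection_perm G 3 F \<pi> \<longleftrightarrow> (y, v) \<in> F 1 j \<or> (y, v) \<in> F j k \<or> (y, v) \<in> F k 1 \<or>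
        (y \<in> X \<and> v = 0 \<and> (y, v) \<notin> F 1 1 \<and> (y, v) \<notin> F j j \<and> (y, v) \<notin> F k k)"
      unfolding multisection_perm_def jk by (auto simp: unit_arrows_iff \<pi>_eq simp del: One_nat_def)
    then show ?thesis unfolding Un_iff loc_iff by blast
  qed
  have fwd: "(y, v) \<in> perm_graph h" if yv: "(y, v) \<in> multisection_perm G 3 F \<pi>" for y v
  proof -
    have arrow: "y \<in> X \<and> v \<in> y" if "(y, v) \<in> F i i'" "i \<in> {1..3}" "i' \<in> {1..3}" for i i'
      using bisection_arrowD[OF F_bisection[OF that(2,3)] that(1)] by blast
    consider "(y, v) \<in> F 1 j" | "(y, v) \<in> F j k" | "(y, v) \<in> F k 1"
      | "y \<in> X" "v = 0" "y \<notin> base \<union> ?\<beta> ` base \<union> ?\<gamma> ` base"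
      using yv unfolding perm_iff by blast
    then show ?thesis
    proof cases
      case 1
      then have y: "y \<in> base" using F_src[OF one \<pi>(2)] by (simp add: base_iff)
      then have "v = b y" using bisection_src_inj[OF bis(1) 1 b] by blast
      then show ?thesis using rot(1)[OF y] arrow[OF 1 one \<pi>(2)] by (simp add: perm_graph_iff)
    next
      case 2
      then have "y \<in> ?\<beta> ` base" unfolding loc_iff by (rule F_src[OF \<pi>(2,3)])
      then obtain x where x: "x \<in> base" "y = ?\<beta> x" by blast
      have "(x, v + b x) \<in> F 1 k" using F_mult_mem[OF one \<pi>(2,3) b[OF x(1)]] 2 x(2) by blast
      then have "v + b x = c x" using bisection_src_inj[OF bis(2) _ c[OF x(1)]] by blast
      then have "translate (- v) y = ?\<gamma> x" by (simp add: x(2) flip: \<open>v + b x = c x\<close>)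
      then show ?thesis using rot(2)[OF x(1)] arrow[OF 2 \<pi>(2,3)] by (simp add: perm_graph_iff x(2))
    next
      case 3
      then have "y \<in> ?\<gamma> ` base" unfolding loc_iff by (rule F_src[OF \<pi>(3) one])
      then obtain x where x: "x \<in> base" "y = ?\<gamma> x" by blast
      have "(x, v + c x) \<in> F 1 1" using F_mult_mem[OF one \<pi>(3) one c[OF x(1)]] 3 x(2) by blast
      then have "v + c x = 0" using F_unit[OF one] by blast
      then have "v = - c x" by (simp add: eq_neg_iff_add_eq_0)
      then have "translate (- v) y = x" by (simp add: x(2))
      then show ?thesis using rot(3)[OF x(1)] arrow[OF 3 \<pi>(3) one] by (simp add: perm_graph_iff x(2))
    next
      case 4
      then show ?thesis using fix_h[OF 4(3)] zero_in[OF 4(1)] by (simp add: perm_graph_iff)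
    qed
  qed
  have total: "\<exists>v. (y, v) \<in> multisection_perm G 3 F \<pi>" if "y \<in> X" for y
  proof (cases "y \<in> base \<union> ?\<beta> ` base \<union> ?\<gamma> ` base")
    case True
    then have "(y, 0) \<in> F 1 1 \<or> (y, 0) \<in> F j j \<or> (y, 0) \<in> F k k" unfolding Un_iff loc_iff by blast
    then obtain v where "(y, v) \<in> F 1 j \<or> (y, v) \<in> F j k \<or> (y, v) \<in> F k 1"
      using F_total[OF one \<pi>(2), of y] F_total[OF \<pi>(2,3), of y] F_total[OF \<pi>(3) one, of y] by blast
    then show ?thesis unfolding perm_iff by blast
  next
    case False
    then show ?thesis using that unfolding perm_iff by blast
  qed
  have bwd: "(y, v) \<in> multisection_perm G 3 F \<pi>" if yv: "(y, v) \<in> perm_graph h" for y v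
  proof -
    have y: "y \<in> X" "h y = translate (- v) y" using yv by (auto simp: perm_graph_iff)
    obtain w where w: "(y, w) \<in> multisection_perm G 3 F \<pi>" using total[OF y(1)] by blast
    then have "h y = translate (- w) y" using fwd by (auto simp: perm_graph_iff)
    then have "- v = - w" using y by (intro translate_hull_inj[OF y(1)]) simp
    then show ?thesis using w by simp
  qed
  have "multisection_perm G 3 F \<pi> = perm_graph h" using fwd bwd by auto
  with h(1) show thesis by (rule that)
qed

lemma multisection_perm_id: "multisection_perm G 3 F id = perm_graph id"
proof -
  have "F i i \<subseteq> unit_arrows G" if "i \<in> {1..3}" for i using F that by (simp add: multisection_def)
  then have "(\<Union>i\<in>{1..3}. F i i) \<subseteq> unit_arrows G" by blast
  then show ?thesis unfolding multisection_perm_def perm_graph_id id_apply by blast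
qed

lemma multisection_alt_subset: "multisection_alt G 3 F \<subseteq> perm_graph ` alternating_perms"
proof
  fix a assume "a \<in> multisection_alt G 3 F"
  then obtain \<pi> where a: "a = multisection_perm G 3 F \<pi>" and \<pi>: "\<pi> permutes {1..3}" "evenperm \<pi>"
    unfolding multisection_alt_def by blast
  consider "\<pi> = id" | "\<pi> 1 = 2" "\<pi> 2 = 3" "\<pi> 3 = 1" | "\<pi> 1 = 3" "\<pi> 3 = 2" "\<pi> 2 = 1"
    using evenperm_three_cases[OF \<pi>] by blast
  then show "a \<in> perm_graph ` alternating_perms"
  proof cases
    case 1
    have "id \<in> alternating_perms" using alternating_perms_comp by (simp only: comp_closed_def)
    then show ?thesis unfolding a 1 multisection_perm_id by (rule imageI)
  next
    case 2
    obtain h where "h \<in> alternating_perms" "multisection_perm G 3 F \<pi> = perm_graph h"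
      using multisection_rotation[OF \<pi>(1) _ _ _ 2] by auto
    then show ?thesis unfolding a by blast
  next
    case 3
    obtain h where "h \<in> alternating_perms" "multisection_perm G 3 F \<pi> = perm_graph h"
      using multisection_rotation[OF \<pi>(1) _ _ _ 3] by auto
    then show ?thesis unfolding a by blast
  qed
qed

end

section \<open>The alternating full group\<close>

abbreviation "alternating_group \<equiv> alternating_full_group G"

lemma perm_graph_hom: "group_hom perm_group (full_group G) perm_graph"
  using perm_graph_iso group_perm_group group_full_group
  by (simp add: group_hom_def group_hom_axioms_def iso_def)

lemma perm_graph_inj: "inj_on perm_graph full_perms"
  using perm_graph_iso by (simp add: iso_def bij_betw_def)

text \<open>Multisections of degree three yield only products of elements of \<open>cycles\<close>,
  and each element of \<open>cycles\<close> arises from one, so both families generate the same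
  subgroup.\<close>

lemma carrier_alternating_group: "carrier alternating_group = perm_graph ` alternating_perms"
proof -
  let ?T = "\<Union>F\<in>{F. multisection G 3 F}. multisection_alt G 3 F"
  have img: "generate (full_group G) (perm_graph ` cycles) = perm_graph ` alternating_perms"
    using group_hom.generate_img[OF perm_graph_hom] cycles_subset_full_perms by simp
  have sub: "subgroup (perm_graph ` alternating_perms) (full_group G)"
    unfolding img[symmetric] using cycles_subset_full_perms perm_graph_in_full_group
    by (intro group.generate_is_subgroup[OF group_full_group]) blast
  have "?T \<subseteq> perm_graph ` alternating_perms" using multisection_alt_subset by blast
  then have "generate (full_group G) ?T \<subseteq> perm_graph ` alternating_perms"
    using sub by (rule group.generate_subgroup_incl[OF group_full_group])
  moreover have "perm_graph ` cycles \<subseteq> ?T"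
  proof
    fix a assume "a \<in> perm_graph ` cycles"
    then obtain f where f: "f \<in> cycles" "a = perm_graph f" by blast
    then show "a \<in> ?T" using cycle_in_multisection_alt[OF f(1)] by blast
  qed
  then have "perm_graph ` alternating_perms \<subseteq> generate (full_group G) ?T"
    unfolding img[symmetric] by (rule group.mono_generate[OF group_full_group])
  ultimately show ?thesis by (simp add: alternating_full_group_def)
qed

lemma alternating_perms_subgroup: "subgroup alternating_perms perm_group"
  using cycles_subset_full_perms by (intro group.generate_is_subgroup[OF group_perm_group]) simp

lemma alternating_group_subgroup: "subgroup (carrier alternating_group) (full_group G)"
  unfolding carrier_alternating_group
  using group_hom.subgroup_img_is_subgroup[OF perm_graph_hom alternating_perms_subgroup] .

lemma alternating_group_eq: "alternating_group = (full_group G)\<lparr>carrier := carrier alternating_group\<rparr>"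
  by (simp add: alternating_full_group_def)

lemma group_alternating_group: "group alternating_group"
  using group.subgroup_imp_group[OF group_full_group alternating_group_subgroup] alternating_group_eq by simp

lemma alternating_group_finitely_generated: "finitely_generated_group alternating_group"
proof -
  obtain S where S: "finite S" "S \<subseteq> cycles" "\<And>H. comp_closed H \<Longrightarrow> S \<subseteq> H \<Longrightarrow> cycles \<subseteq> H"
    using cycles_finitely_generated by blast
  have Sf: "S \<subseteq> full_perms" using S(2) cycles_subset_full_perms by blast
  have "comp_closed (generate perm_group S)"
    unfolding comp_closed_def
    using generate.one[of perm_group S] generate.eng[of _ perm_group S] by simp
  \<comment> \<open>The generated subgroup is itself composition-closed, so it may serve as the
    \<open>H\<close> that must contain all of \<open>cycles\<close>.\<close>
  moreover have "S \<subseteq> generate perm_group S" by (blast intro: generate.incl)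
  ultimately have "cycles \<subseteq> generate perm_group S" by (rule S(3))
  moreover have "subgroup (generate perm_group S) perm_group"
    using Sf by (intro group.generate_is_subgroup[OF group_perm_group]) simp
  ultimately have "alternating_perms \<subseteq> generate perm_group S"
    by (rule group.generate_subgroup_incl[OF group_perm_group])
  moreover have "generate perm_group S \<subseteq> alternating_perms" using S(2) by (rule group.mono_generate[OF group_perm_group])
  ultimately have "generate perm_group S = alternating_perms" by blast
  then have "generate (full_group G) (perm_graph ` S) = carrier alternating_group"
    unfolding carrier_alternating_group using group_hom.generate_img[OF perm_graph_hom, of S] Sf by simp
  moreover have sub: "perm_graph ` S \<subseteq> carrier alternating_group"
    unfolding carrier_alternating_group using S(2) by (blast intro: generate.incl)
  ultimately have "generate alternating_group (perm_graph ` S) = carrier alternating_group"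
    using group.generate_consistent[OF group_full_group sub alternating_group_subgroup] alternating_group_eq by simp
  then show ?thesis
    unfolding finitely_generated_group_def using group_alternating_group S(1) sub by blast
qed

lemma alternating_group_simple: "is_simple_group alternating_group"
  unfolding is_simple_group_def
proof (intro conjI allI impI group_alternating_group)
  have one: "\<one>\<^bsub>alternating_group\<^esub> = perm_graph id"
    by (simp add: alternating_full_group_def full_group_def perm_graph_id)
  have mult: "perm_graph g \<otimes>\<^bsub>alternating_group\<^esub> perm_graph h = perm_graph (g \<circ> h)"
    if "g \<in> full_perms" "h \<in> full_perms" for g h
    using perm_graph_comp[OF that] by (simp add: alternating_full_group_def full_group_def)
  interpret A: group alternating_group by (rule group_alternating_group)
  note sub = alternating_perms_subset
  have invA: "finv g \<in> alternating_perms" if "g \<in> alternating_perms" for g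
    using subgroup.m_inv_closed[OF alternating_perms_subgroup that] that sub by (simp add: perm_group_inv subset_iff)
  have inv_graph: "m_inv alternating_group (perm_graph g) = perm_graph (finv g)" if g: "g \<in> alternating_perms" for g
  proof (rule A.inv_equality)
    have "finv g \<circ> g = id" using g sub full_permsD(1) by (auto simp: bij_is_inj)
    then show "perm_graph (finv g) \<otimes>\<^bsub>alternating_group\<^esub> perm_graph g = \<one>\<^bsub>alternating_group\<^esub>"
      using mult[of "finv g" g] g invA[OF g] sub by (auto simp: one)
    show "perm_graph g \<in> carrier alternating_group" "perm_graph (finv g) \<in> carrier alternating_group"
      using g invA[OF g] by (auto simp: carrier_alternating_group)
  qed
  obtain f0 where f0: "f0 \<in> cycles" "f0 \<noteq> id" using nontrivial_cycle by blast
  have "perm_graph f0 \<in> carrier alternating_group"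
    unfolding carrier_alternating_group using f0(1) by (intro imageI generate.incl)
  moreover have "perm_graph f0 \<noteq> perm_graph id"
    using f0 cycles_subset_full_perms id_in_full_perms inj_onD[OF perm_graph_inj, of f0 id] by blast
  ultimately show "carrier alternating_group \<noteq> {\<one>\<^bsub>alternating_group\<^esub>}" unfolding one by blast
  fix N assume "N \<lhd> alternating_group"
  then have N: "subgroup N alternating_group"
    and conj: "\<And>x h. x \<in> carrier alternating_group \<Longrightarrow> h \<in> N \<Longrightarrow>
      x \<otimes>\<^bsub>alternating_group\<^esub> h \<otimes>\<^bsub>alternating_group\<^esub> m_inv alternating_group x \<in> N"
    using A.normal_inv_iff by blast+
  \<comment> \<open>Normal subgroups are pulled back to permutations, where supports can be
    compared.\<close>
  define M where "M = {g \<in> alternating_perms. perm_graph g \<in> N}"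
  have MN: "N = perm_graph ` M"
    using subgroup.subset[OF N] unfolding M_def carrier_alternating_group by blast
  have M_id: "id \<in> M"
    using alternating_perms_comp subgroup.one_closed[OF N] unfolding one M_def comp_closed_def by blast
  have M_comp: "f \<circ> g \<in> M" if "f \<in> M" "g \<in> M" for f g
  proof -
    have fg: "f \<in> alternating_perms" "g \<in> alternating_perms" "perm_graph f \<in> N" "perm_graph g \<in> N"
      using that by (auto simp: M_def)
    then have full: "f \<in> full_perms" "g \<in> full_perms" using sub by blast+
    have "perm_graph (f \<circ> g) \<in> N" using subgroup.m_closed[OF N fg(3,4)] unfolding mult[OF full] .
    then show ?thesis
      unfolding M_def using comp_closedD[OF alternating_perms_comp fg(1,2)] by blast
  qed
  have M_inv: "finv g \<in> M" if "g \<in> M" for g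
    using that subgroup.m_inv_closed[OF N, of "perm_graph g"] inv_graph[of g] invA by (auto simp: M_def)
  show "N = carrier alternating_group \<or> N = {\<one>\<^bsub>alternating_group\<^esub>}"
  proof (cases "M \<subseteq> {id}")
    case True
    moreover have "perm_graph id \<in> N" using subgroup.one_closed[OF N] by (simp add: one)
    ultimately show ?thesis unfolding one MN by auto
  next
    case False
    then obtain g where g: "g \<in> M" "g \<noteq> id" by blast
    have "cycles \<subseteq> M"
    proof (rule cycles_subset_normal[OF _ _ _ _ g])
      show "comp_closed M" unfolding comp_closed_def using M_id M_comp by blast
      show "M \<subseteq> full_perms" using sub by (auto simp: M_def)
      show "finv g \<in> M" if "g \<in> M" for g using that by (rule M_inv)
      show "f \<circ> (g \<circ> finv f) \<in> M" if f: "f \<in> cycles" and "g \<in> M" for f g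
      proof -
        have g: "g \<in> alternating_perms" "perm_graph g \<in> N" using \<open>g \<in> M\<close> by (auto simp: M_def)
        have f': "f \<in> alternating_perms" using f by (rule generate.incl)
        have F: "f \<in> full_perms" "g \<in> full_perms" "finv f \<in> full_perms" using f' g invA[OF f'] sub by auto
        have "perm_graph f \<otimes>\<^bsub>alternating_group\<^esub> perm_graph g \<otimes>\<^bsub>alternating_group\<^esub> perm_graph (finv f) \<in> N"
          using conj[of "perm_graph f" "perm_graph g"] f' g inv_graph[OF f'] by (simp add: carrier_alternating_group)
        then have "perm_graph ((f \<circ> g) \<circ> finv f) \<in> N"
          using F by (simp add: mult comp_in_full_perms)
        moreover have "f \<circ> (g \<circ> finv f) \<in> alternating_perms"
          using f' g invA[OF f'] by (intro comp_closedD[OF alternating_perms_comp])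
        ultimately show ?thesis unfolding M_def by (simp only: comp_assoc mem_Collect_eq simp_thms)
      qed
    qed
    moreover have "alternating_perms \<subseteq> M"
    proof
      fix g assume "g \<in> alternating_perms"
      then show "g \<in> M"
      proof (induction rule: generate.induct)
        case one
        show ?case unfolding perm_group_simps by (rule M_id)
      next
        case (incl h)
        then show ?case using \<open>cycles \<subseteq> M\<close> by blast
      next
        case (inv h)
        then have "h \<in> M" "h \<in> full_perms" using \<open>cycles \<subseteq> M\<close> cycles_subset_full_perms by auto
        then show ?case using M_inv by (simp add: perm_group_inv)
      next
        case (eng h1 h2)
        then show ?case unfolding perm_group_simps by (intro M_comp)
      qed
    qed
    ultimately show ?thesis unfolding MN carrier_alternating_group by (auto simp: M_def)
  qed
qed

end

theorem theorem6p7: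
  fixes Q :: "(real ^ 'n) set"
  assumes "quasicrystal Q" and "aperiodic Q"
  shows "is_simple_group (qc_alternating_group Q) \<and>
         finitely_generated_group (qc_alternating_group Q)"
proof -
  interpret aperiodic_quasicrystal Q
    using assms by unfold_locales
  show ?thesis
    unfolding qc_alternating_group_def
    using alternating_group_simple alternating_group_finitely_generated by blast
qed

end
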